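(* Let $\Omega\subset\mathbb{R}^2$ be a ring-shaped domain with inner boundary component $\Gamma_i$ and outer boundary component $\Gamma_o$, and let $u$ be the solution to $\Delta u=-2$ in $\Omega$, $u=0$ on $\partial\Omega$. Suppose that $u$ has infinitely many maximum points and that $\overline\tau(\Gamma_o)<\sqrt2$. Then the expected core radii $R(\Gamma_o)$ and $R(\Gamma_i)$ are both well defined and positive. Moreover, they satisfy $$R(\Gamma_o)\geq R(\Gamma_i)>0,$$ and the equality $R(\Gamma_o)=R(\Gamma_i)$ holds if and only if $(\Omega,u)$ is equivalent, i.e. equal up to translations and rescaling, to the ring-shaped model solution $(\Omega_R,u_R)$ whose core radius $R$ is the common value $R(\Gamma_o)=R=R(\Gamma_i)$.
   Context: A domain is a connected open set. A ring-shaped domain is a bounded domain in $\mathbb{R}^2$ with smooth boundary having precisely two connected boundary components, the inner one $\Gamma_i$ and the outer one $\Gamma_o$. Notation: $u_{\max}=\max_\Omega u$; the maximum points of $u$ are the points of $\{p\in\Omega:u(p)=u_{\max}\}$. Rescaling: for $\lambda>0$, $(\Omega,u)$ is replaced by $(\lambda\Omega,\lambda^2u(\cdot/\lambda))$. Ring-shaped model solution with core radius $R\in(0,1)$: let $r_i(R)\in(0,R)$ be the smallest positive zero of $\rho\mapsto1-\rho^2+2R^2\log\rho$, and set $\Omega_R=\{r_i(R)<|x|<1\}$, $u_R(x)=\frac{1-|x|^2}{2}+R^2\log|x|$. Normalised wall shear stress (NWSS) of a connected component $\Gamma$ of $\partial\Omega$: $\overline\tau(\Gamma)=\dfrac{\max_\Gamma|\nabla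 u|}{\sqrt{2u_{\max}}}$. Outer NWSS function $\overline\tau_o:[0,1)\to[1,\sqrt2)$: $\overline\tau_o(0)=1$ and $\overline\tau_o(R)=\dfrac{1-R^2}{\sqrt{1-R^2+2R^2\log R}}$ for $0<R<1$; it is a continuous, strictly increasing bijection. Inner NWSS function $\overline\tau_i:(0,1]\to[\sqrt2,+\infty)$: $\overline\tau_i(R)=\dfrac{R^2-r_i(R)^2}{r_i(R)\sqrt{1-R^2+2R^2\log R}}$ for $0<R<1$ and $\overline\tau_i(1)=\sqrt2$; it is a continuous, strictly decreasing bijection. Expected core radius of a boundary component $\Gamma$: $R(\Gamma)=\overline\tau_o^{-1}(\overline\tau(\Gamma))$ if $1\leq\overline\tau(\Gamma)<\sqrt2$, and $R(\Gamma)=\overline\tau_i^{-1}(\overline\tau(\Gamma))$ if $\overline\tau(\Gamma)\geq\sqrt2$ (it is not defined if $\overline\tau(\Gamma)<1$). *)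

theory Defs
  imports "HOL-Analysis.Analysis"
begin

text \<open>Only used for open \<open>S\<close>, where this is the usual class \<open>C\<^sup>k(S)\<close>.\<close>

fun Ck_on :: "nat \<Rightarrow> ('a::euclidean_space \<Rightarrow> real) \<Rightarrow> 'a set \<Rightarrow> bool" where
  "Ck_on 0 f S \<longleftrightarrow> continuous_on S f"
| "Ck_on (Suc k) f S \<longleftrightarrow>
     f differentiable_on S \<and> (\<forall>v. Ck_on k (\<lambda>x. frechet_derivative f (at x) v) S)"

definition smooth_on :: "('a::euclidean_space \<Rightarrow> real) \<Rightarrow> 'a set \<Rightarrow> bool" where
  "smooth_on f S \<longleftrightarrow> (\<forall>k. Ck_on k f S)"

text \<open>
  The gradient is taken relative to a set, so that it also makes sense at boundary points:
  for \<open>S\<close> the closure of a smooth domain the derivative within \<open>S\<close> is unique at every point of \<open>S\<close>,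
  and at interior points of \<open>S\<close> it is the ordinary derivative.
\<close>

definition grad_within :: "'a::euclidean_space set \<Rightarrow> ('a \<Rightarrow> real) \<Rightarrow> 'a \<Rightarrow> 'a" where
  "grad_within S f x = (\<Sum>b\<in>Basis. frechet_derivative f (at x within S) b *\<^sub>R b)"

definition laplacian :: "('a::euclidean_space \<Rightarrow> real) \<Rightarrow> 'a \<Rightarrow> real" where
  "laplacian f x =
     (\<Sum>b\<in>Basis. frechet_derivative (\<lambda>y. frechet_derivative f (at y) b) (at x) b)"

text \<open>Near each boundary point, \<open>\<Omega>\<close> is a strict sublevel set of a smooth submersion.\<close>

definition smooth_boundary :: "'a::euclidean_space set \<Rightarrow> bool" where
  "smooth_boundary \<Omega> \<longleftrightarrow>
     (\<forall>p\<in>frontier \<Omega>. \<exists>U \<rho>. open U \<and> p \<in> U \<and> smooth_on \<rho> U \<and>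
        (\<forall>x\<in>U. frechet_derivative \<rho> (at x) \<noteq> (\<lambda>v. 0)) \<and>
        \<Omega> \<inter> U = {x \<in> U. \<rho> x < 0})"

definition ring_shaped_domain :: "(real^2) set \<Rightarrow> (real^2) set \<Rightarrow> (real^2) set \<Rightarrow> bool" where
  "ring_shaped_domain \<Omega> \<Gamma>\<^sub>i \<Gamma>\<^sub>o \<longleftrightarrow>
     open \<Omega> \<and> connected \<Omega> \<and> \<Omega> \<noteq> {} \<and> bounded \<Omega> \<and> smooth_boundary \<Omega> \<and>
     components (frontier \<Omega>) = {\<Gamma>\<^sub>i, \<Gamma>\<^sub>o} \<and> \<Gamma>\<^sub>i \<noteq> \<Gamma>\<^sub>o \<and> \<Gamma>\<^sub>i \<subseteq> inside \<Gamma>\<^sub>o"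

text \<open>
  Classical solutions of \<open>\<Delta>u = -2\<close> in \<open>\<Omega>\<close>, \<open>u = 0\<close> on \<open>\<partial>\<Omega>\<close>, in \<open>C\<^sup>2(\<Omega>) \<inter> C\<^sup>1(closure \<Omega>)\<close>; the
  regularity up to the boundary (automatic when \<open>\<partial>\<Omega>\<close> is smooth) is what gives \<open>|\<nabla>u|\<close> a
  meaning on \<open>\<partial>\<Omega>\<close>.
\<close>

definition torsion_solution :: "'a::euclidean_space set \<Rightarrow> ('a \<Rightarrow> real) \<Rightarrow> bool" where
  "torsion_solution \<Omega> u \<longleftrightarrow>
     Ck_on 2 u \<Omega> \<and>
     u differentiable_on closure \<Omega> \<and>
     continuous_on (closure \<Omega>) (grad_within (closure \<Omega>) u) \<and>
     (\<forall>x\<in>\<Omega>. laplacian u x = - 2) \<and>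
     (\<forall>x\<in>frontier \<Omega>. u x = 0)"

definition u_max :: "'a set \<Rightarrow> ('a \<Rightarrow> real) \<Rightarrow> real" where
  "u_max \<Omega> u = (SUP x\<in>\<Omega>. u x)"

definition max_points :: "'a set \<Rightarrow> ('a \<Rightarrow> real) \<Rightarrow> 'a set" where
  "max_points \<Omega> u = {p \<in> \<Omega>. u p = u_max \<Omega> u}"

definition NWSS ::
  "'a::euclidean_space set \<Rightarrow> ('a \<Rightarrow> real) \<Rightarrow> 'a set \<Rightarrow> real" where
  "NWSS \<Omega> u \<Gamma> = (SUP x\<in>\<Gamma>. norm (grad_within (closure \<Omega>) u x)) / sqrt (2 * u_max \<Omega> u)"

definition r_inner :: "real \<Rightarrow> real" where
  "r_inner R = (LEAST \<rho>. 0 < \<rho> \<and> 1 - \<rho>\<^sup>2 + 2 * R\<^sup>2 * ln \<rho> = 0)"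

definition model_domain :: "real \<Rightarrow> (real^2) set" where
  "model_domain R = {x. r_inner R < norm x \<and> norm x < 1}"

definition model_solution :: "real \<Rightarrow> real^2 \<Rightarrow> real" where
  "model_solution R x = (1 - (norm x)\<^sup>2) / 2 + R\<^sup>2 * ln (norm x)"

text \<open>The functions \<open>tau_outer\<close> and \<open>tau_inner\<close> are meaningful on \<open>[0,1)\<close> and \<open>(0,1]\<close> only.\<close>

definition tau_outer :: "real \<Rightarrow> real" where
  "tau_outer R = (if R = 0 then 1 else (1 - R\<^sup>2) / sqrt (1 - R\<^sup>2 + 2 * R\<^sup>2 * ln R))"

definition tau_inner :: "real \<Rightarrow> real" where
  "tau_inner R =
     (if R = 1 then sqrt 2
      else (R\<^sup>2 - (r_inner R)\<^sup>2) / (r_inner R * sqrt (1 - R\<^sup>2 + 2 * R\<^sup>2 * ln R)))"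

definition expected_core_radius ::
  "(real^2) set \<Rightarrow> (real^2 \<Rightarrow> real) \<Rightarrow> (real^2) set \<Rightarrow> real option" where
  "expected_core_radius \<Omega> u \<Gamma> =
     (if NWSS \<Omega> u \<Gamma> < 1 then None
      else if NWSS \<Omega> u \<Gamma> < sqrt 2 then Some (the_inv_into {0..<1} tau_outer (NWSS \<Omega> u \<Gamma>))
      else Some (the_inv_into {0<..1} tau_inner (NWSS \<Omega> u \<Gamma>)))"

text \<open>Only the values of \<open>u\<close> on the closure of \<open>\<Omega>\<close> matter.\<close>

definition equivalent_pairs ::
  "(real^2) set \<Rightarrow> (real^2 \<Rightarrow> real) \<Rightarrow> (real^2) set \<Rightarrow> (real^2 \<Rightarrow> real) \<Rightarrow> bool" where
  "equivalent_pairs \<Omega> u \<Omega>' u' \<longleftrightarrow>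
     (\<exists>c. \<exists>s>0. \<Omega> = (\<lambda>x. c + s *\<^sub>R x) ` \<Omega>' \<and>
        (\<forall>x\<in>closure \<Omega>. u x = s\<^sup>2 * u' ((x - c) /\<^sub>R s)))"

end

theory Submission
  imports Defs "HOL-Complex_Analysis.Complex_Analysis" "HOL-Real_Asymp.Real_Asymp"
begin

text \<open>
  Write \<open>v = max u - u\<close>. On a radial model solution \<open>|\<nabla>u|\<^sup>2\<close> is a function of \<open>v\<close> depending only on the
  squared radius \<open>a\<close> of the circle of maximum points and on the side of that circle, and \<open>a\<close> corresponds
  to the core radius. A maximum principle shows that \<open>|\<nabla>u|\<^sup>2\<close> is bounded by the model value for \<open>a\<close> on a
  region between a boundary component and the maximum set as soon as this holds on the boundary
  component, that is, for the value \<open>a\<close> given by its NWSS.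

  Since \<open>u = - |z|\<^sup>2 / 2 + Re f\<close> locally with \<open>f\<close> holomorphic, the critical points are the fixed points of
  \<open>z \<mapsto> cnj (f' z)\<close>, and the non-isolated maximum points form a closed set \<open>ridge\<close> which is
  locally an analytic arc. It has to separate \<open>\<Gamma>\<^sub>i\<close> from \<open>\<Gamma>\<^sub>o\<close>, because \<open>u\<close> has no interior minimum. Expanding
  \<open>u\<close> to third order along the normal at a point where the ridge borders both regions, the comparison from outside
  bounds the curvature from below by \<open>1 / sqrt a\<^sub>o\<close> and the one from inside bounds it from above by
  \<open>1 / sqrt a\<^sub>i\<close>, whence \<open>a\<^sub>i \<le> a\<^sub>o\<close>. In case of equality the curvature is constant, which determines \<open>f'\<close>
  near the ridge and, by analytic continuation, everywhere.
\<close>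

section \<open>Model solutions\<close>


text \<open>In the variable \<open>x = \<rho>\<^sup>2 / a\<close> a radial solution vanishes where
  \<open>eta x = 2 * m / a\<close>, an equation with one root on each side of \<open>1\<close>, and
  its squared NWSS at a root is \<open>shear x\<close>. So the NWSS \<tau> of a boundary component
  selects a root of \<open>shear x = \<tau>\<^sup>2\<close> and with it
  \<open>a = 2 * m / eta x\<close>; the core radius is \<open>1 / sqrt x\<close> for the root above
  \<open>1\<close> at the same level of \<open>eta\<close>. Comparing core radii thus means
  comparing levels of \<open>eta\<close>: a higher level means a smaller \<open>a\<close> and a
  smaller core radius.

  The obstacle is that the shape of the maximum set is not known beforehand: it may have isolated
  points, and the ridge is not known to be a single closed curve. The comparison tolerates this,
  because it only asks that the closure of the region add nothing but points of \<open>M\<close> and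
  of one boundary component. The curvature argument needs just one ridge point with the inner region
  on one side and the outer region on the other, and rigidity just a small arc of such
  points.\<close>

definition eta :: "real \<Rightarrow> real" where "eta x = x - 1 - ln x"

text \<open>The squared NWSS of a radial solution on a zero circle of squared radius
  \<open>a * x\<close>: there \<open>|\<nabla>u|\<^sup>2 = a * (x - 1)\<^sup>2 / x\<close> and
  \<open>2 * m = a * eta x\<close>.\<close>

definition shear :: "real \<Rightarrow> real" where "shear x = (x - 1)\<^sup>2 / (x * eta x)"

lemma eta_pos: "0 < x \<Longrightarrow> x \<noteq> 1 \<Longrightarrow> 0 < eta x"
  using ln_le_minus_one[of x] ln_eq_minus_one[of x] unfolding eta_def by fastforce

lemma eta_deriv: "0 < x \<Longrightarrow> (eta has_real_derivative (x - 1) / x) (at x)"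
  unfolding eta_def[abs_def] by (auto intro!: derivative_eq_intros simp: field_simps)

lemma eta_cont: "S \<subseteq> {0<..} \<Longrightarrow> continuous_on S eta"
  unfolding eta_def[abs_def] by (intro continuous_intros) auto

lemma eta_less: "1 \<le> x \<Longrightarrow> x < y \<Longrightarrow> eta x < eta y"
proof (rule DERIV_pos_imp_increasing_open[of x y eta])
  fix z assume "1 \<le> x" "x < z" "z < y"
  then have "(eta has_real_derivative (z - 1) / z) (at z)" "0 < (z - 1) / z"
    by (auto intro: eta_deriv)
  then show "\<exists>d. (eta has_real_derivative d) (at z) \<and> 0 < d" by blast
qed (auto intro: eta_cont)

lemma eta_greater: "0 < x \<Longrightarrow> x < y \<Longrightarrow> y \<le> 1 \<Longrightarrow> eta y < eta x"
proof (rule DERIV_neg_imp_decreasing_open[of x y eta])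
  fix z assume "0 < x" "y \<le> 1" "x < z" "z < y"
  then have "(eta has_real_derivative (z - 1) / z) (at z)" "(z - 1) / z < 0"
    by (auto intro: eta_deriv divide_neg_pos)
  then show "\<exists>d. (eta has_real_derivative d) (at z) \<and> d < 0" by blast
qed (auto intro: eta_cont)

lemma eta_inj_outer: "1 \<le> x \<Longrightarrow> 1 \<le> y \<Longrightarrow> eta x = eta y \<Longrightarrow> x = y"
  by (metis eta_less less_irrefl linorder_neqE)

lemma eta_inj_inner: "0 < x \<Longrightarrow> x \<le> 1 \<Longrightarrow> 0 < y \<Longrightarrow> y \<le> 1 \<Longrightarrow> eta x = eta y \<Longrightarrow> x = y"
  by (metis eta_greater less_irrefl linorder_neqE)

lemma eta_one [simp]: "eta 1 = 0"
  by (simp add: eta_def)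

lemma eta_surj_outer:
  assumes "0 < c" obtains x where "1 < x" "eta x = c"
proof -
  have "filterlim eta at_top at_top" unfolding eta_def[abs_def] by real_asymp
  then have "\<forall>\<^sub>F x in at_top. c \<le> eta x \<and> 1 \<le> x"
    by (intro eventually_conj eventually_ge_at_top) (simp add: filterlim_at_top)
  then obtain b where b: "c \<le> eta b" "1 \<le> b"
    by (metis (no_types, lifting) eventually_at_top_linorder order_refl)
  obtain x where x: "1 \<le> x" "eta x = c"
    using IVT'[of eta 1 c b] b assms eta_cont[of "{1..b}"] by (auto simp: subset_iff)
  with assms have "x \<noteq> 1" by auto
  with x show ?thesis by (intro that[of x]) auto
qed

lemma eta_surj_inner:
  assumes "0 < c" obtains x where "0 < x" "x < 1" "eta x = c"
proof -
  have "filterlim eta at_top (at_right 0)" unfolding eta_def[abs_def] by real_asymp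
  then have "\<forall>\<^sub>F x in at_right 0. c \<le> eta x \<and> x \<in> {0<..<1}"
    by (intro eventually_conj eventually_at_right_real) (auto simp: filterlim_at_top)
  then obtain b where b: "c \<le> eta b" "0 < b" "b < 1"
    using eventually_happens[of _ "at_right (0::real)"] by fastforce
  have "\<exists>x\<ge>b. x \<le> 1 \<and> eta x = c"
    using IVT2'[of eta 1 c b] b assms eta_cont[of "{b..1}"] by (auto simp: subset_iff)
  then obtain x where x: "b \<le> x" "x \<le> 1" "eta x = c" by auto
  with assms have "x \<noteq> 1" by auto
  with x b show ?thesis by (intro that[of x]) auto
qed

text \<open>Compares \<open>ln\<close> with its [1/1] Pade approximant at \<open>1\<close>. The
  difference of the two sides vanishes at \<open>1\<close> and has derivative
  \<open>eta (1/y)\<close>. This gives the sign of the derivative of \<open>shear\<close>.\<close>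

lemma ln_gt_pade: "1 < x \<Longrightarrow> 2 * (x - 1) < (x + 1) * ln (x::real)"
proof -
  assume x: "1 < x"
  have "(\<lambda>x::real. (x + 1) * ln x - 2 * (x - 1)) 1 < (\<lambda>x. (x + 1) * ln x - 2 * (x - 1)) x"
  proof (rule DERIV_pos_imp_increasing_open[OF x])
    fix y :: real assume y: "1 < y" "y < x"
    have "((\<lambda>x. (x + 1) * ln x - 2 * (x - 1)) has_real_derivative eta (1/y)) (at y)"
      using y by (auto intro!: derivative_eq_intros simp: eta_def ln_div field_simps)
    moreover have "eta (1/y) > 0" using y by (intro eta_pos) auto
    ultimately show "\<exists>d. ((\<lambda>x. (x + 1) * ln x - 2 * (x - 1)) has_real_derivative d) (at y) \<and> 0 < d"
      by blast
  next
    show "continuous_on {1..x} (\<lambda>x. (x + 1) * ln x - 2 * (x - 1))"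
      by (intro continuous_intros) auto
  qed
  then show ?thesis by simp
qed

lemma ln_lt_pade: "0 < x \<Longrightarrow> x < 1 \<Longrightarrow> (x + 1) * ln (x::real) < 2 * (x - 1)"
proof -
  assume x: "0 < x" "x < 1"
  have "2 * (1 / x - 1) < (1 / x + 1) * - ln x"
    using ln_gt_pade[of "1 / x"] x by (simp add: ln_div)
  then have "x * (2 * (1 / x - 1)) < x * ((1 / x + 1) * - ln x)"
    using x by (intro mult_strict_left_mono)
  then have "2 * (1 - x) < - ((x + 1) * ln x)"
    using x by (simp add: right_diff_distrib distrib_left distrib_right)
  then show ?thesis by simp
qed

lemma shear_deriv:
  assumes "0 < x" "x \<noteq> 1"
  shows "(shear has_real_derivative
     (x - 1) * (2 * (x - 1) - (x + 1) * ln x) / (x * eta x)\<^sup>2) (at x)"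
proof -
  have e: "eta x \<noteq> 0" using eta_pos assms by fastforce
  have "(shear has_real_derivative
      (2 * (x - 1) * (x * eta x) - (x - 1)\<^sup>2 * (eta x + x * ((x - 1) / x))) / (x * eta x)\<^sup>2) (at x)"
    unfolding shear_def[abs_def] using assms e
    by (auto intro!: derivative_eq_intros eta_deriv simp: power2_eq_square)
  moreover have "2 * (x - 1) * (x * eta x) - (x - 1)\<^sup>2 * (eta x + x * ((x - 1) / x))
     = (x - 1) * (2 * (x - 1) - (x + 1) * ln x)"
    using assms by (simp add: eta_def power2_eq_square field_simps)
  ultimately show ?thesis by simp
qed

lemma shear_deriv_neg:
  assumes "0 < x" "x \<noteq> 1"
  shows "(x - 1) * (2 * (x - 1) - (x + 1) * ln x) / (x * eta x)\<^sup>2 < 0"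
proof -
  have "(x - 1) * (2 * (x - 1) - (x + 1) * ln x) < 0"
    using assms ln_gt_pade[of x] ln_lt_pade[of x]
    by (cases "x < 1") (auto simp: mult_less_0_iff)
  moreover have "(x * eta x)\<^sup>2 > 0" using assms eta_pos[of x] by simp
  ultimately show ?thesis by (simp add: divide_neg_pos)
qed

text \<open>The last hypothesis keeps the interval away from \<open>1\<close>, where the definition
  yields \<open>0 / 0 = 0\<close> although both one-sided limits are \<open>2\<close>.\<close>

lemma shear_decreasing:
  assumes "0 < x" "x < y" "1 < x \<or> y < 1"
  shows "shear y < shear x"
proof (rule DERIV_neg_imp_decreasing[OF assms(2)])
  fix z assume "x \<le> z" "z \<le> y"
  then have "0 < z" "z \<noteq> 1" using assms by auto
  then show "\<exists>d. (shear has_real_derivative d) (at z) \<and> d < 0"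
    using shear_deriv shear_deriv_neg by blast
qed

lemma shear_less_iff:
  assumes "1 < x \<and> 1 < y \<or> 0 < x \<and> x < 1 \<and> 0 < y \<and> y < 1"
  shows "shear y < shear x \<longleftrightarrow> x < y"
  using assms shear_decreasing[of x y] shear_decreasing[of y x] by (cases x y rule: linorder_cases) auto

lemma shear_gt_one:
  assumes "1 < x" shows "1 < shear x"
proof -
  have "(x - 1)\<^sup>2 - x * eta x = x * eta (1/x)"
    using assms by (simp add: eta_def power2_eq_square ln_div field_simps)
  moreover have "x * eta (1/x) > 0" using assms eta_pos[of "1/x"] by simp
  moreover have "x * eta x > 0" using assms eta_pos[of x] by simp
  ultimately show ?thesis by (simp add: shear_def field_simps)
qed


lemma shear_gt_two:
  assumes "0 < x" "x < 1" shows "2 < shear x"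
proof -
  have "(\<lambda>x. (x - 1)\<^sup>2 - 2 * x * eta x) 1 < (\<lambda>x. (x - 1)\<^sup>2 - 2 * x * eta x) x"
  proof (rule DERIV_neg_imp_decreasing_open[OF assms(2)])
    show "continuous_on {x..1} (\<lambda>x. (x - 1)\<^sup>2 - 2 * x * eta x)"
      using assms by (intro continuous_intros eta_cont) auto
    fix z :: real assume z: "x < z" "z < 1"
    then have "((\<lambda>x. (x - 1)\<^sup>2 - 2 * x * eta x) has_real_derivative -2 * eta z) (at z)"
      using assms by (auto intro!: derivative_eq_intros eta_deriv simp: field_simps)
    then show "\<exists>d. ((\<lambda>x. (x - 1)\<^sup>2 - 2 * x * eta x) has_real_derivative d) (at z) \<and> d < 0"
      using eta_pos[of z] z assms by auto
  qed
  moreover have "x * eta x > 0" using assms eta_pos[of x] by simp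
  ultimately show ?thesis by (simp add: shear_def field_simps)
qed

lemma shear_cont: 
  assumes "S \<subseteq> {0<..} - {1}" shows "continuous_on S shear"
proof (rule DERIV_continuous_on[OF DERIV_subset[OF shear_deriv subset_UNIV]])
qed (use assms in auto)

text \<open>The limits \<open>2\<close> at \<open>1\<close> and \<open>1\<close> at infinity are the
  squares of the end values \<open>sqrt 2\<close> and \<open>1\<close> of the outer NWSS
  function.\<close>

lemma shear_surj_outer:
  assumes "1 < c" "c < 2" obtains x where "1 < x" "shear x = c"
proof -
  have "(shear \<longlongrightarrow> 1) at_top" unfolding shear_def[abs_def] eta_def by real_asymp
  then have "\<forall>\<^sub>F x in at_top. shear x < c \<and> 1 < x"
    by (intro eventually_conj eventually_gt_at_top order_tendstoD) (use assms in auto)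
  then obtain b where b: "shear b < c" "1 < b"
    using eventually_happens[of _ "at_top::real filter"] by fastforce
  have "(shear \<longlongrightarrow> 2) (at_right 1)" unfolding shear_def[abs_def] eta_def by real_asymp
  then have "\<forall>\<^sub>F x in at_right 1. c < shear x \<and> x \<in> {1<..<b}"
    by (intro eventually_conj order_tendstoD eventually_at_right_real) (use assms b in auto)
  then obtain a where a: "c < shear a" "1 < a" "a < b"
    using eventually_happens[of _ "at_right (1::real)"] by fastforce
  have "{a..b} \<subseteq> {0<..} - {1}" using a by auto
  then obtain x where "a \<le> x" "shear x = c"
    using IVT2'[of shear b c a] a b shear_cont[of "{a..b}"] by auto
  with a show ?thesis by (intro that[of x]) auto
qed

lemma shear_surj_inner:
  assumes "2 < c" obtains x where "0 < x" "x < 1" "shear x = c"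
proof -
  have "filterlim shear at_top (at_right 0)" unfolding shear_def[abs_def] eta_def by real_asymp
  then have "\<forall>\<^sub>F x in at_right 0. c < shear x \<and> x \<in> {0<..<1}"
    by (intro eventually_conj eventually_at_right_real) (auto simp: filterlim_at_top_dense)
  then obtain a where a: "c < shear a" "0 < a" "a < 1"
    using eventually_happens[of _ "at_right (0::real)"] by fastforce
  have "(shear \<longlongrightarrow> 2) (at_left 1)" unfolding shear_def[abs_def] eta_def by real_asymp
  then have "\<forall>\<^sub>F x in at_left 1. shear x < c \<and> x \<in> {a<..<1}"
    by (intro eventually_conj order_tendstoD eventually_at_left_real) (use assms a in auto)
  then obtain b where b: "shear b < c" "a < b" "b < 1"
    using eventually_happens[of _ "at_left (1::real)"] by fastforce
  have "{a..b} \<subseteq> {0<..} - {1}" using a b by auto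
  then obtain x where "a \<le> x" "x \<le> b" "shear x = c"
    using IVT2'[of shear b c a] a b shear_cont[of "{a..b}"] by auto
  with a b show ?thesis by (intro that[of x]) auto
qed

section \<open>The NWSS functions expressed through \<open>shear\<close>, and their
  injectivity\<close>

lemma model_max_eq_eta:
  assumes "0 < R" shows "1 - R\<^sup>2 + 2 * R\<^sup>2 * ln R = R\<^sup>2 * eta (1 / R\<^sup>2)"
  using assms by (simp add: eta_def ln_div ln_realpow field_simps)

text \<open>The model has outer radius \<open>1\<close> and its maxima lie at radius
  \<open>R\<close>, so the squared radius ratio on the outer circle is
  \<open>1 / R\<^sup>2\<close>.\<close>

lemma tau_outer_eq:
  assumes "0 < R" "R < 1" shows "tau_outer R = sqrt (shear (1 / R\<^sup>2))"
proof -
  have R1: "R\<^sup>2 < 1" using assms by (simp add: power_less_one_iff)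
  have e: "eta (1 / R\<^sup>2) > 0" using assms R1 by (intro eta_pos) auto
  have "shear (1 / R\<^sup>2) = (1 - R\<^sup>2)\<^sup>2 / (R\<^sup>2 * eta (1 / R\<^sup>2))"
    using assms e by (simp add: shear_def field_simps power2_eq_square)
  then show ?thesis
    using assms R1 by (simp add: tau_outer_def model_max_eq_eta real_sqrt_divide)
qed

text \<open>In the variable \<open>\<rho>\<^sup>2 / R\<^sup>2\<close> the equation defining
  \<open>r_inner\<close> says that \<open>eta\<close> has the same value as at
  \<open>1 / R\<^sup>2\<close>. It has two roots; the one above \<open>1\<close> belongs to \<rho> =
  1, so the one below \<open>1\<close> is the least.\<close>

lemma r_inner_eq:
  assumes "0 < R" "R < 1" "0 < y" "y < 1" "eta y = eta (1 / R\<^sup>2)"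
  shows "r_inner R = R * sqrt y"
proof -
  have eq: "1 - \<rho>\<^sup>2 + 2 * R\<^sup>2 * ln \<rho> = R\<^sup>2 * (eta (1 / R\<^sup>2) - eta (\<rho>\<^sup>2 / R\<^sup>2))" if "0 < \<rho>" for \<rho>
    using assms that by (simp add: eta_def ln_div ln_realpow field_simps)
  show ?thesis unfolding r_inner_def
  proof (rule Least_equality)
    show "0 < R * sqrt y \<and> 1 - (R * sqrt y)\<^sup>2 + 2 * R\<^sup>2 * ln (R * sqrt y) = 0"
      using assms eq[of "R * sqrt y"] by (simp add: power_mult_distrib)
  next
    fix \<rho> assume r: "0 < \<rho> \<and> 1 - \<rho>\<^sup>2 + 2 * R\<^sup>2 * ln \<rho> = 0"
    then have e: "eta (\<rho>\<^sup>2 / R\<^sup>2) = eta y" using eq[of \<rho>] assms by simp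
    show "R * sqrt y \<le> \<rho>"
    proof (cases "\<rho> < R")
      case True
      then have "\<rho>\<^sup>2 / R\<^sup>2 \<le> 1" using r assms by (simp add: power_mono)
      moreover have "0 < \<rho>\<^sup>2 / R\<^sup>2" using r assms(1) by simp
      ultimately have y: "y = \<rho>\<^sup>2 / R\<^sup>2"
        using eta_inj_inner[OF _ _ assms(3) _ e] assms(4) by simp
      have "sqrt y = \<rho> / R" using conjunct1[OF r] assms(1) unfolding y by (simp add: real_sqrt_divide)
      then show ?thesis using assms by simp
    next
      case False
      moreover have "R * sqrt y \<le> R * 1" using assms by (intro mult_left_mono) auto
      ultimately show ?thesis by simp
    qed
  qed
qed

lemma tau_inner_eq:
  assumes "0 < R" "R < 1" "0 < y" "y < 1" "eta y = eta (1 / R\<^sup>2)"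
  shows "tau_inner R = sqrt (shear y)"
proof -
  have e: "eta y > 0" using assms by (intro eta_pos) auto
  have "tau_inner R = R\<^sup>2 * (1 - y) / (R * sqrt y * (R * sqrt (eta y)))"
    using assms(1-4) r_inner_eq[OF assms] model_max_eq_eta[OF assms(1)] unfolding assms(5)
    by (simp add: tau_inner_def power_mult_distrib real_sqrt_mult right_diff_distrib)
  also have "\<dots> = (1 - y) / (sqrt y * sqrt (eta y))"
    using assms by (simp add: power2_eq_square)
  also have "\<dots> = sqrt ((1 - y)\<^sup>2 / (y * eta y))"
    using assms by (simp add: real_sqrt_divide real_sqrt_mult)
  finally show ?thesis by (simp add: shear_def power2_commute)
qed

lemma inv_square_gt_one: "0 < R \<Longrightarrow> R < 1 \<Longrightarrow> 1 < 1 / (R::real)\<^sup>2"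
  by (simp add: power_less_one_iff)

lemma tau_outer_inj: "inj_on tau_outer {0..<1}"
proof (rule linorder_inj_onI')
  fix i j :: real assume ij: "i \<in> {0..<1}" "j \<in> {0..<1}" "i < j"
  then have j: "0 < j" "j < 1" by auto
  show "tau_outer i \<noteq> tau_outer j"
  proof (cases "i = 0")
    case True
    then show ?thesis
      using shear_gt_one[OF inv_square_gt_one[OF j]] by (simp add: tau_outer_eq[OF j] tau_outer_def[of 0])
  next
    case False
    then have i: "0 < i" "i < 1" using ij by auto
    have "1 / j\<^sup>2 < 1 / i\<^sup>2" using i ij by (intro divide_strict_left_mono power_strict_mono) auto
    then have "shear (1 / i\<^sup>2) < shear (1 / j\<^sup>2)"
      using inv_square_gt_one[OF j] inv_square_gt_one[OF i] by (subst shear_less_iff) auto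
    then show ?thesis by (simp add: tau_outer_eq i j)
  qed
qed

text \<open>A larger \<open>R\<close> lowers the level \<open>eta (1 / R\<^sup>2)\<close>, which
  moves the root below \<open>1\<close> upwards and hence lowers \<open>shear\<close>.\<close>

lemma tau_inner_inj: "inj_on tau_inner {0<..1}"
proof (rule linorder_inj_onI')
  fix i j :: real assume ij: "i \<in> {0<..1}" "j \<in> {0<..1}" "i < j"
  then have i: "0 < i" "i < 1" by auto
  have xi: "1 < 1 / i\<^sup>2" by (rule inv_square_gt_one[OF i])
  then obtain y where y: "0 < y" "y < 1" "eta y = eta (1 / i\<^sup>2)"
    using eta_surj_inner[OF eta_pos[of "1 / i\<^sup>2"]] i by auto
  show "tau_inner i \<noteq> tau_inner j"
  proof (cases "j = 1")
    case True
    then show ?thesis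
      using shear_gt_two[OF y(1,2)] by (simp add: tau_inner_eq[OF i y] tau_inner_def[of 1])
  next
    case False
    then have j: "0 < j" "j < 1" using ij by auto
    have xj: "1 < 1 / j\<^sup>2" by (rule inv_square_gt_one[OF j])
    then obtain w where w: "0 < w" "w < 1" "eta w = eta (1 / j\<^sup>2)"
      using eta_surj_inner[OF eta_pos[of "1 / j\<^sup>2"]] j by auto
    have "1 / j\<^sup>2 < 1 / i\<^sup>2" using i ij by (intro divide_strict_left_mono power_strict_mono) auto
    then have "eta w < eta y" using y w xj by (simp add: eta_less)
    then have "y < w" using eta_greater[of w y] y w by (cases y w rule: linorder_cases) auto
    then have "shear w < shear y" using y w by (subst shear_less_iff) auto
    then show ?thesis by (simp add: tau_inner_eq[OF i y] tau_inner_eq[OF j w])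
  qed
qed


text \<open>The sign \<sigma> selects the root above or below \<open>1\<close>, so that both sides
  of the circle of maxima are handled by the same lemmas.\<close>

definition eta_branch :: "real \<Rightarrow> real \<Rightarrow> real" where
  "eta_branch \<sigma> c = (THE x. 0 < x \<and> 0 < \<sigma> * (x - 1) \<and> eta x = c)"

lemma eta_branch_unique:
  assumes "\<sigma> = 1 \<or> \<sigma> = -1" "0 < x" "0 < \<sigma> * (x - 1)"
  shows "eta_branch \<sigma> (eta x) = x"
  unfolding eta_branch_def
proof (rule the_equality)
  fix y assume "0 < y \<and> 0 < \<sigma> * (y - 1) \<and> eta y = eta x"
  then show "y = x" using assms eta_inj_outer[of x y] eta_inj_inner[of x y] by auto
qed (use assms in auto)

lemma eta_branch:
  assumes "\<sigma> = 1 \<or> \<sigma> = -1" "0 < c"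
  shows "0 < eta_branch \<sigma> c" "0 < \<sigma> * (eta_branch \<sigma> c - 1)" "eta (eta_branch \<sigma> c) = c"
proof -
  obtain x where x: "0 < x" "0 < \<sigma> * (x - 1)" "eta x = c"
  proof (cases "\<sigma> = 1")
    case True
    obtain x where "1 < x" "eta x = c" by (rule eta_surj_outer[OF assms(2)])
    with True that[of x] show ?thesis by simp
  next
    case False
    obtain x where "0 < x" "x < 1" "eta x = c" by (rule eta_surj_inner[OF assms(2)])
    with False assms(1) that[of x] show ?thesis by simp
  qed
  then have "eta_branch \<sigma> c = x" using eta_branch_unique[OF assms(1) x(1,2)] by simp
  with x show "0 < eta_branch \<sigma> c" "0 < \<sigma> * (eta_branch \<sigma> c - 1)" "eta (eta_branch \<sigma> c) = c"
    by auto
qed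

lemma eta_branch_deriv:
  assumes \<sigma>: "\<sigma> = 1 \<or> \<sigma> = -1" and c: "0 < c"
  defines "x \<equiv> eta_branch \<sigma> c"
  shows "(eta_branch \<sigma> has_real_derivative x / (x - 1)) (at c)"
proof -
  note x = eta_branch[OF \<sigma> c, folded x_def]
  define d where "d = min x \<bar>x - 1\<bar> / 2"
  have d: "0 < d" using x by (auto simp: d_def)
  have near: "0 < z \<and> 0 < \<sigma> * (z - 1)" if "\<bar>z - x\<bar> \<le> d" for z
    using that x \<sigma> unfolding d_def min_def by (auto simp: abs_if split: if_splits)
  have "isCont (eta_branch \<sigma>) (eta x)"
  proof (rule isCont_inverse_function[OF d, where f = eta and x = x])
    show "\<And>z. \<bar>z - x\<bar> \<le> d \<Longrightarrow> eta_branch \<sigma> (eta z) = z"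
      using eta_branch_unique[OF \<sigma>] near by blast
    show "\<And>z. \<bar>z - x\<bar> \<le> d \<Longrightarrow> isCont eta z"
      using near eta_deriv DERIV_isCont by blast
  qed
  then have "(eta_branch \<sigma> has_real_derivative inverse ((x - 1) / x)) (at c)"
    using x \<sigma> c eta_branch(3)[OF \<sigma>] eta_deriv[of x]
    by (intro DERIV_inverse_function[where f=eta and a=0 and b="c + 1"]) (auto simp: x_def)
  then show ?thesis by simp
qed

lemma eta_branch_tendsto_outer: "filterlim (eta_branch 1) (at_right 1) (at_right 0)"
  unfolding filterlim_at
proof
  show "\<forall>\<^sub>F c in at_right 0. eta_branch 1 c \<in> {1<..} \<and> eta_branch 1 c \<noteq> 1"
    using eventually_at_right_less[of 0] by eventually_elim (use eta_branch(2)[of 1] in fastforce)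
  show "(eta_branch 1 \<longlongrightarrow> 1) (at_right 0)"
  proof (rule order_tendstoI)
    fix b :: real assume "b < 1"
    show "\<forall>\<^sub>F c in at_right 0. b < eta_branch 1 c"
      using eventually_at_right_less[of 0]
      by eventually_elim (use eta_branch(2)[of 1] \<open>b < 1\<close> in fastforce)
  next
    fix b :: real assume b: "1 < b"
    then have "0 < eta b" by (intro eta_pos) auto
    then have "\<forall>\<^sub>F c in at_right 0. c \<in> {0<..<eta b}" by (rule eventually_at_right_real)
    then show "\<forall>\<^sub>F c in at_right 0. eta_branch 1 c < b"
    proof eventually_elim
      case (elim c)
      then have "\<not> eta b \<le> eta (eta_branch 1 c)" using eta_branch(3)[of 1 c] by simp
      then show ?case
        using eta_less[of b "eta_branch 1 c"] b by (cases b "eta_branch 1 c" rule: linorder_cases) auto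
    qed
  qed
qed

lemma eta_branch_tendsto_inner: "filterlim (eta_branch (-1)) (at_left 1) (at_right 0)"
  unfolding filterlim_at
proof
  show "\<forall>\<^sub>F c in at_right 0. eta_branch (-1) c \<in> {..<1} \<and> eta_branch (-1) c \<noteq> 1"
    using eventually_at_right_less[of 0] by eventually_elim (use eta_branch(2)[of "-1"] in fastforce)
  show "(eta_branch (-1) \<longlongrightarrow> 1) (at_right 0)"
  proof (rule order_tendstoI)
    fix b :: real assume "1 < b"
    show "\<forall>\<^sub>F c in at_right 0. eta_branch (-1) c < b"
      using eventually_at_right_less[of 0]
      by eventually_elim (use eta_branch(2)[of "-1"] \<open>1 < b\<close> in fastforce)
  next
    fix b :: real assume "b < 1"
    define b' where "b' = max b (1/2)"
    have b: "0 < b'" "b' < 1" "b \<le> b'" using \<open>b < 1\<close> by (auto simp: b'_def)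
    then have "0 < eta b'" by (intro eta_pos) auto
    then have "\<forall>\<^sub>F c in at_right 0. c \<in> {0<..<eta b'}" by (rule eventually_at_right_real)
    then show "\<forall>\<^sub>F c in at_right 0. b < eta_branch (-1) c"
    proof eventually_elim
      case (elim c)
      then have "\<not> eta b' \<le> eta (eta_branch (-1) c)" using eta_branch(3)[of "-1" c] by simp
      then show ?case
        using eta_greater[of "eta_branch (-1) c" b'] b eta_branch(1)[of "-1" c] elim
        by (cases b' "eta_branch (-1) c" rule: linorder_cases) auto
    qed
  qed
qed

text \<open>
  For the radial solution \<open>v = (\<rho>\<^sup>2 - a - a ln (\<rho>\<^sup>2 / a)) / 2\<close> of \<open>\<Delta>v = 2\<close> with minimum \<open>0\<close>
  on \<open>\<rho>\<^sup>2 = a\<close>, one has \<open>|\<nabla>v|\<^sup>2 = excess \<sigma> a v / weight \<sigma> a v\<close>, where \<open>\<sigma> = 1\<close> outside and \<open>\<sigma> = -1\<close> inside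
  the circle of minima and \<open>\<rho>\<^sup>2 / a = 1 + \<sigma> * excess \<sigma> a v\<close>.
\<close>

definition excess :: "real \<Rightarrow> real \<Rightarrow> real \<Rightarrow> real" where
  "excess \<sigma> a v = \<sigma> * (eta_branch \<sigma> (2 * v / a) - 1)"

definition weight :: "real \<Rightarrow> real \<Rightarrow> real \<Rightarrow> real" where
  "weight \<sigma> a v = eta_branch \<sigma> (2 * v / a) / (a * excess \<sigma> a v)"

context
  fixes \<sigma> a :: real
  assumes \<sigma>: "\<sigma> = 1 \<or> \<sigma> = -1" and a: "0 < a"
begin

lemma excess_pos: "0 < v \<Longrightarrow> 0 < excess \<sigma> a v"
  using eta_branch(2)[OF \<sigma>, of "2 * v / a"] a by (simp add: excess_def)

lemma weight_pos: "0 < v \<Longrightarrow> 0 < weight \<sigma> a v"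
  using eta_branch(1)[OF \<sigma>, of "2 * v / a"] a excess_pos by (simp add: weight_def)

lemma excess_deriv:
  assumes v: "0 < v"
  shows "(excess \<sigma> a has_real_derivative 2 * weight \<sigma> a v) (at v)"
proof -
  define x where "x = eta_branch \<sigma> (2 * v / a)"
  have "0 < \<sigma> * (x - 1)" using excess_pos[OF v] by (simp add: excess_def x_def)
  have "(eta_branch \<sigma> has_real_derivative x / (x - 1)) (at (2 * v / a))"
    unfolding x_def using a v by (intro eta_branch_deriv[OF \<sigma>]) simp
  then have "((\<lambda>v. eta_branch \<sigma> (2 * v / a)) has_real_derivative x / (x - 1) * (2 / a)) (at v)"
    by (rule DERIV_chain2) (use a in \<open>auto intro!: derivative_eq_intros\<close>)
  then have "(excess \<sigma> a has_real_derivative \<sigma> * (x / (x - 1) * (2 / a))) (at v)"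
    unfolding excess_def[abs_def] by (auto intro!: derivative_eq_intros)
  moreover have "\<sigma> * (x / (x - 1) * (2 / a)) = 2 * weight \<sigma> a v"
    using \<sigma> by (auto simp: weight_def excess_def x_def divide_simps)
  ultimately show ?thesis by simp
qed

lemma weight_deriv:
  assumes v: "0 < v"
  shows "(weight \<sigma> a has_real_derivative - 2 * weight \<sigma> a v / (a * (excess \<sigma> a v)\<^sup>2)) (at v)"
proof -
  have eq: "weight \<sigma> a w = (1 + \<sigma> * excess \<sigma> a w) / (a * excess \<sigma> a w)" for w
    using \<sigma> by (auto simp: weight_def excess_def)
  have l: "excess \<sigma> a v \<noteq> 0" using excess_pos[OF v] by simp
  have "(weight \<sigma> a has_real_derivative
      (\<sigma> * (2 * weight \<sigma> a v) * (a * excess \<sigma> a v)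
        - (1 + \<sigma> * excess \<sigma> a v) * (a * (2 * weight \<sigma> a v))) / (a * excess \<sigma> a v)\<^sup>2) (at v)"
    unfolding eq[abs_def] using a l
    by (auto intro!: derivative_eq_intros excess_deriv[OF v] simp: eq power2_eq_square)
  moreover have "(\<sigma> * (2 * weight \<sigma> a v) * (a * excess \<sigma> a v)
        - (1 + \<sigma> * excess \<sigma> a v) * (a * (2 * weight \<sigma> a v))) / (a * excess \<sigma> a v)\<^sup>2
     = - 2 * weight \<sigma> a v / (a * (excess \<sigma> a v)\<^sup>2)"
    using a l by (simp add: field_simps power2_eq_square)
  ultimately show ?thesis by simp
qed

text \<open>For \<open>v = m\<close> the left side is the model value of
  \<open>|\<nabla>u|\<^sup>2\<close> on the boundary; this is how a bound on the NWSS enters the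
  gradient comparison.\<close>

lemma excess_weight_eq_shear:
  assumes "0 < v"
  shows "excess \<sigma> a v / weight \<sigma> a v = 2 * v * shear (eta_branch \<sigma> (2 * v / a))"
proof -
  define x where "x = eta_branch \<sigma> (2 * v / a)"
  have x: "0 < x" "0 < \<sigma> * (x - 1)" "eta x = 2 * v / a"
    using eta_branch[OF \<sigma>, of "2 * v / a"] a assms by (auto simp: x_def)
  have "excess \<sigma> a v / weight \<sigma> a v = a * (x - 1)\<^sup>2 / x"
    using \<sigma> x by (auto simp: weight_def excess_def x_def[symmetric] power2_eq_square)
  also have "\<dots> = 2 * v * shear x"
    using a assms x by (simp add: shear_def)
  finally show ?thesis by (simp add: x_def)
qed

lemma eta_branch_tendsto:
  "filterlim (eta_branch \<sigma>) (if \<sigma> = 1 then at_right 1 else at_left 1) (at_right 0)"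
  using \<sigma> eta_branch_tendsto_inner eta_branch_tendsto_outer by auto

lemma scale_tendsto: "filterlim (\<lambda>v. 2 * v / a) (at_right 0) (at_right 0)"
  using a by real_asymp

text \<open>Limits as \<open>v\<close> tends to \<open>0\<close> are turned into limits of explicit
  functions of \<open>x\<close> at \<open>1\<close>, where asymptotic expansion applies.\<close>

lemma tendsto_via_eta_branch:
  assumes "(f \<longlongrightarrow> L) (if \<sigma> = 1 then at_right 1 else at_left 1)"
    and "\<And>v. 0 < v \<Longrightarrow> f (eta_branch \<sigma> (2 * v / a)) = h v"
  shows "(h \<longlongrightarrow> L) (at_right 0)"
proof -
  have "((\<lambda>v. f (eta_branch \<sigma> (2 * v / a))) \<longlongrightarrow> L) (at_right 0)"
    using filterlim_compose[OF assms(1) filterlim_compose[OF eta_branch_tendsto scale_tendsto]] .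
  then show ?thesis
    by (rule Lim_transform_eventually)
       (use eventually_at_right_less[of 0] in eventually_elim, use assms(2) in auto)
qed

text \<open>\<open>weight\<close> blows up at \<open>v = 0\<close>, but only like
  \<open>1 / (2 * sqrt (a * v))\<close>.\<close>

lemma weight_times_tendsto: "((\<lambda>v. weight \<sigma> a v * v) \<longlongrightarrow> 0) (at_right 0)"
proof (rule tendsto_via_eta_branch)
  show "((\<lambda>x. x * eta x / (2 * (\<sigma> * (x - 1)))) \<longlongrightarrow> 0) (if \<sigma> = 1 then at_right 1 else at_left 1)"
    using \<sigma> unfolding eta_def by (auto simp del: mult_minus1 minus_diff_eq) (real_asymp+)
  fix v :: real assume v: "0 < v"
  then have "eta (eta_branch \<sigma> (2 * v / a)) = 2 * v / a"
    using a by (intro eta_branch(3)[OF \<sigma>]) simp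
  then show "eta_branch \<sigma> (2 * v / a) * eta (eta_branch \<sigma> (2 * v / a)) /
      (2 * (\<sigma> * (eta_branch \<sigma> (2 * v / a) - 1))) = weight \<sigma> a v * v"
    using a by (simp add: weight_def excess_def)
qed

text \<open>For the model, \<open>|\<nabla>v|\<^sup>2 / (4 * v)\<close> differs from
  \<open>1\<close> by a term of order \<open>sqrt v\<close>, whose coefficient consists of the side
  \<sigma> and the curvature \<open>1 / sqrt a\<close> of the circle of minima. The curvature bounds
  are read off from this term.\<close>

lemma model_gradient_expansion:
  "((\<lambda>v. (excess \<sigma> a v / (4 * weight \<sigma> a v * v) - 1) / sqrt v) \<longlongrightarrow> - \<sigma> * 2 / (3 * sqrt a)) (at_right 0)"
proof (rule tendsto_via_eta_branch)
  have "((\<lambda>x. (shear x / 2 - 1) / sqrt (eta x)) \<longlongrightarrow> - (sqrt 2 / 3)) (at_right 1)"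
    unfolding shear_def eta_def by real_asymp (simp add: powr_half_sqrt real_sqrt_divide)
  moreover have "((\<lambda>x. (shear x / 2 - 1) / sqrt (eta x)) \<longlongrightarrow> sqrt 2 / 3) (at_left 1)"
    unfolding shear_def eta_def by real_asymp (simp add: powr_half_sqrt real_sqrt_divide)
  ultimately have "((\<lambda>x. (shear x / 2 - 1) / sqrt (eta x)) \<longlongrightarrow> - \<sigma> * (sqrt 2 / 3))
      (if \<sigma> = 1 then at_right 1 else at_left 1)"
    using \<sigma> by auto
  from tendsto_divide[OF this tendsto_const[of "sqrt (a / 2)"]]
  have "((\<lambda>x. (shear x / 2 - 1) / sqrt (eta x) / sqrt (a / 2)) \<longlongrightarrow> - \<sigma> * (sqrt 2 / 3) / sqrt (a / 2))
      (if \<sigma> = 1 then at_right 1 else at_left 1)"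
    using a by simp
  moreover have "- \<sigma> * (sqrt 2 / 3) / sqrt (a / 2) = - \<sigma> * 2 / (3 * sqrt a)"
    by (simp add: real_sqrt_divide)
  ultimately show "((\<lambda>x. (shear x / 2 - 1) / sqrt (eta x) / sqrt (a / 2)) \<longlongrightarrow> - \<sigma> * 2 / (3 * sqrt a))
      (if \<sigma> = 1 then at_right 1 else at_left 1)"
    by simp
  fix v :: real assume v: "0 < v"
  define x where "x = eta_branch \<sigma> (2 * v / a)"
  have x: "eta x = 2 * v / a"
    unfolding x_def using a v by (intro eta_branch(3)[OF \<sigma>]) simp
  have "excess \<sigma> a v / (4 * weight \<sigma> a v * v) = (excess \<sigma> a v / weight \<sigma> a v) / (4 * v)"
    by simp
  also have "\<dots> = shear x / 2" unfolding excess_weight_eq_shear[OF v] using v by (simp add: x_def)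
  finally have "excess \<sigma> a v / (4 * weight \<sigma> a v * v) = shear x / 2" .
  moreover have "sqrt (eta x) * sqrt (a / 2) = sqrt v"
    unfolding x using a by (simp flip: real_sqrt_mult)
  ultimately have "(shear x / 2 - 1) / sqrt (eta x) / sqrt (a / 2)
      = (excess \<sigma> a v / (4 * weight \<sigma> a v * v) - 1) / sqrt v"
    by (metis divide_divide_eq_left)
  then show "(shear (eta_branch \<sigma> (2 * v / a)) / 2 - 1) / sqrt (eta (eta_branch \<sigma> (2 * v / a))) / sqrt (a / 2)
     = (excess \<sigma> a v / (4 * weight \<sigma> a v * v) - 1) / sqrt v"
    unfolding x_def .
qed

end


section \<open>Gradient comparison\<close>

lemma second_derivative_test_max:
  fixes f f' :: "real \<Rightarrow> real"
  assumes "0 < d" "\<And>t. \<bar>t\<bar> < d \<Longrightarrow> (f has_real_derivative f' t) (at t)"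
    and f'': "(f' has_real_derivative s) (at 0)"
    and le: "\<And>t. \<bar>t\<bar> < d \<Longrightarrow> f t \<le> f 0"
  shows "f' 0 = 0" "s \<le> 0"
proof -
  show z: "f' 0 = 0"
    using assms by (intro DERIV_local_max[of f _ 0 d]) auto
  show "s \<le> 0"
  proof (rule ccontr)
    assume "\<not> s \<le> 0"
    then obtain e where e: "0 < e" "\<And>h. 0 < h \<Longrightarrow> h < e \<Longrightarrow> f' 0 < f' (0 + h)"
      using DERIV_pos_inc_right[OF f''] by (meson not_le)
    define t where "t = min d e / 2"
    have t: "0 < t" "t < d" "t < e" using e assms(1) by (auto simp: t_def)
    have "f 0 < f t"
    proof (rule DERIV_pos_imp_increasing_open[OF t(1)])
      fix x assume "0 < x" "x < t"
      then show "\<exists>y. (f has_real_derivative y) (at x) \<and> 0 < y"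
        using assms(2)[of x] e(2)[of x] z t by auto
    next
      show "continuous_on {0..t} f"
        using assms(2) t by (intro DERIV_atLeastAtMost_imp_continuous_on) force
    qed
    with le[of t] t show False by simp
  qed
qed

text \<open>Along a line, \<open>p\<close> and \<open>q\<close> are the components of the gradient
  and \<open>v = m - u\<close>; \<open>r\<close>, \<open>s\<close> and \<open>y\<close> are their
  derivatives. By \<open>excess_deriv\<close> and \<open>weight_deriv\<close> the derivative of the
  barrier factors as \<open>2 * weight * B\<close>. At a maximum \<open>B\<close> vanishes, so the
  derivative of the factor drops out of the second-order condition and \<open>B' \<le> 0\<close>
  remains.\<close>

lemma barrier_derivatives:
  fixes p q r s v y :: "real \<Rightarrow> real"
  assumes \<sigma>: "\<sigma> = 1 \<or> \<sigma> = -1" and a: "0 < a" and "0 < d"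
    and p: "\<And>t. \<bar>t\<bar> < d \<Longrightarrow> (p has_real_derivative r t) (at t)"
    and q: "\<And>t. \<bar>t\<bar> < d \<Longrightarrow> (q has_real_derivative s t) (at t)"
    and v: "\<And>t. \<bar>t\<bar> < d \<Longrightarrow> (v has_real_derivative y t) (at t)"
    and r: "(r has_real_derivative r1) (at 0)" and s: "(s has_real_derivative s1) (at 0)"
    and y: "(y has_real_derivative y1) (at 0)"
    and v_pos: "\<And>t. \<bar>t\<bar> < d \<Longrightarrow> 0 < v t"
    and max: "\<And>t. \<bar>t\<bar> < d \<Longrightarrow>
       weight \<sigma> a (v t) * ((p t)\<^sup>2 + (q t)\<^sup>2) - excess \<sigma> a (v t)
       \<le> weight \<sigma> a (v 0) * ((p 0)\<^sup>2 + (q 0)\<^sup>2) - excess \<sigma> a (v 0)"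
  defines "k \<equiv> weight \<sigma> a (v 0)" and "l \<equiv> excess \<sigma> a (v 0)" and "W \<equiv> (p 0)\<^sup>2 + (q 0)\<^sup>2"
  shows "p 0 * r 0 + q 0 * s 0 = y 0 * (1 + W / (a * l\<^sup>2))"
    and "(r 0)\<^sup>2 + (s 0)\<^sup>2 + p 0 * r1 + q 0 * s1 - y1 * (1 + W / (a * l\<^sup>2))
       - y 0 * (2 * (p 0 * r 0 + q 0 * s 0) / (a * l\<^sup>2) - 4 * k * y 0 * W / (a * l ^ 3)) \<le> 0"
proof -
  define f where "f t = weight \<sigma> a (v t) * ((p t)\<^sup>2 + (q t)\<^sup>2) - excess \<sigma> a (v t)" for t
  define B where "B t = p t * r t + q t * s t
     - y t * (1 + ((p t)\<^sup>2 + (q t)\<^sup>2) / (a * (excess \<sigma> a (v t))\<^sup>2))" for t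
  define f' where "f' t = 2 * weight \<sigma> a (v t) * B t" for t
  define B' where "B' = (r 0)\<^sup>2 + (s 0)\<^sup>2 + p 0 * r1 + q 0 * s1 - y1 * (1 + W / (a * l\<^sup>2))
       - y 0 * (2 * (p 0 * r 0 + q 0 * s 0) / (a * l\<^sup>2) - 4 * k * y 0 * W / (a * l ^ 3))"
  have l0: "l > 0" "k > 0"
    using v_pos[of 0] \<open>0 < d\<close> excess_pos[OF \<sigma> a] weight_pos[OF \<sigma> a] by (auto simp: l_def k_def)
  have dl: "((\<lambda>t. excess \<sigma> a (v t)) has_real_derivative 2 * weight \<sigma> a (v t) * y t) (at t)"
    and dk: "((\<lambda>t. weight \<sigma> a (v t)) has_real_derivative
       - 2 * weight \<sigma> a (v t) / (a * (excess \<sigma> a (v t))\<^sup>2) * y t) (at t)" if "\<bar>t\<bar> < d" for t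
    using DERIV_chain2[OF excess_deriv[OF \<sigma> a v_pos[OF that]] v[OF that]]
      DERIV_chain2[OF weight_deriv[OF \<sigma> a v_pos[OF that]] v[OF that]] by auto
  have f: "(f has_real_derivative f' t) (at t)" if t: "\<bar>t\<bar> < d" for t
    unfolding f_def f'_def B_def
    by (rule derivative_eq_intros dl[OF t] dk[OF t] p[OF t] q[OF t] refl)+
       (simp add: algebra_simps power2_eq_square)
  have d0: "\<bar>0::real\<bar> < d" using \<open>0 < d\<close> by simp
  define Q where "Q = 2 * (p 0 * r 0 + q 0 * s 0) / (a * l\<^sup>2) - 4 * k * y 0 * W / (a * l ^ 3)"
  have dW: "((\<lambda>t. (p t)\<^sup>2 + (q t)\<^sup>2) has_real_derivative 2 * (p 0 * r 0 + q 0 * s 0)) (at 0)"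
    by (rule derivative_eq_intros p[OF d0] q[OF d0] refl)+ simp
  have dL: "((\<lambda>t. a * (excess \<sigma> a (v t))\<^sup>2) has_real_derivative a * (4 * l * k * y 0)) (at 0)"
    by (rule derivative_eq_intros dl[OF d0] refl)+ (simp add: l_def k_def)
  have "((\<lambda>t. ((p t)\<^sup>2 + (q t)\<^sup>2) / (a * (excess \<sigma> a (v t))\<^sup>2)) has_real_derivative
      (2 * (p 0 * r 0 + q 0 * s 0) * (a * l\<^sup>2) - W * (a * (4 * l * k * y 0))) / (a * l\<^sup>2 * (a * l\<^sup>2))) (at 0)"
    using DERIV_divide[OF dW dL] l0 a by (simp add: W_def l_def)
  moreover have "(2 * (p 0 * r 0 + q 0 * s 0) * (a * l\<^sup>2) - W * (a * (4 * l * k * y 0))) / (a * l\<^sup>2 * (a * l\<^sup>2)) = Q"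
    using l0 a by (simp add: Q_def field_simps power2_eq_square power3_eq_cube)
  ultimately have dQ: "((\<lambda>t. ((p t)\<^sup>2 + (q t)\<^sup>2) / (a * (excess \<sigma> a (v t))\<^sup>2)) has_real_derivative Q) (at 0)"
    by simp
  have B'_eq: "B' = (r 0)\<^sup>2 + (s 0)\<^sup>2 + p 0 * r1 + q 0 * s1 - y1 * (1 + W / (a * l\<^sup>2)) - y 0 * Q"
    by (simp add: B'_def Q_def)
  have dB: "(B has_real_derivative B') (at 0)"
    unfolding B_def
    by (rule dQ derivative_eq_intros p[OF d0] q[OF d0] r s y refl)+
       (simp add: B'_eq W_def l_def algebra_simps power2_eq_square)
  have f': "(f' has_real_derivative
     (2 * (- 2 * k / (a * l\<^sup>2) * y 0)) * B 0 + B' * (2 * k)) (at 0)"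
    unfolding f'_def
    by (rule derivative_eq_intros dk[OF d0] dB refl)+ (simp add: k_def l_def)
  have f'0: "f' 0 = 0" and B'0: "(2 * (- 2 * k / (a * l\<^sup>2) * y 0)) * B 0 + B' * (2 * k) \<le> 0"
    using second_derivative_test_max[OF \<open>0 < d\<close> f f'] max unfolding f_def by blast+
  then have "B 0 = 0" using l0 by (simp add: f'_def k_def)
  then show "p 0 * r 0 + q 0 * s 0 = y 0 * (1 + W / (a * l\<^sup>2))"
    by (simp add: B_def W_def l_def)
  from \<open>B 0 = 0\<close> B'0 l0 have "B' \<le> 0" by (simp add: mult_le_0_iff)
  then show "(r 0)\<^sup>2 + (s 0)\<^sup>2 + p 0 * r1 + q 0 * s1 - y1 * (1 + W / (a * l\<^sup>2))
       - y 0 * (2 * (p 0 * r 0 + q 0 * s 0) / (a * l\<^sup>2) - 4 * k * y 0 * W / (a * l ^ 3)) \<le> 0"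
    by (simp add: B'_def)
qed

text \<open>
  Since \<open>\<Delta>u = -2\<close>, the function \<open>g = u\<^sub>x - \<i> u\<^sub>y + cnj z\<close> is holomorphic; \<open>G\<close> extends \<open>|\<nabla>u|\<close> continuously to
  the closure.
\<close>

locale torsion =
  fixes \<Omega> :: "complex set" and u :: "complex \<Rightarrow> real" and g :: "complex \<Rightarrow> complex"
    and G :: "complex \<Rightarrow> real"
  assumes open_dom: "open \<Omega>" and connected_dom: "connected \<Omega>" and bounded_dom: "bounded \<Omega>"
    and nonempty_dom: "\<Omega> \<noteq> {}"
    and holo: "g holomorphic_on \<Omega>"
    and deriv_u: "z \<in> \<Omega> \<Longrightarrow> (u has_derivative (\<lambda>h. Re ((g z - cnj z) * h))) (at z)"
    and cont_u: "continuous_on (closure \<Omega>) u"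
    and frontier_zero: "z \<in> frontier \<Omega> \<Longrightarrow> u z = 0"
    and cont_G: "continuous_on (closure \<Omega>) G"
    and G_eq: "z \<in> \<Omega> \<Longrightarrow> G z = cmod (g z - cnj z)"
begin

section \<open>Derivatives along lines, the minimum principle and the set of maximum points\<close>

definition m :: real where "m = (SUP z\<in>\<Omega>. u z)"

definition M :: "complex set" where "M = {z \<in> \<Omega>. u z = m}"

lemma segment_in_dom:
  assumes "open S" "z \<in> S" "cmod e = 1"
  obtains d where "0 < d" "\<And>t. \<bar>t\<bar> < d \<Longrightarrow> z + of_real t * e \<in> S"
proof -
  obtain d where "0 < d" "ball z d \<subseteq> S" using assms open_contains_ball by blast
  moreover have "z + of_real t * e \<in> ball z d" if "\<bar>t\<bar> < d" for t
    using that assms by (simp add: dist_norm norm_mult)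
  ultimately show ?thesis using that by blast
qed

lemma u_line:
  assumes "z + of_real t * e \<in> \<Omega>"
  defines "w \<equiv> z + of_real t * e"
  shows "((\<lambda>t. u (z + of_real t * e)) has_real_derivative Re ((g w - cnj w) * e)) (at t)"
proof -
  have "((\<lambda>t. z + of_real t * e) has_derivative (\<lambda>h. of_real h * e)) (at t)"
    by (auto intro!: derivative_eq_intros)
  from has_derivative_compose[OF this deriv_u[OF assms(1)]]
  show ?thesis
    unfolding has_field_derivative_def w_def by (rule has_derivative_eq_rhs) (auto simp: algebra_simps)
qed

lemma holomorphic_line:
  assumes "f holomorphic_on S" "open S" "z + of_real t * e \<in> S"
  shows "((\<lambda>t. f (z + of_real t * e)) has_vector_derivative deriv f (z + of_real t * e) * e) (at t)"
proof -
  have "((\<lambda>t. z + of_real t * e) has_vector_derivative e) (at t)"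
    by (auto intro!: derivative_eq_intros)
  from field_vector_diff_chain_at[OF this holomorphic_derivI[OF assms]]
  show ?thesis by (simp add: o_def mult.commute)
qed

lemma phi_line:
  assumes "z + of_real t * e \<in> \<Omega>"
  defines "w \<equiv> z + of_real t * e"
  shows "((\<lambda>t. Re (g (z + of_real t * e) - cnj (z + of_real t * e))) has_real_derivative
            Re (deriv g w * e - cnj e)) (at t)"
    and "((\<lambda>t. Im (g (z + of_real t * e) - cnj (z + of_real t * e))) has_real_derivative
            Im (deriv g w * e - cnj e)) (at t)"
    and "((\<lambda>t. Re (deriv g (z + of_real t * e) * e - cnj e)) has_real_derivative
            Re (deriv (deriv g) w * e\<^sup>2)) (at t)"
    and "((\<lambda>t. Im (deriv g (z + of_real t * e) * e - cnj e)) has_real_derivative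
            Im (deriv (deriv g) w * e\<^sup>2)) (at t)"
proof -
  have "((\<lambda>t. cnj (z + of_real t * e)) has_vector_derivative cnj e) (at t)"
    by (auto intro!: derivative_eq_intros)
  then have 1: "((\<lambda>t. g (z + of_real t * e) - cnj (z + of_real t * e)) has_vector_derivative
      deriv g w * e - cnj e) (at t)"
    using holomorphic_line[OF holo open_dom assms(1)] unfolding w_def
    by (intro has_vector_derivative_diff)
  have "((\<lambda>t. deriv g (z + of_real t * e) * e - cnj e) has_vector_derivative
      deriv (deriv g) w * e * e - 0) (at t)"
    using holomorphic_line[OF holomorphic_deriv[OF holo open_dom] open_dom assms(1)] unfolding w_def
    by (intro has_vector_derivative_diff has_vector_derivative_const has_vector_derivative_mult_left)
  then have 2: "((\<lambda>t. deriv g (z + of_real t * e) * e - cnj e) has_vector_derivative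
      deriv (deriv g) w * e\<^sup>2) (at t)"
    by (simp add: power2_eq_square mult.assoc)
  show "((\<lambda>t. Re (g (z + of_real t * e) - cnj (z + of_real t * e))) has_real_derivative
            Re (deriv g w * e - cnj e)) (at t)"
    and "((\<lambda>t. Im (g (z + of_real t * e) - cnj (z + of_real t * e))) has_real_derivative
            Im (deriv g w * e - cnj e)) (at t)"
    and "((\<lambda>t. Re (deriv g (z + of_real t * e) * e - cnj e)) has_real_derivative
            Re (deriv (deriv g) w * e\<^sup>2)) (at t)"
    and "((\<lambda>t. Im (deriv g (z + of_real t * e) * e - cnj e)) has_real_derivative
            Im (deriv (deriv g) w * e\<^sup>2)) (at t)"
    unfolding has_real_derivative_iff_has_vector_derivative
    by (rule bounded_linear.has_vector_derivative[OF bounded_linear_Re 1]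
        bounded_linear.has_vector_derivative[OF bounded_linear_Im 1]
        bounded_linear.has_vector_derivative[OF bounded_linear_Re 2]
        bounded_linear.has_vector_derivative[OF bounded_linear_Im 2])+
qed

lemma u'_line:
  assumes "z + of_real t * e \<in> \<Omega>"
  defines "w \<equiv> z + of_real t * e"
  shows "((\<lambda>t. Re ((g (z + of_real t * e) - cnj (z + of_real t * e)) * e)) has_real_derivative
            Re ((deriv g w * e - cnj e) * e)) (at t)"
  unfolding times_complex.sel w_def
  by (rule derivative_eq_intros phi_line(1,2)[OF assms(1)] refl)+ (simp add: algebra_simps)

text \<open>At a minimum the second derivatives in the directions \<open>1\<close> and
  \<open>\<i>\<close> are nonnegative, but they are \<open>Re g' - 1\<close> and
  \<open>- Re g' - 1\<close>, with sum \<open>-2\<close>.\<close>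

lemma no_local_min:
  assumes "open S" "z \<in> S" "S \<subseteq> \<Omega>" "\<And>w. w \<in> S \<Longrightarrow> u z \<le> u w"
  shows False
proof -
  have *: "0 \<le> Re ((deriv g z * e - cnj e) * e)" if e: "cmod e = 1" for e
  proof -
    obtain d where d: "0 < d" "\<And>t. \<bar>t\<bar> < d \<Longrightarrow> z + of_real t * e \<in> S"
      using segment_in_dom[OF assms(1,2) e] by blast
    then have in_dom: "\<And>t. \<bar>t\<bar> < d \<Longrightarrow> z + of_real t * e \<in> \<Omega>" using assms by blast
    have "- Re ((deriv g (z + of_real 0 * e) * e - cnj e) * e) \<le> 0"
    proof (rule second_derivative_test_max(2)[OF d(1)])
      show "((\<lambda>t. - u (z + of_real t * e)) has_real_derivative
         - Re ((g (z + of_real t * e) - cnj (z + of_real t * e)) * e)) (at t)" if "\<bar>t\<bar> < d" for t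
        using in_dom[OF that] by (intro DERIV_minus u_line)
      show "((\<lambda>t. - Re ((g (z + of_real t * e) - cnj (z + of_real t * e)) * e)) has_real_derivative
         - Re ((deriv g (z + of_real 0 * e) * e - cnj e) * e)) (at 0)"
        using in_dom[of 0] d by (intro DERIV_minus u'_line) simp
    qed (use assms d in auto)
    then show ?thesis by simp
  qed
  from *[of 1] *[of \<i>] show False by simp
qed

lemma compact_closure: "compact (closure \<Omega>)"
  using bounded_dom by simp

lemma dom_subset_closure: "z \<in> \<Omega> \<Longrightarrow> z \<in> closure \<Omega>"
  using closure_subset by blast

lemma closure_cases: "z \<in> closure \<Omega> \<Longrightarrow> z \<in> \<Omega> \<or> z \<in> frontier \<Omega>"
  using open_dom by (auto simp: frontier_def interior_open)

lemma u_nonneg: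
  assumes "z \<in> closure \<Omega>" shows "0 \<le> u z"
proof -
  have "closure \<Omega> \<noteq> {}" using nonempty_dom by simp
  then obtain p where p: "p \<in> closure \<Omega>" "\<And>w. w \<in> closure \<Omega> \<Longrightarrow> u p \<le> u w"
    using continuous_attains_inf[OF compact_closure _ cont_u] by blast
  have "p \<notin> \<Omega>"
    using no_local_min[OF open_dom, of p] p(2) dom_subset_closure by blast
  then have "u p = 0" using p(1) closure_cases frontier_zero by blast
  with p(2)[OF assms] show ?thesis by simp
qed

lemma u_pos: "z \<in> \<Omega> \<Longrightarrow> 0 < u z"
  using no_local_min[OF open_dom, of z] u_nonneg dom_subset_closure by (metis order_le_less subset_refl)

lemma max_attained: obtains p where "p \<in> \<Omega>" "u p = m" "\<And>z. z \<in> closure \<Omega> \<Longrightarrow> u z \<le> m"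
proof -
  have "closure \<Omega> \<noteq> {}" using nonempty_dom by simp
  then obtain p where p: "p \<in> closure \<Omega>" "\<And>w. w \<in> closure \<Omega> \<Longrightarrow> u w \<le> u p"
    using continuous_attains_sup[OF compact_closure _ cont_u] by blast
  obtain q where "q \<in> \<Omega>" using nonempty_dom by blast
  then have "0 < u p" using u_pos p(2) dom_subset_closure by (metis less_le_trans)
  then have "p \<in> \<Omega>" using p(1) closure_cases frontier_zero by fastforce
  moreover have "u p = m"
    unfolding m_def using calculation p(2) dom_subset_closure
    by (intro antisym cSUP_upper2[of _ _ p] cSUP_least) (auto intro!: bdd_aboveI2)
  ultimately show ?thesis using that p by metis
qed

lemma u_le: "z \<in> closure \<Omega> \<Longrightarrow> u z \<le> m"
  using max_attained by metis

lemma m_pos: "0 < m"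
  using max_attained u_pos by metis

lemma M_subset: "M \<subseteq> \<Omega>" by (auto simp: M_def)

lemma M_eq: "M = {z \<in> closure \<Omega>. u z = m}"
  using m_pos closure_cases frontier_zero dom_subset_closure by (fastforce simp: M_def)

lemma compact_M: "compact M"
proof -
  have "closed M"
    unfolding M_eq using continuous_closed_preimage_constant[OF cont_u closed_closure] .
  moreover have "bounded M" using bounded_dom M_subset bounded_subset by blast
  ultimately show ?thesis by (simp add: compact_eq_bounded_closed)
qed

lemma grad_zero_on_M:
  assumes "z \<in> M" shows "g z = cnj z"
proof -
  have z: "z \<in> \<Omega>" "\<And>w. w \<in> \<Omega> \<Longrightarrow> u w \<le> u z"
    using assms u_le dom_subset_closure by (auto simp: M_def)
  have "(\<lambda>h. Re ((g z - cnj z) * h)) = (\<lambda>h. 0)"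
    using differential_zero_maxmin[OF z(1) open_dom deriv_u[OF z(1)]] z(2) by blast
  then have "Re ((g z - cnj z) * 1) = 0" "Re ((g z - cnj z) * \<i>) = 0" by metis+
  then show ?thesis by (auto intro: complex_eqI)
qed

text \<open>The directions \<open>1\<close> and \<open>\<i>\<close> suffice. Their first-order
  conditions determine \<open>|g'|\<close>, and adding the two second-order conditions cancels
  \<open>g''\<close>, because it enters with the factor \<open>e\<^sup>2\<close>, which is
  \<open>1\<close> and \<open>-1\<close>. What remains is
  \<open>4 * \<omega> * (k * W / l - 1) \<le> 0\<close>, against \<open>F z > 0\<close>.\<close>

lemma no_interior_max:
  assumes \<sigma>: "\<sigma> = 1 \<or> \<sigma> = -1" and a: "0 < a"
  defines "F \<equiv> \<lambda>z. weight \<sigma> a (m - u z) * (cmod (g z - cnj z))\<^sup>2 - excess \<sigma> a (m - u z)"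
  assumes S: "open S" "z \<in> S" "S \<subseteq> \<Omega>" and lt: "\<And>w. w \<in> S \<Longrightarrow> u w < m"
    and max: "\<And>w. w \<in> S \<Longrightarrow> F w \<le> F z" and pos: "0 < F z"
  shows False
proof -
  define p q where "p = Re (g z - cnj z)" and "q = Im (g z - cnj z)"
  define A C where "A = Re (deriv g z)" and "C = Im (deriv g z)"
  define g1 g2 where "g1 = Re (deriv (deriv g) z)" and "g2 = Im (deriv (deriv g) z)"
  define k l W where "k = weight \<sigma> a (m - u z)" and "l = excess \<sigma> a (m - u z)"
    and "W = p\<^sup>2 + q\<^sup>2"
  define \<omega> where "\<omega> = W / (a * l\<^sup>2)"
  have kl: "0 < k" "0 < l"
    using lt[OF S(2)] excess_pos[OF \<sigma> a] weight_pos[OF \<sigma> a] by (auto simp: k_def l_def)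
  have Fz: "F z = k * W - l"
    by (simp add: F_def k_def l_def W_def p_def q_def cmod_power2)
  then have kW: "l < k * W" using pos by simp
  then have W: "0 < W" using kl by (meson less_trans zero_less_mult_pos)
  then have \<omega>: "0 < \<omega>" using a kl by (simp add: \<omega>_def)
  have dir: "p * Re (deriv g z * e - cnj e) + q * Im (deriv g z * e - cnj e) = - Re ((g z - cnj z) * e) * (1 + \<omega>)"
    "(Re (deriv g z * e - cnj e))\<^sup>2 + (Im (deriv g z * e - cnj e))\<^sup>2
      + p * Re (deriv (deriv g) z * e\<^sup>2) + q * Im (deriv (deriv g) z * e\<^sup>2)
      - - Re ((deriv g z * e - cnj e) * e) * (1 + \<omega>)
      - - Re ((g z - cnj z) * e) * (2 * (p * Re (deriv g z * e - cnj e) + q * Im (deriv g z * e - cnj e)) / (a * l\<^sup>2)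
         - 4 * k * - Re ((g z - cnj z) * e) * W / (a * l ^ 3)) \<le> 0"
    if e: "cmod e = 1" for e
  proof -
    obtain d where d: "0 < d" "\<And>t. \<bar>t\<bar> < d \<Longrightarrow> z + of_real t * e \<in> S"
      using segment_in_dom[OF S(1,2) e] by blast
    then have in_dom: "\<And>t. \<bar>t\<bar> < d \<Longrightarrow> z + of_real t * e \<in> \<Omega>" using S by blast
    have d0: "z + of_real 0 * e \<in> \<Omega>" using in_dom[of 0] d by simp
    have dv: "((\<lambda>t. m - u (z + of_real t * e)) has_real_derivative
         - Re ((g (z + of_real t * e) - cnj (z + of_real t * e)) * e)) (at t)" if "\<bar>t\<bar> < d" for t
      using u_line[OF in_dom[OF that]] by (auto intro!: derivative_eq_intros)
    have max': "weight \<sigma> a (m - u (z + of_real t * e)) *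
        ((Re (g (z + of_real t * e) - cnj (z + of_real t * e)))\<^sup>2
          + (Im (g (z + of_real t * e) - cnj (z + of_real t * e)))\<^sup>2) - excess \<sigma> a (m - u (z + of_real t * e))
       \<le> weight \<sigma> a (m - u (z + of_real 0 * e)) *
        ((Re (g (z + of_real 0 * e) - cnj (z + of_real 0 * e)))\<^sup>2
          + (Im (g (z + of_real 0 * e) - cnj (z + of_real 0 * e)))\<^sup>2) - excess \<sigma> a (m - u (z + of_real 0 * e))"
      if "\<bar>t\<bar> < d" for t
      using max[OF d(2)[OF that]] unfolding F_def cmod_power2 by simp
    have pos': "0 < m - u (z + of_real t * e)" if "\<bar>t\<bar> < d" for t
      using lt[OF d(2)[OF that]] by simp
    note * = barrier_derivatives[OF \<sigma> a d(1) phi_line(1)[OF in_dom] phi_line(2)[OF in_dom] dv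
      phi_line(3)[OF d0] phi_line(4)[OF d0] DERIV_minus[OF u'_line[OF d0]] pos' max']
    show "p * Re (deriv g z * e - cnj e) + q * Im (deriv g z * e - cnj e) = - Re ((g z - cnj z) * e) * (1 + \<omega>)"
      using *(1)[unfolded of_real_0 mult_zero_left add_0_right]
      unfolding \<omega>_def W_def p_def q_def k_def l_def .
    show "(Re (deriv g z * e - cnj e))\<^sup>2 + (Im (deriv g z * e - cnj e))\<^sup>2
      + p * Re (deriv (deriv g) z * e\<^sup>2) + q * Im (deriv (deriv g) z * e\<^sup>2)
      - - Re ((deriv g z * e - cnj e) * e) * (1 + \<omega>)
      - - Re ((g z - cnj z) * e) * (2 * (p * Re (deriv g z * e - cnj e) + q * Im (deriv g z * e - cnj e)) / (a * l\<^sup>2)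
         - 4 * k * - Re ((g z - cnj z) * e) * W / (a * l ^ 3)) \<le> 0"
      using *(2)[unfolded of_real_0 mult_zero_left add_0_right]
      unfolding \<omega>_def W_def p_def q_def k_def l_def .
  qed
  have e1: "Re (deriv g z * 1 - cnj 1) = A - 1" "Im (deriv g z * 1 - cnj 1) = C"
    "Re (deriv (deriv g) z * 1\<^sup>2) = g1" "Im (deriv (deriv g) z * 1\<^sup>2) = g2"
    "- Re ((g z - cnj z) * 1) = - p" "- Re ((deriv g z * 1 - cnj 1) * 1) = 1 - A"
    by (simp_all add: A_def C_def p_def g1_def g2_def)
  have ei: "Re (deriv g z * \<i> - cnj \<i>) = - C" "Im (deriv g z * \<i> - cnj \<i>) = A + 1"
    "Re (deriv (deriv g) z * \<i>\<^sup>2) = - g1" "Im (deriv (deriv g) z * \<i>\<^sup>2) = - g2"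
    "- Re ((g z - cnj z) * \<i>) = q" "- Re ((deriv g z * \<i> - cnj \<i>) * \<i>) = A + 1"
    by (simp_all add: A_def C_def q_def g1_def g2_def)
  have c1: "p * (A - 1) + q * C = - p * (1 + \<omega>)"
    using dir(1)[of 1] unfolding e1 by simp
  have ci: "p * - C + q * (A + 1) = q * (1 + \<omega>)"
    using dir(1)[of \<i>] unfolding ei by simp
  define X where "X = 2 * p * (p * (1 + \<omega>)) / (a * l\<^sup>2) - 4 * k * p\<^sup>2 * W / (a * l ^ 3)"
  define Y where "Y = 2 * q * (q * (1 + \<omega>)) / (a * l\<^sup>2) - 4 * k * q\<^sup>2 * W / (a * l ^ 3)"
  have "(A - 1)\<^sup>2 + C\<^sup>2 + p * g1 + q * g2 - (1 - A) * (1 + \<omega>)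
      - - p * (2 * (- p * (1 + \<omega>)) / (a * l\<^sup>2) - 4 * k * - p * W / (a * l ^ 3)) \<le> 0"
    using dir(2)[of 1] unfolding e1 c1 by simp
  moreover have "- p * (2 * (- p * (1 + \<omega>)) / (a * l\<^sup>2) - 4 * k * - p * W / (a * l ^ 3)) = X"
    by (simp add: X_def power2_eq_square right_diff_distrib mult_ac)
  ultimately have s1: "(A - 1)\<^sup>2 + C\<^sup>2 + p * g1 + q * g2 - (1 - A) * (1 + \<omega>) - X \<le> 0" by simp
  have "(- C)\<^sup>2 + (A + 1)\<^sup>2 + p * - g1 + q * - g2 - (A + 1) * (1 + \<omega>)
      - q * (2 * (q * (1 + \<omega>)) / (a * l\<^sup>2) - 4 * k * q * W / (a * l ^ 3)) \<le> 0"
    using dir(2)[of \<i>] unfolding ei ci by simp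
  moreover have "q * (2 * (q * (1 + \<omega>)) / (a * l\<^sup>2) - 4 * k * q * W / (a * l ^ 3)) = Y"
    by (simp add: Y_def power2_eq_square right_diff_distrib mult_ac)
  ultimately have si: "C\<^sup>2 + (A + 1)\<^sup>2 - p * g1 - q * g2 - (A + 1) * (1 + \<omega>) - Y \<le> 0" by simp
  \<comment> \<open>The two squares come from the real and imaginary parts of
    \<open>g' * cnj (p + \<i> q)\<close>, both known from the first-order conditions.\<close>
  have "W * (A\<^sup>2 + C\<^sup>2) = (p * A + q * C)\<^sup>2 + (q * A - p * C)\<^sup>2"
    by (simp add: W_def power2_eq_square algebra_simps)
  also have "p * A + q * C = - p * \<omega>" using c1 by (simp add: algebra_simps)
  also have "q * A - p * C = q * \<omega>" using ci by (simp add: algebra_simps)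
  also have "(- p * \<omega>)\<^sup>2 + (q * \<omega>)\<^sup>2 = W * \<omega>\<^sup>2" by (simp add: W_def power2_eq_square algebra_simps)
  finally have AC: "A\<^sup>2 + C\<^sup>2 = \<omega>\<^sup>2" using W by simp
  have "X + Y = 2 * (p\<^sup>2 + q\<^sup>2) * (1 + \<omega>) / (a * l\<^sup>2) - 4 * k * (p\<^sup>2 + q\<^sup>2) * W / (a * l ^ 3)"
    unfolding X_def Y_def by (simp add: power2_eq_square add_divide_distrib algebra_simps)
  also have "\<dots> = 2 * \<omega> * (1 + \<omega>) - 4 * \<omega> * (k * W / l)"
    unfolding W_def[symmetric] \<omega>_def by (simp add: power2_eq_square power3_eq_cube mult_ac)
  finally have XY: "X + Y = 2 * \<omega> * (1 + \<omega>) - 4 * \<omega> * (k * W / l)" .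
  have "(1 - A) * (1 + \<omega>) + (A + 1) * (1 + \<omega>) = 2 * (1 + \<omega>)"
    by (simp add: algebra_simps)
  moreover have "(A - 1)\<^sup>2 + C\<^sup>2 + (C\<^sup>2 + (A + 1)\<^sup>2) = 2 * \<omega>\<^sup>2 + 2"
    using AC by (simp add: power2_eq_square algebra_simps)
  ultimately have "2 * \<omega>\<^sup>2 + 2 - 2 * (1 + \<omega>) - (X + Y) \<le> 0"
    using s1 si by linarith
  then have "4 * \<omega> * (k * W / l - 1) \<le> 0"
    unfolding XY by (simp add: power2_eq_square algebra_simps)
  moreover have "1 < k * W / l" using kW kl by simp
  ultimately show False using \<omega> by (simp add: mult_le_0_iff)
qed

text \<open>The usual bound for a function that stays below \<open>m\<close> and has bounded second
  derivatives: moving from \<open>z\<close> a distance \<open>n / C\<close> along the unit gradient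
  \<open>e\<close> raises \<open>u\<close> by at least \<open>n\<^sup>2 / (2 * C)\<close>, where
  \<open>n = |\<nabla>u|\<close>, and the value reached is still at most \<open>m\<close>. Near
  \<open>M\<close> the segment stays in the domain; by compactness, points with \<open>u\<close>
  close to \<open>m\<close> are near \<open>M\<close>.\<close>

lemma gradient_bound_near_M:
  obtains C \<delta> where "0 \<le> C" "0 < \<delta>"
    "\<And>z. z \<in> \<Omega> \<Longrightarrow> m - u z < \<delta> \<Longrightarrow> (cmod (g z - cnj z))\<^sup>2 \<le> C * (m - u z)"
proof -
  have M_ne: "M \<noteq> {}" by (rule max_attained) (auto simp: M_def)
  obtain r where r: "0 < r" "(\<Union>x\<in>M. cball x r) \<subseteq> \<Omega>"
    by (rule compact_subset_open_imp_cball_epsilon_subset[OF compact_M open_dom M_subset])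
  define K where "K = {z. infdist z M \<le> r}"
  have K_dom: "K \<subseteq> \<Omega>"
  proof
    fix z assume "z \<in> K"
    moreover obtain x where "x \<in> M" "infdist z M = dist z x"
      using infdist_attains_inf[OF compact_imp_closed[OF compact_M] M_ne] by blast
    ultimately have "z \<in> cball x r" by (simp add: K_def dist_commute)
    with r(2) \<open>x \<in> M\<close> show "z \<in> \<Omega>" by blast
  qed
  have "closed K" unfolding K_def
    by (intro closed_Collect_le continuous_intros)
  then have "compact K"
    using K_dom bounded_dom bounded_subset compact_eq_bounded_closed by blast
  moreover have "continuous_on K (deriv g)" "continuous_on K (\<lambda>z. g z - cnj z)"
    using K_dom holo holomorphic_deriv[OF holo open_dom]
    by (auto intro!: continuous_intros intro: continuous_on_subset holomorphic_on_imp_continuous_on)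
  ultimately have "bounded (deriv g ` K)" "bounded ((\<lambda>z. g z - cnj z) ` K)"
    by (auto intro: compact_imp_bounded compact_continuous_image)
  then obtain C0 G0 where C0: "\<And>z. z \<in> K \<Longrightarrow> cmod (deriv g z) \<le> C0" "0 < C0"
    and G0: "\<And>z. z \<in> K \<Longrightarrow> cmod (g z - cnj z) \<le> G0" "0 < G0"
    unfolding bounded_pos by auto
  \<comment> \<open>\<open>1 + C0\<close> bounds the rate of change of the gradient; the summand
    \<open>2 * G0 / r\<close> keeps the step length \<open>n / C\<close> below
    \<open>r / 2\<close>.\<close>
  define C where "C = 1 + C0 + 2 * G0 / r"
  have C: "1 + C0 \<le> C" "2 * G0 / r \<le> C" "0 < C" using C0(2) G0(2) r(1) unfolding C_def by (auto intro!: add_pos_pos add_nonneg_nonneg)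
  have bound: "(cmod (g z - cnj z))\<^sup>2 \<le> 2 * C * (m - u z)" if z: "infdist z M \<le> r / 2" for z
  proof (cases "g z = cnj z")
    case True
    have "z \<in> K" using z r by (simp add: K_def)
    then have "u z \<le> m" using u_le K_dom dom_subset_closure by blast
    with True C show ?thesis by simp
  next
    case False
    define n where "n = cmod (g z - cnj z)"
    have n: "0 < n" using False by (simp add: n_def)
    define e where "e = cnj (g z - cnj z) / n"
    have e: "cmod e = 1" using n by (simp add: e_def n_def norm_divide del: complex_cnj_diff)
    have ze: "Re ((g z - cnj z) * e) = n"
    proof -
      have "(g z - cnj z) * e = (of_real n)\<^sup>2 / of_real n"
        unfolding e_def n_def by (simp add: complex_norm_square del: complex_cnj_diff flip: of_real_power)
      then show ?thesis by (simp add: power2_eq_square)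
    qed
    have ball_K: "cball z (r / 2) \<subseteq> K"
    proof
      fix x assume "x \<in> cball z (r / 2)"
      then show "x \<in> K" using z infdist_triangle[of x M z] by (simp add: K_def dist_commute)
    qed
    define t0 where "t0 = n / C"
    have zK: "z \<in> K" using ball_K r by auto
    have t0: "0 < t0" "t0 \<le> r / 2"
    proof -
      have "2 * n / r \<le> C" using C(2) G0(1)[OF zK] r(1) unfolding n_def
        by (smt (verit) divide_right_mono)
      then show "0 < t0" "t0 \<le> r / 2" using n C r by (auto simp: t0_def field_simps)
    qed
    have in_ball: "z + of_real t * e \<in> cball z (r / 2)" if "0 \<le> t" "t \<le> t0" for t
      using that t0 e by (simp add: dist_norm norm_mult)
    define h where "h t = (m - u (z + of_real t * e)) + t * n - C * t\<^sup>2 / 2" for t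
    have "h t0 \<le> h 0"
    proof (rule DERIV_nonpos_imp_nonincreasing[of 0 t0 h])
      fix t assume t: "0 \<le> t" "t \<le> t0"
      let ?w = "z + of_real t * e"
      have w: "?w \<in> cball z (r / 2)" "?w \<in> \<Omega>" using in_ball[OF t] ball_K K_dom by blast+
      have "(h has_real_derivative (- Re ((g ?w - cnj ?w) * e) + n - C * t)) (at t)"
        unfolding h_def using u_line[OF w(2)] by (auto intro!: derivative_eq_intros)
      moreover have "- Re ((g ?w - cnj ?w) * e) + n - C * t \<le> 0"
      proof -
        have "cmod (g ?w - g z) \<le> C0 * cmod (?w - z)"
        proof (rule field_differentiable_bound[of "cball z (r / 2)"])
          fix x assume "x \<in> cball z (r / 2)"
          then have "x \<in> K" "x \<in> \<Omega>" using ball_K K_dom by blast+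
          then show "(g has_field_derivative deriv g x) (at x within cball z (r / 2))"
            "cmod (deriv g x) \<le> C0"
            using holomorphic_derivI[OF holo open_dom] C0 by blast+
        qed (use w r in auto)
        also have "cmod (?w - z) = t" using t e by (simp add: norm_mult)
        finally have "cmod (g ?w - g z) \<le> C0 * t" .
        moreover have "cmod (cnj (?w - z)) = t"
          using \<open>cmod (?w - z) = t\<close> unfolding complex_mod_cnj .
        moreover have "(g z - cnj z) - (g ?w - cnj ?w) = cnj (?w - z) - (g ?w - g z)"
          by simp
        then have "cmod ((g z - cnj z) - (g ?w - cnj ?w)) \<le> cmod (cnj (?w - z)) + cmod (g ?w - g z)"
          by (simp only: norm_triangle_ineq4)
        ultimately have "cmod ((g z - cnj z) - (g ?w - cnj ?w)) \<le> C0 * t + t"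
          by linarith
        then have "cmod (((g z - cnj z) - (g ?w - cnj ?w)) * e) \<le> C0 * t + t"
          using e by (simp add: norm_mult)
        then have "Re (((g z - cnj z) - (g ?w - cnj ?w)) * e) \<le> C0 * t + t"
          using complex_Re_le_cmod order_trans by blast
        then have "n - Re ((g ?w - cnj ?w) * e) \<le> C0 * t + t"
          using ze by (simp only: left_diff_distrib minus_complex.sel)
        also have "\<dots> \<le> C * t" using mult_right_mono[OF C(1) t(1)] by (simp add: algebra_simps)
        finally show ?thesis by simp
      qed
      ultimately show "\<exists>y. (h has_real_derivative y) (at t) \<and> y \<le> 0" by blast
    qed (use t0 in simp)
    moreover have "z + of_real t0 * e \<in> \<Omega>"
      using in_ball[of t0] t0 ball_K K_dom by (meson less_imp_le order_refl subsetD)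
    then have "u (z + of_real t0 * e) \<le> m" using u_le dom_subset_closure by blast
    ultimately have "t0 * n - C * t0\<^sup>2 / 2 \<le> m - u z" by (simp add: h_def mult.commute)
    moreover have "t0 * n - C * t0\<^sup>2 / 2 = n\<^sup>2 / (2 * C)"
      using C by (simp add: t0_def field_simps power2_eq_square)
    ultimately have "n\<^sup>2 / (2 * C) \<le> m - u z" by simp
    then show ?thesis using C(3) by (simp add: n_def divide_le_eq mult.commute)
  qed
  define L where "L = {z \<in> closure \<Omega>. r / 2 \<le> infdist z M}"
  have "compact L"
  proof -
    have "L = closure \<Omega> \<inter> {z. r / 2 \<le> infdist z M}" by (auto simp: L_def)
    moreover have "closed {z. r / 2 \<le> infdist z M}" by (intro closed_Collect_le continuous_intros)
    ultimately show ?thesis using compact_closure compact_Int_closed by metis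
  qed
  obtain \<delta> where \<delta>: "0 < \<delta>" "\<And>z. z \<in> L \<Longrightarrow> \<delta> \<le> m - u z"
  proof (cases "L = {}")
    case True then show ?thesis using that[of 1] by simp
  next
    case False
    have "continuous_on L u" using cont_u by (rule continuous_on_subset) (auto simp: L_def)
    then obtain x where x: "x \<in> L" "\<And>z. z \<in> L \<Longrightarrow> u z \<le> u x"
      using continuous_attains_sup[OF \<open>compact L\<close> False] by blast
    have "x \<notin> M" using x(1) r(1) by (auto simp: L_def)
    then have "u x < m" using x(1) u_le by (fastforce simp: M_eq L_def)
    with x(2) show ?thesis by (intro that[of "m - u x"]) auto
  qed
  show ?thesis
  proof (rule that[of "2 * C" \<delta>])
    fix z assume z: "z \<in> \<Omega>" "m - u z < \<delta>"
    then have "z \<notin> L" using \<delta>(2) by force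
    then have "infdist z M \<le> r / 2" using z dom_subset_closure by (auto simp: L_def)
    then show "(cmod (g z - cnj z))\<^sup>2 \<le> 2 * C * (m - u z)" by (rule bound)
  qed (use C \<delta> in auto)
qed

text \<open>
  The function compared with \<open>0\<close> here has no positive interior maximum because, with \<open>k = weight\<close>, \<open>l = excess\<close>,
  \<open>W = |\<nabla>u|\<^sup>2\<close> and \<open>\<omega> = W / (a l\<^sup>2)\<close>, its Laplacian at a critical point is \<open>8 k \<omega> (k W / l - 1)\<close>; on the maximum
  set it vanishes since \<open>|\<nabla>u|\<^sup>2 = O(m - u)\<close> there.
\<close>

theorem gradient_comparison:
  assumes \<sigma>: "\<sigma> = 1 \<or> \<sigma> = -1" and a: "0 < a"
    and N: "open N" "N \<subseteq> \<Omega> - M" and cl: "closure N \<subseteq> N \<union> M \<union> \<Gamma>" and \<Gamma>: "\<Gamma> \<subseteq> frontier \<Omega>"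
    and bd: "\<And>z. z \<in> \<Gamma> \<Longrightarrow> weight \<sigma> a m * (G z)\<^sup>2 \<le> excess \<sigma> a m"
    and z: "z \<in> N"
  shows "weight \<sigma> a (m - u z) * (cmod (g z - cnj z))\<^sup>2 \<le> excess \<sigma> a (m - u z)"
proof (rule ccontr)
  assume neg: "\<not> ?thesis"
  define F where "F w = weight \<sigma> a (m - u w) * (G w)\<^sup>2 - excess \<sigma> a (m - u w)" for w
  have clN: "closure N \<subseteq> closure \<Omega>" using N(2) by (intro closure_mono) auto
  have Fz: "0 < F z" using neg z N G_eq[of z] by (auto simp: F_def)
  have v0: "0 < m - u z" using z N u_le[of z] dom_subset_closure by (fastforce simp: M_def)
  obtain C \<delta>1 where C: "0 \<le> C" "0 < \<delta>1"
    "\<And>z. z \<in> \<Omega> \<Longrightarrow> m - u z < \<delta>1 \<Longrightarrow> (cmod (g z - cnj z))\<^sup>2 \<le> C * (m - u z)"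
    using gradient_bound_near_M by blast
  have "((\<lambda>v. C * (weight \<sigma> a v * v)) \<longlongrightarrow> C * 0) (at_right 0)"
    by (intro tendsto_mult tendsto_const weight_times_tendsto[OF \<sigma> a])
  then have "\<forall>\<^sub>F v in at_right 0. C * (weight \<sigma> a v * v) < F z"
    using Fz by (intro order_tendstoD) auto
  then obtain \<delta>2 where \<delta>2: "0 < \<delta>2" "\<And>v. 0 < v \<Longrightarrow> v < \<delta>2 \<Longrightarrow> C * (weight \<sigma> a v * v) < F z"
    unfolding eventually_at_right_field by auto
  define \<delta> where "\<delta> = min (min \<delta>1 \<delta>2) (m - u z)"
  have \<delta>: "0 < \<delta>" "\<delta> \<le> \<delta>1" "\<delta> \<le> \<delta>2" "\<delta> \<le> m - u z"
    using C \<delta>2 v0 by (auto simp: \<delta>_def)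
  \<comment> \<open>By the choice of \<delta> the maximum of \<open>F\<close> on \<open>K\<close> is
    attained where \<open>m - u\<close> is at least \<delta>. Cutting at \<open>\<delta> / 2\<close>
    therefore keeps the maximum point off the artificial part of the boundary of
    \<open>K\<close>.\<close>
  define K where "K = {w \<in> closure N. u w \<le> m - \<delta> / 2}"
  have "compact K"
  proof -
    have "closed K" unfolding K_def
      using cont_u clN by (intro continuous_on_closed_Collect_le continuous_on_const) (auto intro: continuous_on_subset)
    moreover have "K \<subseteq> closure \<Omega>" using clN by (auto simp: K_def)
    ultimately show ?thesis using compact_closure compact_imp_bounded bounded_subset compact_eq_bounded_closed by metis
  qed
  moreover have "continuous_on K F"
  proof -
    have K_sub: "K \<subseteq> closure \<Omega>" using clN by (auto simp: K_def)
    have "continuous_on {0<..} (weight \<sigma> a)" "continuous_on {0<..} (excess \<sigma> a)"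
      using weight_deriv[OF \<sigma> a] excess_deriv[OF \<sigma> a]
      by (auto intro!: DERIV_isCont continuous_at_imp_continuous_on)
    moreover have "continuous_on K (\<lambda>w. m - u w)" "(\<lambda>w. m - u w) ` K \<subseteq> {0<..}"
      using continuous_on_subset[OF cont_u K_sub] \<delta> by (auto intro!: continuous_intros simp: K_def)
    ultimately have "continuous_on K (\<lambda>w. weight \<sigma> a (m - u w))" "continuous_on K (\<lambda>w. excess \<sigma> a (m - u w))"
      using continuous_on_compose2 by blast+
    then show ?thesis
      unfolding F_def using continuous_on_subset[OF cont_G K_sub] by (intro continuous_intros)
  qed
  moreover have "z \<in> K" using z \<delta> closure_subset by (auto simp: K_def)
  ultimately obtain z1 where z1: "z1 \<in> K" "\<And>w. w \<in> K \<Longrightarrow> F w \<le> F z1"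
    using continuous_attains_sup[of K F] by blast
  have Fz1: "F z \<le> F z1" "0 < F z1" using z1 \<open>z \<in> K\<close> Fz by force+
  have "z1 \<notin> M" using z1(1) \<delta> by (auto simp: K_def M_def)
  moreover have "z1 \<notin> \<Gamma>"
    using bd[of z1] \<Gamma> frontier_zero[of z1] Fz1 by (auto simp: F_def)
  ultimately have z1N: "z1 \<in> N" using z1(1) cl by (auto simp: K_def)
  then have z1\<Omega>: "z1 \<in> \<Omega>" using N by auto
  have v1: "0 < m - u z1" using z1(1) \<delta> by (auto simp: K_def)
  have "\<delta> \<le> m - u z1"
  proof (rule ccontr)
    assume small: "\<not> \<delta> \<le> m - u z1"
    have "F z1 \<le> weight \<sigma> a (m - u z1) * (cmod (g z1 - cnj z1))\<^sup>2"
      using excess_pos[OF \<sigma> a v1] G_eq[OF z1\<Omega>] by (simp add: F_def)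
    also have "\<dots> \<le> weight \<sigma> a (m - u z1) * (C * (m - u z1))"
      using weight_pos[OF \<sigma> a v1] C(3)[OF z1\<Omega>] small \<delta> by (intro mult_left_mono) auto
    also have "\<dots> < F z" using \<delta>2(2)[OF v1] small \<delta> by (simp add: mult_ac)
    finally show False using Fz1 by simp
  qed
  define S where "S = {w \<in> N. u w < m - \<delta> / 2}"
  have "open S"
  proof -
    have "continuous_on N u"
      using cont_u by (rule continuous_on_subset) (use N(2) dom_subset_closure in auto)
    then have "open (N \<inter> u -` {..< m - \<delta> / 2})"
      using N(1) by (intro continuous_open_preimage) auto
    moreover have "S = N \<inter> u -` {..< m - \<delta> / 2}" by (auto simp: S_def)
    ultimately show ?thesis by simp
  qed
  have F_eq: "weight \<sigma> a (m - u w) * (cmod (g w - cnj w))\<^sup>2 - excess \<sigma> a (m - u w) = F w" if "w \<in> N" for w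
    using G_eq[of w] that N by (auto simp: F_def)
  show False
  proof (rule no_interior_max[OF \<sigma> a \<open>open S\<close>])
    show "z1 \<in> S" using z1N \<open>\<delta> \<le> m - u z1\<close> \<delta> by (simp add: S_def)
    show "S \<subseteq> \<Omega>" using N by (auto simp: S_def)
    show "u w < m" if "w \<in> S" for w using that \<delta> by (simp add: S_def)
    show "weight \<sigma> a (m - u w) * (cmod (g w - cnj w))\<^sup>2 - excess \<sigma> a (m - u w)
        \<le> weight \<sigma> a (m - u z1) * (cmod (g z1 - cnj z1))\<^sup>2 - excess \<sigma> a (m - u z1)" if "w \<in> S" for w
      using that z1(2)[of w] F_eq z1N closure_subset by (auto simp: S_def K_def)
    show "0 < weight \<sigma> a (m - u z1) * (cmod (g z1 - cnj z1))\<^sup>2 - excess \<sigma> a (m - u z1)"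
      using Fz1 F_eq[OF z1N] by simp
  qed
qed

end

text \<open>From \<open>v = s\<^sup>2 + c s\<^sup>3 + ...\<close> and
  \<open>y = 2 s + 3 c s\<^sup>2 + ...\<close> one gets
  \<open>y\<^sup>2 / (4 v) = 1 + 2 c s + ...\<close>, where \<open>s\<close> is asymptotic to
  \<open>sqrt v\<close>. The coefficient \<open>2 * c\<close> is compared with the one in
  \<open>model_gradient_expansion\<close>.\<close>

lemma normal_expansion_bound:
  fixes v y :: "real \<Rightarrow> real"
  assumes \<sigma>: "\<sigma> = 1 \<or> \<sigma> = -1" and a: "0 < a"
    and v: "((\<lambda>s. (v s - s\<^sup>2) / s ^ 3) \<longlongrightarrow> c) (at_right 0)"
    and y: "((\<lambda>s. (y s - 2 * s) / s\<^sup>2) \<longlongrightarrow> 3 * c) (at_right 0)"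
    and le: "\<forall>\<^sub>F s in at_right 0. weight \<sigma> a (v s) * (y s)\<^sup>2 \<le> excess \<sigma> a (v s)"
  shows "2 * c \<le> - \<sigma> * 2 / (3 * sqrt a)"
proof -
  have id: "((\<lambda>s. s) \<longlongrightarrow> (0::real)) (at_right 0)" by (rule tendsto_ident_at)
  have nz: "\<forall>\<^sub>F s in at_right 0. (0::real) < s" by (rule eventually_at_right_less)
  have "((\<lambda>s. 1 + s * ((v s - s\<^sup>2) / s ^ 3)) \<longlongrightarrow> 1 + 0 * c) (at_right 0)"
    by (intro tendsto_intros id v)
  then have "((\<lambda>s. v s / s\<^sup>2) \<longlongrightarrow> 1 + 0 * c) (at_right 0)"
    by (rule Lim_transform_eventually)
       (use nz in eventually_elim, simp add: field_simps power2_eq_square power3_eq_cube)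
  then have vq: "((\<lambda>s. v s / s\<^sup>2) \<longlongrightarrow> 1) (at_right 0)" by simp
  have "\<forall>\<^sub>F s in at_right 0. 0 < v s / s\<^sup>2" using order_tendstoD(1)[OF vq, of 0] by simp
  with nz have vpos: "\<forall>\<^sub>F s in at_right 0. 0 < v s"
    by eventually_elim (simp add: zero_less_divide_iff)
  have "((\<lambda>s. v s / s\<^sup>2 * s\<^sup>2) \<longlongrightarrow> 1 * 0\<^sup>2) (at_right 0)"
    by (intro tendsto_intros id vq)
  then have "(v \<longlongrightarrow> 1 * 0\<^sup>2) (at_right 0)"
    by (rule Lim_transform_eventually) (use nz in eventually_elim, simp)
  then have v_lim: "filterlim v (at_right 0) (at_right 0)"
    using vpos by (auto simp: filterlim_at elim: eventually_mono)
  have "((\<lambda>s. 4 + s * ((y s - 2 * s) / s\<^sup>2)) \<longlongrightarrow> 4 + 0 * (3 * c)) (at_right 0)"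
    by (intro tendsto_intros id y)
  then have "((\<lambda>s. (y s + 2 * s) / s) \<longlongrightarrow> 4 + 0 * (3 * c)) (at_right 0)"
    by (rule Lim_transform_eventually)
       (use nz in eventually_elim, simp add: field_simps power2_eq_square)
  then have yq: "((\<lambda>s. (y s + 2 * s) / s) \<longlongrightarrow> 4) (at_right 0)" by simp
  have "((\<lambda>s. ((y s - 2 * s) / s\<^sup>2 * ((y s + 2 * s) / s) - 4 * ((v s - s\<^sup>2) / s ^ 3))
      / (4 * (v s / s\<^sup>2) * sqrt (v s / s\<^sup>2))) \<longlongrightarrow> (3 * c * 4 - 4 * c) / (4 * 1 * sqrt 1)) (at_right 0)"
    by (intro tendsto_intros y yq v vq) simp
  then have "((\<lambda>s. ((y s)\<^sup>2 / (4 * v s) - 1) / sqrt (v s)) \<longlongrightarrow> (3 * c * 4 - 4 * c) / (4 * 1 * sqrt 1)) (at_right 0)"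
  proof (rule Lim_transform_eventually)
    show "\<forall>\<^sub>F s in at_right 0. ((y s - 2 * s) / s\<^sup>2 * ((y s + 2 * s) / s) - 4 * ((v s - s\<^sup>2) / s ^ 3))
      / (4 * (v s / s\<^sup>2) * sqrt (v s / s\<^sup>2)) = ((y s)\<^sup>2 / (4 * v s) - 1) / sqrt (v s)"
      using nz vpos
    proof eventually_elim
      case (elim s)
      have "(y s - 2 * s) / s\<^sup>2 * ((y s + 2 * s) / s) - 4 * ((v s - s\<^sup>2) / s ^ 3) = ((y s)\<^sup>2 - 4 * v s) / s ^ 3"
        using elim by (simp add: field_simps power2_eq_square power3_eq_cube)
      moreover have "4 * (v s / s\<^sup>2) * sqrt (v s / s\<^sup>2) = 4 * v s * sqrt (v s) / s ^ 3"
        using elim by (simp add: real_sqrt_divide power2_eq_square power3_eq_cube)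
      moreover have "((y s)\<^sup>2 / (4 * v s) - 1) / sqrt (v s) = ((y s)\<^sup>2 - 4 * v s) / (4 * v s * sqrt (v s))"
        using elim by (simp add: field_simps)
      ultimately show ?case using elim by simp
    qed
  qed
  then have left: "((\<lambda>s. ((y s)\<^sup>2 / (4 * v s) - 1) / sqrt (v s)) \<longlongrightarrow> 2 * c) (at_right 0)" by simp
  have right: "((\<lambda>s. (excess \<sigma> a (v s) / (4 * weight \<sigma> a (v s) * v s) - 1) / sqrt (v s))
      \<longlongrightarrow> - \<sigma> * 2 / (3 * sqrt a)) (at_right 0)"
    using filterlim_compose[OF model_gradient_expansion[OF \<sigma> a] v_lim] .
  have "\<forall>\<^sub>F s in at_right 0. ((y s)\<^sup>2 / (4 * v s) - 1) / sqrt (v s)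
      \<le> (excess \<sigma> a (v s) / (4 * weight \<sigma> a (v s) * v s) - 1) / sqrt (v s)"
    using le vpos
  proof eventually_elim
    case (elim s)
    have k: "0 < weight \<sigma> a (v s)" by (rule weight_pos[OF \<sigma> a elim(2)])
    have "(y s)\<^sup>2 / (4 * v s) \<le> excess \<sigma> a (v s) / (4 * weight \<sigma> a (v s) * v s)"
      using elim k by (simp add: field_simps)
    then show ?case using elim by (intro divide_right_mono) auto
  qed
  from tendsto_le[OF _ right left this] show ?thesis by simp
qed


section \<open>The ridge of maximum points\<close>

context torsion
begin

definition ridge :: "complex set" where "ridge = {p \<in> M. p islimpt M}"

lemma ridge_subset: "ridge \<subseteq> \<Omega>" "ridge \<subseteq> M"
  using M_subset by (auto simp: ridge_def)

lemma compact_ridge: "compact ridge"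
proof -
  have "ridge = M \<inter> {p. p islimpt M}" by (auto simp: ridge_def)
  then show ?thesis using compact_M closed_limpts by (metis compact_Int_closed)
qed

lemma ridge_nonempty: "infinite M \<Longrightarrow> ridge \<noteq> {}"
  using compact_M unfolding compact_eq_Bolzano_Weierstrass ridge_def by fastforce

lemma deriv_g: "z \<in> \<Omega> \<Longrightarrow> (g has_field_derivative deriv g z) (at z)"
  using holo open_dom by (rule holomorphic_derivI)

lemma deriv_deriv_g: "z \<in> \<Omega> \<Longrightarrow> (deriv g has_field_derivative deriv (deriv g) z) (at z)"
  using holomorphic_deriv[OF holo open_dom] open_dom by (rule holomorphic_derivI)

text \<open>
  The critical points of \<open>u\<close> are the fixed points of \<open>z \<mapsto> cnj (g z)\<close>. The square of this map is holomorphic and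
  fixes \<open>M\<close>, hence near the ridge it is the identity.
\<close>

lemma reflection_involutive:
  assumes p: "p \<in> ridge"
  obtains r where "0 < r" "ball p r \<subseteq> \<Omega>" "\<And>z. z \<in> ball p r \<Longrightarrow> cnj (g z) \<in> \<Omega>"
    "\<And>z. z \<in> ball p r \<Longrightarrow> g (cnj (g z)) = cnj z"
proof -
  have pM: "p \<in> M" "p \<in> \<Omega>" "p islimpt M" using p M_subset by (auto simp: ridge_def)
  have gp: "cnj (g p) = p" using grad_zero_on_M[OF pM(1)] by simp
  have "isCont (\<lambda>z. cnj (g z)) p"
    using deriv_g[OF pM(2)] by (intro continuous_intros DERIV_isCont)
  then have "((\<lambda>z. cnj (g z)) \<longlongrightarrow> cnj (g p)) (nhds p)"
    using tendsto_at_iff_tendsto_nhds[of "\<lambda>z. cnj (g z)" p] by (simp add: isCont_def)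
  from topological_tendstoD[OF this open_dom]
  have "\<forall>\<^sub>F z in nhds p. cnj (g z) \<in> \<Omega>" using pM(2) gp by simp
  moreover have "\<forall>\<^sub>F z in nhds p. z \<in> \<Omega>"
    using open_dom pM(2) by (rule eventually_nhds_in_open)
  ultimately have "\<forall>\<^sub>F z in nhds p. cnj (g z) \<in> \<Omega> \<and> z \<in> \<Omega>"
    by (rule eventually_conj)
  then obtain r where r: "0 < r" "\<And>z. dist z p < r \<Longrightarrow> cnj (g z) \<in> \<Omega> \<and> z \<in> \<Omega>"
    unfolding eventually_nhds_metric by blast
  have hol: "cnj \<circ> g \<circ> cnj holomorphic_on cnj ` \<Omega>"
    using holo open_dom
    by (intro holomorphic_on_compose_cnj_cnj) (auto simp: image_image image_cnj_conv_vimage_cnj intro!: open_vimage continuous_intros)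
  have "(cnj \<circ> g \<circ> cnj) \<circ> g holomorphic_on ball p r"
  proof (rule holomorphic_on_compose_gen[OF _ hol])
    show "g holomorphic_on ball p r"
      using r by (intro holomorphic_on_subset[OF holo]) (auto simp: dist_commute)
    show "g ` ball p r \<subseteq> cnj ` \<Omega>"
      using r(2) by (force simp: dist_commute image_iff intro: bexI[of _ "cnj (g _)"])
  qed
  then have hol2: "(\<lambda>z. cnj (g (cnj (g z))) - z) holomorphic_on ball p r"
    by (intro holomorphic_intros) (simp add: o_def)
  have lim: "p islimpt M \<inter> ball p r"
    using pM(3) r(1) by (intro islimpt_Int_eventually eventually_at_in_open') auto
  have "cnj (g (cnj (g z))) - z = 0" if "z \<in> ball p r" for z
  proof (rule analytic_continuation[OF hol2 open_ball connected_ball _ _ lim _ that])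
    show "cnj (g (cnj (g w))) - w = 0" if "w \<in> M \<inter> ball p r" for w
      using grad_zero_on_M[of w] that by simp
  qed (use r in auto)
  then have "g (cnj (g z)) = cnj z" if "z \<in> ball p r" for z
    using that by (metis complex_cnj_cnj eq_iff_diff_eq_0)
  with r show ?thesis by (intro that[of r]) (auto simp: dist_commute)
qed

text \<open>Both relations come from differentiating \<open>g (cnj (g z)) = cnj z\<close>, once and
  twice, at a fixed point. The second derivative of \<open>u\<close> along a unit vector
  \<open>e\<close> is \<open>Re (g' e\<^sup>2) - 1\<close>, so the first relation says that the
  Hessian has eigenvalues \<open>0\<close> and \<open>-2\<close>.\<close>

lemma ridge_derivatives:
  assumes p: "p \<in> ridge"
  shows "cmod (deriv g p) = 1"
    and "cnj (deriv (deriv g) p) * (deriv g p)\<^sup>2 + cnj (deriv g p) * deriv (deriv g) p = 0"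
proof -
  obtain r where r: "0 < r" "ball p r \<subseteq> \<Omega>" "\<And>z. z \<in> ball p r \<Longrightarrow> cnj (g z) \<in> \<Omega>"
    "\<And>z. z \<in> ball p r \<Longrightarrow> g (cnj (g z)) = cnj z"
    using reflection_involutive[OF p] by blast
  have gp: "cnj (g p) = p" using grad_zero_on_M[of p] p ridge_subset by auto
  have p\<Omega>: "p \<in> \<Omega>" using p ridge_subset by auto
  have prod: "cnj (deriv g (cnj (g z))) * deriv g z = 1" if z: "z \<in> ball p r" for z
  proof -
    have "(cnj \<circ> g \<circ> cnj has_field_derivative cnj (deriv g (cnj (g z)))) (at (g z))"
      using deriv_g[OF r(3)[OF z]] has_field_derivative_cnj_cnj by blast
    then have "((\<lambda>z. (cnj \<circ> g \<circ> cnj) (g z)) has_field_derivative cnj (deriv g (cnj (g z))) * deriv g z) (at z)"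
      by (rule DERIV_chain2) (use z r(2) in \<open>blast intro: deriv_g\<close>)
    moreover have "((\<lambda>z. (cnj \<circ> g \<circ> cnj) (g z)) has_field_derivative 1) (at z)"
    proof (rule has_field_derivative_transform_within_open[OF DERIV_ident open_ball z])
      show "w = (cnj \<circ> g \<circ> cnj) (g w)" if "w \<in> ball p r" for w
        using r(4)[OF that] by simp
    qed
    ultimately show ?thesis by (rule DERIV_unique)
  qed
  have pr: "p \<in> ball p r" using r by simp
  have "deriv g p * cnj (deriv g p) = 1"
    using prod[OF pr] gp by (simp add: mult.commute)
  then have "of_real ((cmod (deriv g p))\<^sup>2) = (1::complex)"
    by (simp only: complex_norm_square)
  then have "(cmod (deriv g p))\<^sup>2 = 1" by (simp only: of_real_eq_1_iff)
  then show "cmod (deriv g p) = 1"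
    by (metis norm_ge_zero power2_eq_1_iff zero_le_one abs_of_nonneg not_one_le_zero neg_0_le_iff_le)
  have "(cnj \<circ> deriv g \<circ> cnj has_field_derivative cnj (deriv (deriv g) p)) (at (g p))"
    using deriv_deriv_g[OF p\<Omega>] has_field_derivative_cnj_cnj[of "deriv g" _ "g p"] gp by simp
  then have "((\<lambda>z. (cnj \<circ> deriv g \<circ> cnj) (g z)) has_field_derivative cnj (deriv (deriv g) p) * deriv g p) (at p)"
    by (rule DERIV_chain2[OF _ deriv_g[OF p\<Omega>]])
  from DERIV_mult[OF this deriv_deriv_g[OF p\<Omega>]]
  have "((\<lambda>z. (cnj \<circ> deriv g \<circ> cnj) (g z) * deriv g z) has_field_derivative
      cnj (deriv (deriv g) p) * deriv g p * deriv g p + deriv (deriv g) p * cnj (deriv g p)) (at p)"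
    using gp by simp
  moreover have "((\<lambda>z. (cnj \<circ> deriv g \<circ> cnj) (g z) * deriv g z) has_field_derivative 0) (at p)"
    by (rule has_field_derivative_transform_within_open[OF DERIV_const open_ball pr])
       (use prod in simp)
  ultimately have "cnj (deriv (deriv g) p) * deriv g p * deriv g p + deriv (deriv g) p * cnj (deriv g p) = 0"
    by (rule DERIV_unique)
  then show "cnj (deriv (deriv g) p) * (deriv g p)\<^sup>2 + cnj (deriv g p) * deriv (deriv g) p = 0"
    by (simp add: power2_eq_square algebra_simps)
qed

text \<open>\<open>T\<close> spans the kernel of the Hessian and is determined up to sign;
  \<open>\<i> * T\<close> is a unit normal.\<close>

lemma ridge_tangent:
  assumes "p \<in> ridge"
  obtains T where "cmod T = 1" "T\<^sup>2 = cnj (deriv g p)" "deriv g p = (cnj T)\<^sup>2" "T * cnj T = 1"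
proof -
  define T where "T = csqrt (cnj (deriv g p))"
  have T2: "T\<^sup>2 = cnj (deriv g p)" by (simp add: T_def)
  have "(cmod T)\<^sup>2 = 1" using ridge_derivatives(1)[OF assms] T2 by (metis complex_mod_cnj norm_power)
  then have T1: "cmod T = 1" by (metis norm_ge_zero one_power2 power2_eq_imp_eq zero_le_one)
  have "deriv g p = (cnj T)\<^sup>2" using T2 by (metis complex_cnj_cnj complex_cnj_power)
  moreover have "T * cnj T = 1" using T1 by (metis complex_norm_square of_real_1 one_power2)
  ultimately show ?thesis using that T1 T2 by blast
qed

text \<open>Near the ridge \<open>g\<close> is its Schwarz function and
  \<open>z \<mapsto> cnj (g z)\<close> the reflection in it; \<zeta> is a holomorphic coordinate
  that turns this reflection into complex conjugation and the ridge into the real axis. The last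
  clause allows either sign of the tangent \<open>T\<close>.\<close>

definition chart :: "complex \<Rightarrow> complex set \<Rightarrow> (complex \<Rightarrow> complex) \<Rightarrow> bool" where
  "chart p V \<zeta> \<longleftrightarrow> open V \<and> p \<in> V \<and> V \<subseteq> \<Omega> \<and> \<zeta> holomorphic_on \<Omega> \<and> V \<inter> M \<subseteq> ridge \<and>
     connected {z \<in> V. Im (\<zeta> z) > 0} \<and> connected {z \<in> V. Im (\<zeta> z) < 0} \<and>
     (\<forall>z\<in>V. (z \<in> M \<longleftrightarrow> Im (\<zeta> z) = 0) \<and> \<zeta> (cnj (g z)) = cnj (\<zeta> z) \<and> deriv \<zeta> z \<noteq> 0) \<and>
     (\<forall>T. T\<^sup>2 = cnj (deriv g p) \<longrightarrow>
        (\<exists>\<kappa>\<in>{1, -1}. \<forall>z\<in>\<Omega>. deriv \<zeta> z = of_real \<kappa> * (cnj T + T * deriv g z)))"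

text \<open>Symmetrisation: \<zeta> is the tangential coordinate \<open>cnj T * (z - p)\<close> plus
  the conjugate of its value at the mirror point \<open>cnj (g z)\<close>. Hence reflecting
  \<open>z\<close> conjugates \<zeta>, and the derivative at \<open>p\<close> is
  \<open>2 * cnj T\<close>, which does not vanish.\<close>

lemma ridge_chart:
  assumes p: "p \<in> ridge"
  shows "\<exists>V \<zeta>. chart p V \<zeta>"
proof -
  obtain r where r: "0 < r" "ball p r \<subseteq> \<Omega>" "\<And>z. z \<in> ball p r \<Longrightarrow> cnj (g z) \<in> \<Omega>"
    "\<And>z. z \<in> ball p r \<Longrightarrow> g (cnj (g z)) = cnj z"
    using reflection_involutive[OF p] by blast
  have pM: "p \<in> M" "p \<in> \<Omega>" using p ridge_subset by auto
  have gp: "g p = cnj p" using grad_zero_on_M[OF pM(1)] .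
  obtain T where T: "cmod T = 1" "T\<^sup>2 = cnj (deriv g p)" "deriv g p = (cnj T)\<^sup>2" "T * cnj T = 1"
    using ridge_tangent[OF p] by blast
  define \<zeta> where "\<zeta> z = cnj T * (z - p) + T * (g z - cnj p)" for z
  have hol: "\<zeta> holomorphic_on \<Omega>" unfolding \<zeta>_def by (intro holomorphic_intros holo)
  have der: "deriv \<zeta> z = cnj T + T * deriv g z" if "z \<in> \<Omega>" for z
    unfolding \<zeta>_def by (rule DERIV_imp_deriv) (auto intro!: derivative_eq_intros deriv_g[OF that])
  have sym: "\<zeta> (cnj (g z)) = cnj (\<zeta> z)" if "z \<in> ball p r" for z
    using r(4)[OF that] by (simp add: \<zeta>_def algebra_simps)
  have "T * deriv g p = cnj T"
    using T(3,4) by (simp add: power2_eq_square flip: mult.assoc)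
  then have dp: "deriv \<zeta> p \<noteq> 0" using der[OF pM(2)] T(4) by auto
  obtain r0 where r0: "0 < r0" "ball p r0 \<subseteq> ball p r" "inj_on \<zeta> (ball p r0)"
    using has_complex_derivative_locally_injective[of \<zeta> "ball p r" p] dp r(1)
      holomorphic_on_subset[OF hol r(2)] by (metis centre_in_ball open_ball)
  have "isCont (\<lambda>z. cnj (g z)) p"
    using deriv_g[OF pM(2)] by (intro continuous_intros DERIV_isCont)
  then have "((\<lambda>z. cnj (g z)) \<longlongrightarrow> cnj (g p)) (nhds p)"
    using tendsto_at_iff_tendsto_nhds[of "\<lambda>z. cnj (g z)" p] by (simp add: isCont_def)
  from topological_tendstoD[OF this open_ball[of p r0]]
  have "\<forall>\<^sub>F z in nhds p. cnj (g z) \<in> ball p r0" using r0(1) gp by simp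
  then obtain r1' where r1': "0 < r1'" "\<And>z. dist z p < r1' \<Longrightarrow> cnj (g z) \<in> ball p r0"
    unfolding eventually_nhds_metric by blast
  \<comment> \<open>The smaller ball has its mirror image inside the ball on which \<zeta> is
    injective, so a real value of \<zeta> forces \<open>cnj (g z) = z\<close>.\<close>
  define r1 where "r1 = min r0 r1'"
  have r1: "0 < r1" "ball p r1 \<subseteq> ball p r0" "\<And>z. z \<in> ball p r1 \<Longrightarrow> cnj (g z) \<in> ball p r0"
    using r0 r1' by (auto simp: r1_def dist_commute)
  have inj1: "inj_on \<zeta> (ball p r1)" using r0(3) r1(2) inj_on_subset by blast
  have B1: "ball p r1 \<subseteq> \<Omega>" "ball p r1 \<subseteq> ball p r" using r1 r0 r by blast+
  have hol1: "\<zeta> holomorphic_on ball p r1" using hol B1 holomorphic_on_subset by blast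
  obtain \<psi> where \<psi>: "\<psi> holomorphic_on \<zeta> ` ball p r1" "\<And>z. z \<in> ball p r1 \<Longrightarrow> \<psi> (\<zeta> z) = z"
    using holomorphic_has_inverse[OF hol1 open_ball inj1] by metis
  have "open (\<zeta> ` ball p r1)" using open_mapping_thm3[OF hol1 open_ball inj1] .
  moreover have "0 \<in> \<zeta> ` ball p r1"
    using r1(1) gp by (intro image_eqI[of _ _ p]) (auto simp: \<zeta>_def)
  ultimately obtain \<rho> where \<rho>: "0 < \<rho>" "ball 0 \<rho> \<subseteq> \<zeta> ` ball p r1"
    using open_contains_ball by blast
  \<comment> \<open>As the preimage of a disc, \<open>V\<close> has halves that are images of
    half-discs under the inverse of \<zeta>, hence connected.\<close>
  define V where "V = {z \<in> ball p r1. \<zeta> z \<in> ball 0 \<rho>}"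
  have \<zeta>p: "\<zeta> p = 0" by (simp add: \<zeta>_def gp)
  have V_eq: "V = ball p r1 \<inter> \<zeta> -` ball 0 \<rho>" by (auto simp: V_def)
  have open_V: "open V"
    unfolding V_eq using hol1 by (intro continuous_open_preimage holomorphic_on_imp_continuous_on) auto
  have pV: "p \<in> V" using r1(1) \<rho>(1) by (simp add: V_def \<zeta>p)
  have V\<Omega>: "V \<subseteq> \<Omega>" using B1 by (auto simp: V_def)
  have \<psi>V: "\<psi> w \<in> V" "\<zeta> (\<psi> w) = w" if w: "w \<in> ball 0 \<rho>" for w
  proof -
    obtain z where "z \<in> ball p r1" "w = \<zeta> z" using w \<rho>(2) by blast
    then show "\<psi> w \<in> V" "\<zeta> (\<psi> w) = w" using \<psi>(2) w by (auto simp: V_def)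
  qed
  have cont\<psi>: "continuous_on (ball 0 \<rho>) \<psi>"
    using \<psi>(1) \<rho>(2) holomorphic_on_imp_continuous_on continuous_on_subset by blast
  have half: "{z \<in> V. P (\<zeta> z)} = \<psi> ` (ball 0 \<rho> \<inter> {w. P w})" for P
  proof
    show "{z \<in> V. P (\<zeta> z)} \<subseteq> \<psi> ` (ball 0 \<rho> \<inter> {w. P w})"
    proof
      fix z assume z: "z \<in> {z \<in> V. P (\<zeta> z)}"
      then have "z = \<psi> (\<zeta> z)" "\<zeta> z \<in> ball 0 \<rho> \<inter> {w. P w}" using \<psi>(2) by (simp_all add: V_def)
      then show "z \<in> \<psi> ` (ball 0 \<rho> \<inter> {w. P w})" by (rule image_eqI)
    qed
  qed (use \<psi>V in force)
  have conn: "connected {z \<in> V. Im (\<zeta> z) > 0}" "connected {z \<in> V. Im (\<zeta> z) < 0}"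
    unfolding half[of "\<lambda>w. Im w > 0"] half[of "\<lambda>w. Im w < 0"]
    by (intro connected_continuous_image continuous_on_subset[OF cont\<psi>] convex_connected convex_Int
        convex_ball convex_halfspace_Im_gt convex_halfspace_Im_lt Int_lower1)+
  have crit: "g z = cnj z \<longleftrightarrow> Im (\<zeta> z) = 0" if z: "z \<in> V" for z
  proof -
    have zB: "z \<in> ball p r1" using z by (simp add: V_def)
    have "Im (\<zeta> z) = 0 \<longleftrightarrow> \<zeta> (cnj (g z)) = \<zeta> z"
      using sym B1 zB by (auto simp: complex_eq_iff)
    also have "\<dots> \<longleftrightarrow> cnj (g z) = z"
      using inj_on_eq_iff[OF r0(3) r1(3)[OF zB]] zB r1(2) by blast
    finally show ?thesis by (metis complex_cnj_cnj)
  qed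
  \<comment> \<open>Every point of the arc is critical, so \<open>u\<close> is constant along it,
    with the value \<open>m\<close> taken at \<open>p\<close>. Thus all critical points in
    \<open>V\<close> are maximum points.\<close>
  have level: "u (\<psi> (of_real t)) = m" if t: "\<bar>t\<bar> < \<rho>" for t
  proof -
    have "((\<lambda>s. u (\<psi> (of_real s))) has_real_derivative 0) (at s within {-\<rho><..<\<rho>})" if s: "s \<in> {-\<rho><..<\<rho>}" for s
    proof -
      have sb: "complex_of_real s \<in> ball 0 \<rho>" using s by (auto simp: dist_norm)
      have "(\<psi> has_field_derivative deriv \<psi> (of_real s)) (at (of_real s))"
        using holomorphic_derivI[OF holomorphic_on_subset[OF \<psi>(1) \<rho>(2)] open_ball sb] .
      moreover have "(of_real has_vector_derivative (1::complex)) (at s)"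
        by (auto intro!: derivative_eq_intros)
      ultimately have "((\<lambda>s. \<psi> (of_real s)) has_vector_derivative deriv \<psi> (of_real s)) (at s)"
        using field_vector_diff_chain_at[of of_real 1 s \<psi>] by (simp add: o_def)
      then have 1: "((\<lambda>s. \<psi> (of_real s)) has_derivative (\<lambda>h. h *\<^sub>R deriv \<psi> (of_real s))) (at s)"
        by (simp add: has_vector_derivative_def)
      have "g (\<psi> (of_real s)) = cnj (\<psi> (of_real s))"
        using crit[OF \<psi>V(1)[OF sb]] \<psi>V(2)[OF sb] by simp
      then have "(u has_derivative (\<lambda>h. 0)) (at (\<psi> (of_real s)))"
        using deriv_u[of "\<psi> (of_real s)"] \<psi>V(1)[OF sb] V\<Omega> by auto
      from has_derivative_at_withinI[OF has_derivative_compose[OF 1 this]]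
      have "((\<lambda>s. u (\<psi> (of_real s))) has_derivative (\<lambda>h. 0)) (at s within {-\<rho><..<\<rho>})" .
      moreover have "(*) (0::real) = (\<lambda>h. 0)" by (intro ext) simp
      ultimately show ?thesis unfolding has_field_derivative_def by (simp only:)
    qed
    then obtain c where c: "\<And>s. s \<in> {-\<rho><..<\<rho>} \<Longrightarrow> u (\<psi> (of_real s)) = c"
      using has_field_derivative_zero_constant[OF convex_real_interval(8)] by blast
    have "\<psi> 0 = p" using \<psi>(2)[of p] \<zeta>p r1(1) by simp
    then have "c = m" using c[of 0] \<rho>(1) pM(1) by (simp add: M_def)
    then show ?thesis using c[of t] t by (auto simp: abs_less_iff)
  qed
  have M_iff: "z \<in> M \<longleftrightarrow> Im (\<zeta> z) = 0" if z: "z \<in> V" for z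
  proof
    assume "Im (\<zeta> z) = 0"
    then have eq: "\<zeta> z = of_real (Re (\<zeta> z))" by (simp add: complex_eq_iff)
    have "cmod (\<zeta> z) < \<rho>" using z by (simp add: V_def)
    then have "\<bar>Re (\<zeta> z)\<bar> < \<rho>" using abs_Re_le_cmod order_le_less_trans by blast
    then have "u (\<psi> (\<zeta> z)) = m" using level eq by metis
    then show "z \<in> M" using \<psi>(2)[of z] z V\<Omega> by (auto simp: M_def V_def)
  qed (use crit[OF z] grad_zero_on_M in blast)
  have "V \<inter> M \<subseteq> ridge"
  proof
    fix z assume z: "z \<in> V \<inter> M"
    define x where "x = Re (\<zeta> z)"
    have x: "\<zeta> z = of_real x" using M_iff[of z] z by (auto simp: x_def complex_eq_iff)
    have x\<rho>: "of_real x \<in> ball (0::complex) \<rho>" using z x by (simp add: V_def)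
    have \<psi>x: "\<psi> (of_real x) = z" using \<psi>(2)[of z] z x by (simp add: V_def)
    have "z islimpt M"
    proof (rule islimptI)
      fix S assume S: "z \<in> S" "open S"
      have "open (ball 0 \<rho> \<inter> \<psi> -` S)"
        by (intro continuous_open_preimage[OF cont\<psi>] S open_ball)
      moreover have "of_real x \<in> ball 0 \<rho> \<inter> \<psi> -` S" using x\<rho> \<psi>x S by simp
      ultimately obtain e where e: "0 < e" "ball (of_real x) e \<subseteq> ball 0 \<rho> \<inter> \<psi> -` S"
        using open_contains_ball by blast
      define w where "w = complex_of_real (x + e / 2)"
      have "w \<in> ball (of_real x) e" using e(1) by (simp add: w_def dist_norm)
      then have w: "w \<in> ball 0 \<rho>" "\<psi> w \<in> S" using e(2) by auto
      have "\<psi> w \<in> M" using M_iff[OF \<psi>V(1)[OF w(1)]] \<psi>V(2)[OF w(1)] by (simp add: w_def)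
      moreover have "\<psi> w \<noteq> z" using \<psi>V(2)[OF w(1)] x e(1) by (auto simp: w_def)
      ultimately show "\<exists>y\<in>M. y \<in> S \<and> y \<noteq> z" using w(2) by blast
    qed
    with z show "z \<in> ridge" by (simp add: ridge_def)
  qed
  moreover have "deriv \<zeta> q \<noteq> 0" if "q \<in> V" for q
    using holomorphic_injective_imp_regular[OF hol1 open_ball inj1] that by (simp add: V_def)
  moreover have "\<exists>\<kappa>\<in>{1, -1}. \<forall>z\<in>\<Omega>. deriv \<zeta> z = of_real \<kappa> * (cnj T' + T' * deriv g z)"
    if "T'\<^sup>2 = cnj (deriv g p)" for T'
  proof -
    have "T' = T \<or> T' = - T" using that T(2) by (metis power2_eq_iff)
    then show ?thesis using der by auto
  qed
  moreover have "\<zeta> (cnj (g z)) = cnj (\<zeta> z)" if "z \<in> V" for z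
    using sym that B1 by (auto simp: V_def)
  ultimately have "chart p V \<zeta>"
    unfolding chart_def using open_V pV V\<Omega> hol M_iff conn by blast
  then show ?thesis by blast
qed

text \<open>Let \<open>T'\<close> be a tangent at \<open>q\<close>. Since
  \<open>g' = (cnj T')\<^sup>2\<close> there, \<open>cnj T + T * g'\<close> equals
  \<open>2 * Re (T * cnj T') * cnj T'\<close>, a real multiple of \<open>cnj T'\<close>. Hence
  \<zeta> maps the normals \<open>\<i> * T'\<close> and \<open>- \<i> * T'\<close> to vertical
  directions, and \<nu> is the one along which \<open>Im \<zeta>\<close> increases.\<close>

lemma chart_transverse:
  assumes V: "open V" "V \<subseteq> \<Omega>" and hol: "\<zeta> holomorphic_on \<Omega>" and q: "q \<in> V" "q \<in> ridge"
    and z: "Im (\<zeta> q) = 0" and nz: "deriv \<zeta> q \<noteq> 0"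
    and T: "T * cnj T = 1" and der: "deriv \<zeta> q = of_real \<kappa> * (cnj T + T * deriv g q)"
  obtains \<nu> where "\<nu>\<^sup>2 * deriv g q = -1"
    "\<forall>\<^sub>F s in at_right 0. q + of_real s * \<nu> \<in> V \<and> 0 < Im (\<zeta> (q + of_real s * \<nu>))"
    "\<forall>\<^sub>F s in at_right 0. q - of_real s * \<nu> \<in> V \<and> Im (\<zeta> (q - of_real s * \<nu>)) < 0"
proof -
  obtain T' where T': "cmod T' = 1" "T'\<^sup>2 = cnj (deriv g q)" "deriv g q = (cnj T')\<^sup>2" "T' * cnj T' = 1"
    using ridge_tangent[OF q(2)] by blast
  define \<rho> where "\<rho> = 2 * \<kappa> * Re (T * cnj T')"
  have "of_real \<rho> * cnj T' = of_real \<kappa> * ((T * cnj T' + cnj (T * cnj T')) * cnj T')"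
    unfolding \<rho>_def complex_add_cnj by simp
  also have "(T * cnj T' + cnj (T * cnj T')) * cnj T' = cnj T * (T' * cnj T') + T * (cnj T')\<^sup>2"
    by (simp add: power2_eq_square algebra_simps)
  also have "of_real \<kappa> * \<dots> = deriv \<zeta> q" using der T'(3,4) by simp
  finally have d: "deriv \<zeta> q = of_real \<rho> * cnj T'" by simp
  then have \<rho>: "\<rho> \<noteq> 0" using nz by auto
  define \<nu> where "\<nu> = of_real (sgn \<rho>) * (\<i> * T')"
  have "(of_real (sgn \<rho>) :: complex)\<^sup>2 = 1" using \<rho> by (simp add: sgn_if)
  then have "\<nu>\<^sup>2 = - T'\<^sup>2" by (simp add: \<nu>_def power_mult_distrib)
  then have \<nu>2: "\<nu>\<^sup>2 * deriv g q = -1"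
    using T'(3,4) by (metis mult_minus_left power_mult_distrib power_one)
  have "deriv \<zeta> q * \<nu> = of_real (\<rho> * sgn \<rho>) * \<i> * (T' * cnj T')" by (simp add: d \<nu>_def)
  then have d\<nu>: "deriv \<zeta> q * \<nu> = of_real \<bar>\<rho>\<bar> * \<i>" using T'(4) by (simp add: abs_sgn)
  have "((\<lambda>s. \<zeta> (q + of_real s * \<nu>)) has_vector_derivative deriv \<zeta> q * \<nu>) (at 0)"
    using holomorphic_line[OF hol open_dom, of q 0 \<nu>] q V by auto
  from bounded_linear.has_vector_derivative[OF bounded_linear_Im this]
  have D: "((\<lambda>s. Im (\<zeta> (q + of_real s * \<nu>))) has_real_derivative \<bar>\<rho>\<bar>) (at 0)"
    by (simp add: d\<nu> has_real_derivative_iff_has_vector_derivative)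
  have "\<nu> \<noteq> 0" using \<nu>2 by auto
  have inV: "\<forall>\<^sub>F s in at_right 0. q + of_real s * w \<in> V" for w
  proof -
    have "((\<lambda>s. q + of_real s * w) \<longlongrightarrow> q + of_real 0 * w) (at_right 0)" by (intro tendsto_intros)
    from topological_tendstoD[OF this V(1)] show ?thesis using q(1) by simp
  qed
  have pos: "0 < \<bar>\<rho>\<bar>" using \<rho> by simp
  obtain d1 where d1: "0 < d1" "\<And>s. 0 < s \<Longrightarrow> s < d1 \<Longrightarrow> Im (\<zeta> (q + of_real 0 * \<nu>)) < Im (\<zeta> (q + of_real (0 + s) * \<nu>))"
    using DERIV_pos_inc_right[OF D pos] by blast
  obtain d2 where d2: "0 < d2" "\<And>s. 0 < s \<Longrightarrow> s < d2 \<Longrightarrow> Im (\<zeta> (q + of_real (0 - s) * \<nu>)) < Im (\<zeta> (q + of_real 0 * \<nu>))"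
    using DERIV_pos_inc_left[OF D pos] by blast
  show ?thesis
  proof (rule that[OF \<nu>2])
    show "\<forall>\<^sub>F s in at_right 0. q + of_real s * \<nu> \<in> V \<and> 0 < Im (\<zeta> (q + of_real s * \<nu>))"
      using inV[of \<nu>] eventually_at_right_real[OF d1(1)]
      by eventually_elim (use d1(2) z in auto)
    show "\<forall>\<^sub>F s in at_right 0. q - of_real s * \<nu> \<in> V \<and> Im (\<zeta> (q - of_real s * \<nu>)) < 0"
      using inV[of "- \<nu>"] eventually_at_right_real[OF d2(1)]
      by eventually_elim (use d2(2) z in auto)
  qed
qed

text \<open>A continuous choice of \<open>\<nu>\<close> turns \<open>\<nabla>u \<cdot> \<nu>\<close> into a function that changes sign exactly across the ridge.\<close>

lemma chart_sign:
  assumes V: "open V" "V \<subseteq> \<Omega>" and hol: "\<zeta> holomorphic_on \<Omega>" and p: "p \<in> V" "p \<in> ridge"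
    and sym: "\<And>z. z \<in> V \<Longrightarrow> \<zeta> (cnj (g z)) = cnj (\<zeta> z)"
    and T: "T\<^sup>2 = cnj (deriv g p)" and \<kappa>: "\<kappa> \<in> {1, -1 :: real}"
    and der: "deriv \<zeta> p = of_real \<kappa> * (cnj T + T * deriv g p)"
    and n: "isCont n p" "(n p)\<^sup>2 * deriv g p = -1"
  obtains \<kappa>' where "\<kappa>' \<in> {1, -1 :: real}"
    "\<forall>\<^sub>F z in nhds p. (0 < Im (\<zeta> z) \<longrightarrow> 0 < \<kappa>' * Re ((cnj z - g z) * n z)) \<and>
       (Im (\<zeta> z) < 0 \<longrightarrow> \<kappa>' * Re ((cnj z - g z) * n z) < 0)"
proof -
  have p\<Omega>: "p \<in> \<Omega>" "p \<in> M" using p ridge_subset by auto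
  have T1: "cmod T = 1"
    by (metis T complex_mod_cnj norm_ge_zero norm_power one_power2 power2_eq_imp_eq ridge_derivatives(1)[OF p(2)] zero_le_one)
  then have TT: "T * cnj T = 1" by (metis complex_norm_square of_real_1 one_power2)
  have gp: "deriv g p = (cnj T)\<^sup>2" using T by (metis complex_cnj_cnj complex_cnj_power)
  have "T * deriv g p = cnj T" using TT by (simp add: gp power2_eq_square flip: mult.assoc)
  then have d: "deriv \<zeta> p = 2 * of_real \<kappa> * cnj T" by (simp add: der)
  have "(n p)\<^sup>2 = (\<i> * T)\<^sup>2"
  proof -
    have "(n p)\<^sup>2 = (n p)\<^sup>2 * (T * cnj T)\<^sup>2" by (simp add: TT)
    also have "\<dots> = ((n p)\<^sup>2 * deriv g p) * T\<^sup>2" by (simp add: gp power_mult_distrib mult_ac)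
    finally show ?thesis using n(2) by (simp add: power_mult_distrib)
  qed
  then obtain \<kappa>1 :: real where \<kappa>1: "\<kappa>1 \<in> {1, -1}" "n p = of_real \<kappa>1 * (\<i> * T)"
    by (metis insertCI mult_1 mult_minus_left of_real_1 of_real_minus power2_eq_iff)
  define \<kappa>' where "\<kappa>' = \<kappa> * \<kappa>1"
  have \<kappa>': "\<kappa>' \<in> {1, -1}" using \<kappa> \<kappa>1(1) by (auto simp: \<kappa>'_def)
  have dhol: "deriv \<zeta> holomorphic_on \<Omega>" using hol open_dom by (rule holomorphic_deriv)
  then have "isCont (deriv \<zeta>) p"
    using holomorphic_on_imp_continuous_on continuous_on_eq_continuous_at open_dom p\<Omega> by blast
  then have "\<forall>\<^sub>F z in nhds p. dist (deriv \<zeta> z) (deriv \<zeta> p) < 1 / 4"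
    using tendsto_at_iff_tendsto_nhds[of "deriv \<zeta>" p] by (intro tendstoD) (auto simp: isCont_def)
  moreover have "\<forall>\<^sub>F z in nhds p. z \<in> V" using V(1) p(1) by (rule eventually_nhds_in_open)
  ultimately have "\<forall>\<^sub>F z in nhds p. dist (deriv \<zeta> z) (deriv \<zeta> p) < 1 / 4 \<and> z \<in> V" by (rule eventually_conj)
  then obtain r where r: "0 < r" "\<And>z. dist z p < r \<Longrightarrow> dist (deriv \<zeta> z) (deriv \<zeta> p) < 1 / 4 \<and> z \<in> V"
    unfolding eventually_nhds_metric by blast
  have "isCont (\<lambda>z. cnj (g z)) p"
    using deriv_g[OF p\<Omega>(1)] by (intro continuous_intros DERIV_isCont)
  then have lim: "((\<lambda>z. cnj (g z)) \<longlongrightarrow> p) (nhds p)"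
    using tendsto_at_iff_tendsto_nhds[of "\<lambda>z. cnj (g z)" p] grad_zero_on_M[OF p\<Omega>(2)] by (simp add: isCont_def)
  have "\<forall>\<^sub>F z in nhds p. cnj (g z) \<in> ball p r"
    using topological_tendstoD[OF lim open_ball[of p r]] r(1) by simp
  moreover have "\<forall>\<^sub>F z in nhds p. z \<in> ball p r"
    using r(1) by (intro eventually_nhds_in_open) auto
  moreover have "\<forall>\<^sub>F z in nhds p. dist (n z) (n p) < 1 / 4"
    using n(1) tendsto_at_iff_tendsto_nhds[of n p] by (intro tendstoD) (auto simp: isCont_def)
  ultimately have "\<forall>\<^sub>F z in nhds p. (0 < Im (\<zeta> z) \<longrightarrow> 0 < \<kappa>' * Re ((cnj z - g z) * n z)) \<and>
       (Im (\<zeta> z) < 0 \<longrightarrow> \<kappa>' * Re ((cnj z - g z) * n z) < 0)"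
  proof eventually_elim
    case (elim z)
    define D where "D = z - cnj (g z)"
    define I where "I = Im (\<zeta> z)"
    \<comment> \<open>The Taylor error of \<zeta> between \<open>z\<close> and its mirror image,
      which are \<open>D\<close> apart and whose \<zeta>-values differ by
      \<open>2 * \<i> * I\<close>.\<close>
    define E where "E = 2 * \<i> * of_real I - 2 * of_real \<kappa> * cnj T * D"
    have zV: "z \<in> V" using elim(2) r(2) by (simp add: dist_commute)
    have "cmod ((\<zeta> z - deriv \<zeta> p * z) - (\<zeta> (cnj (g z)) - deriv \<zeta> p * cnj (g z))) \<le> 1 / 4 * cmod (z - cnj (g z))"
    proof (rule field_differentiable_bound[of "ball p r" "\<lambda>z. \<zeta> z - deriv \<zeta> p * z" "\<lambda>z. deriv \<zeta> z - deriv \<zeta> p"])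
      fix w assume "w \<in> ball p r"
      then have w: "dist (deriv \<zeta> w) (deriv \<zeta> p) < 1 / 4" "w \<in> \<Omega>"
        using r(2)[of w] V(2) by (auto simp: dist_commute[of w p])
      show "((\<lambda>z. \<zeta> z - deriv \<zeta> p * z) has_field_derivative deriv \<zeta> w - deriv \<zeta> p) (at w within ball p r)"
        by (rule has_field_derivative_at_within, rule DERIV_diff)
           (rule holomorphic_derivI[OF hol open_dom w(2)] DERIV_cmult_Id)+
      show "cmod (deriv \<zeta> w - deriv \<zeta> p) \<le> 1 / 4" using w(1) by (simp add: dist_norm)
    qed (use elim in auto)
    also have "(\<zeta> z - deriv \<zeta> p * z) - (\<zeta> (cnj (g z)) - deriv \<zeta> p * cnj (g z)) = (\<zeta> z - cnj (\<zeta> z)) - deriv \<zeta> p * D"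
      using sym[OF zV] by (simp add: D_def algebra_simps)
    also have "\<dots> = E" by (simp add: complex_diff_cnj E_def I_def d)
    finally have E: "cmod E \<le> cmod D / 4" by (simp add: D_def)
    have \<kappa>\<kappa>: "of_real \<kappa> * of_real \<kappa> = (1 :: complex)" using \<kappa> by auto
    have "of_real \<kappa> * cnj E = - 2 * \<i> * of_real \<kappa> * of_real I - 2 * (of_real \<kappa> * of_real \<kappa>) * (T * cnj D)"
      by (simp add: E_def algebra_simps)
    then have TD: "T * cnj D = - \<i> * of_real \<kappa> * of_real I - of_real \<kappa> * cnj E / 2"
      by (simp add: \<kappa>\<kappa> diff_divide_distrib)
    have nE: "cmod (of_real \<kappa> * cnj E / 2) \<le> cmod D / 8"
      using E \<kappa> by (auto simp: norm_mult norm_divide)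
    have "cmod D = cmod (T * cnj D)" using T1 by (simp add: norm_mult)
    also have "\<dots> \<le> cmod (- \<i> * of_real \<kappa> * of_real I) + cmod (of_real \<kappa> * cnj E / 2)"
      unfolding TD by (rule norm_triangle_ineq4)
    also have "cmod (- \<i> * of_real \<kappa> * of_real I) = \<bar>I\<bar>" using \<kappa> by (auto simp: norm_mult)
    finally have DI: "7 / 8 * cmod D \<le> \<bar>I\<bar>" using nE by simp
    have "(cnj z - g z) * n z = cnj D * n p + cnj D * (n z - n p)" by (simp add: D_def algebra_simps)
    also have "cnj D * n p = of_real \<kappa>1 * \<i> * (T * cnj D)" by (simp add: \<kappa>1(2))
    also have "\<dots> = of_real (\<kappa>' * I) - of_real \<kappa>1 * \<i> * (of_real \<kappa> * cnj E / 2)"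
      by (simp add: TD \<kappa>'_def algebra_simps)
    finally have eq: "Re ((cnj z - g z) * n z) = \<kappa>' * I
        + (Re (cnj D * (n z - n p)) - Re (of_real \<kappa>1 * \<i> * (of_real \<kappa> * cnj E / 2)))" by simp
    have "cmod (cnj D * (n z - n p)) \<le> cmod D * (1 / 4)"
      unfolding norm_mult complex_mod_cnj using elim(3) by (intro mult_left_mono) (auto simp: dist_norm)
    from order_trans[OF abs_Re_le_cmod this]
    have e1: "\<bar>Re (cnj D * (n z - n p))\<bar> \<le> cmod D / 4" by simp
    have "cmod (of_real \<kappa>1 * \<i> * (of_real \<kappa> * cnj E / 2)) \<le> cmod D / 8"
      using nE \<kappa>1(1) by (auto simp: norm_mult)
    from order_trans[OF abs_Re_le_cmod this]
    have e2: "\<bar>Re (of_real \<kappa>1 * \<i> * (of_real \<kappa> * cnj E / 2))\<bar> \<le> cmod D / 8" .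
    \<comment> \<open>The two tolerances \<open>1 / 4\<close> make the error at most
      \<open>3 / 8 * cmod D\<close>, while \<open>cmod D\<close> is at most
      \<open>8 / 7 * \<bar>I\<bar>\<close>; so the error cannot outweigh the main term
      \<open>\<kappa>' * I\<close>.\<close>
    define err where "err = Re (cnj D * (n z - n p)) - Re (of_real \<kappa>1 * \<i> * (of_real \<kappa> * cnj E / 2))"
    have "\<bar>err\<bar> \<le> 3 / 8 * cmod D" using e1 e2 unfolding err_def by linarith
    with DI have err: "\<bar>err\<bar> \<le> 3 / 7 * \<bar>I\<bar>" by simp
    have "Re ((cnj z - g z) * n z) = \<kappa>' * I + err" using eq by (simp only: err_def)
    then have "\<kappa>' * Re ((cnj z - g z) * n z) = I + \<kappa>' * err" using \<kappa>' by (auto simp: algebra_simps)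
    moreover have "\<bar>\<kappa>' * err\<bar> \<le> 3 / 7 * \<bar>I\<bar>" using err \<kappa>' by auto
    ultimately show ?case unfolding I_def[symmetric] by (auto simp: abs_if split: if_splits)
  qed
  with \<kappa>' show ?thesis by (rule that)
qed


text \<open>By Borsuk's criterion a continuous map from a compact plane set with connected
  complement to the circle has a continuous argument. Halving the argument of \<open>g'\<close>
  yields a continuous square root, hence a continuous normal, which Tietze's theorem extends to the
  plane.\<close>

lemma continuous_ridge_normal:
  assumes conn: "connected (- ridge)"
  obtains n where "continuous_on UNIV n" "\<And>p. p \<in> ridge \<Longrightarrow> (n p)\<^sup>2 * deriv g p = -1"
proof -
  have contg: "continuous_on ridge (deriv g)"
    using holomorphic_deriv[OF holo open_dom] ridge_subset(1)
    by (meson continuous_on_subset holomorphic_on_imp_continuous_on)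
  have "deriv g \<in> ridge \<rightarrow> sphere 0 1" using ridge_derivatives(1) by auto
  then have "\<exists>c. homotopic_with_canon (\<lambda>x. True) ridge (sphere 0 1) (deriv g) (\<lambda>x. c)"
    using iffD1[OF Borsuk_separation_theorem[OF compact_ridge] conn] contg by simp
  then obtain \<theta> where \<theta>: "continuous_on ridge \<theta>" "\<And>p. p \<in> ridge \<Longrightarrow> deriv g p = exp (\<i> * of_real (\<theta> p))"
    unfolding inessential_eq_continuous_logarithm_circle by blast
  obtain \<theta>' :: "complex \<Rightarrow> real" where \<theta>': "continuous_on UNIV \<theta>'" "\<And>p. p \<in> ridge \<Longrightarrow> \<theta>' p = \<theta> p"
    using Tietze_unbounded[OF \<theta>(1), of UNIV] compact_imp_closed[OF compact_ridge] by auto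
  define n where "n z = \<i> * exp (- \<i> * of_real (\<theta>' z) / 2)" for z
  have "continuous_on UNIV n" unfolding n_def by (intro continuous_intros \<theta>'(1)) auto
  moreover have "(n p)\<^sup>2 * deriv g p = -1" if "p \<in> ridge" for p
  proof -
    have "(n p)\<^sup>2 = - exp (- \<i> * of_real (\<theta> p))"
      by (simp add: n_def power_mult_distrib \<theta>'(2)[OF that] flip: exp_double)
    then show ?thesis by (simp add: \<theta>(2)[OF that] exp_minus)
  qed
  ultimately show ?thesis by (rule that)
qed

text \<open>
  If the complement of the ridge were connected, the ridge would have a continuous normal field and
  thus a continuous defining function \<open>s\<close>. The map \<open>Q\<close> below winds once around the circle as the ridge
  is crossed and equals \<open>1\<close> away from it. Since the plane is contractible \<open>Q\<close> has a continuous logarithm,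
  which differs by a constant from the principal one off the ridge although the latter jumps there.
\<close>

theorem ridge_separates:
  assumes ne: "ridge \<noteq> {}"
  shows "\<not> connected (- ridge)"
proof
  assume conn: "connected (- ridge)"
  obtain n where n: "continuous_on UNIV n" "\<And>p. p \<in> ridge \<Longrightarrow> (n p)\<^sup>2 * deriv g p = -1"
    using continuous_ridge_normal[OF conn] by blast
  define s where "s z = Re ((cnj z - g z) * n z)" for z
  have local: "\<exists>S \<nu> \<kappa>. open S \<and> p \<in> S \<and> S \<subseteq> \<Omega> \<and> (\<forall>z\<in>S - ridge. s z \<noteq> 0) \<and> \<kappa> \<in> {1, -1 :: real} \<and>
      (\<forall>\<^sub>F t in at_right 0. 0 < \<kappa> * s (p + of_real t * \<nu>)) \<and>
      (\<forall>\<^sub>F t in at_right 0. \<kappa> * s (p - of_real t * \<nu>) < 0)" if p: "p \<in> ridge" for p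
  proof -
    obtain V \<zeta> where ch: "chart p V \<zeta>" using ridge_chart[OF p] by blast
    have V: "open V" "p \<in> V" "V \<subseteq> \<Omega>" and hol: "\<zeta> holomorphic_on \<Omega>" and VM: "V \<inter> M \<subseteq> ridge"
      using ch unfolding chart_def by simp_all
    have M_iff: "z \<in> M \<longleftrightarrow> Im (\<zeta> z) = 0" and sym: "\<zeta> (cnj (g z)) = cnj (\<zeta> z)"
      and nz: "deriv \<zeta> z \<noteq> 0" if "z \<in> V" for z
      using ch that unfolding chart_def by simp_all
    have der: "\<exists>\<kappa>\<in>{1, -1}. \<forall>z\<in>\<Omega>. deriv \<zeta> z = of_real \<kappa> * (cnj T + T * deriv g z)"
      if "T\<^sup>2 = cnj (deriv g p)" for T
      using ch that unfolding chart_def by simp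
    obtain T where T: "cmod T = 1" "T\<^sup>2 = cnj (deriv g p)" "T * cnj T = 1"
      using ridge_tangent[OF p] by blast
    obtain \<kappa> :: real where \<kappa>: "\<kappa> \<in> {1, -1}" "\<And>z. z \<in> \<Omega> \<Longrightarrow> deriv \<zeta> z = of_real \<kappa> * (cnj T + T * deriv g z)"
      using der[OF T(2)] by blast
    have p\<Omega>: "p \<in> \<Omega>" "p \<in> M" using p ridge_subset by auto
    have np: "isCont n p" using n(1) continuous_on_eq_continuous_at open_UNIV by blast
    obtain \<kappa>' :: real where \<kappa>': "\<kappa>' \<in> {1, -1}"
      and sign: "\<forall>\<^sub>F z in nhds p. (0 < Im (\<zeta> z) \<longrightarrow> 0 < \<kappa>' * s z) \<and> (Im (\<zeta> z) < 0 \<longrightarrow> \<kappa>' * s z < 0)"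
      unfolding s_def using chart_sign[OF V(1,3) hol V(2) p sym T(2) \<kappa>(1) \<kappa>(2)[OF p\<Omega>(1)] np n(2)[OF p]] by blast
    obtain S where S: "open S" "p \<in> S"
      "\<And>z. z \<in> S \<Longrightarrow> (0 < Im (\<zeta> z) \<longrightarrow> 0 < \<kappa>' * s z) \<and> (Im (\<zeta> z) < 0 \<longrightarrow> \<kappa>' * s z < 0)"
      using sign unfolding eventually_nhds by blast
    obtain \<nu> where \<nu>: "\<forall>\<^sub>F t in at_right 0. p + of_real t * \<nu> \<in> V \<and> 0 < Im (\<zeta> (p + of_real t * \<nu>))"
      "\<forall>\<^sub>F t in at_right 0. p - of_real t * \<nu> \<in> V \<and> Im (\<zeta> (p - of_real t * \<nu>)) < 0"
      using chart_transverse[OF V(1,3) hol V(2) p _ nz[OF V(2)] T(3) \<kappa>(2)[OF p\<Omega>(1)]]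
        M_iff[OF V(2)] p\<Omega>(2) by blast
    have inS: "\<forall>\<^sub>F t in at_right 0. p + of_real t * w \<in> S" for w
    proof -
      have "((\<lambda>t. p + of_real t * w) \<longlongrightarrow> p + of_real 0 * w) (at_right 0)" by (intro tendsto_intros)
      from topological_tendstoD[OF this S(1)] show ?thesis using S(2) by simp
    qed
    have "\<forall>\<^sub>F t in at_right 0. 0 < \<kappa>' * s (p + of_real t * \<nu>)"
      using \<nu>(1) inS[of \<nu>] by eventually_elim (use S(3) in blast)
    moreover have "\<forall>\<^sub>F t in at_right 0. \<kappa>' * s (p - of_real t * \<nu>) < 0"
      using \<nu>(2) inS[of "- \<nu>"] by eventually_elim (use S(3) in auto)
    moreover have "s z \<noteq> 0" if z: "z \<in> V \<inter> S - ridge" for z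
    proof -
      have "Im (\<zeta> z) \<noteq> 0" using z M_iff VM by blast
      then show ?thesis using S(3)[of z] z by (cases "0 < Im (\<zeta> z)") auto
    qed
    ultimately show ?thesis using V S \<kappa>'
      by (intro exI[of _ "V \<inter> S"] exI[of _ \<nu>] exI[of _ \<kappa>']) auto
  qed
  define O1 where "O1 = \<Union>{S. open S \<and> S \<subseteq> \<Omega> \<and> (\<forall>z\<in>S - ridge. s z \<noteq> 0)}"
  have "open O1" by (auto simp: O1_def)
  have O1: "O1 \<subseteq> \<Omega>" "\<And>z. z \<in> O1 - ridge \<Longrightarrow> s z \<noteq> 0" by (auto simp: O1_def)
  have "ridge \<subseteq> O1" unfolding O1_def using local by blast
  then obtain r where r: "0 < r" "(\<Union>x\<in>ridge. cball x r) \<subseteq> O1"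
    using compact_subset_open_imp_cball_epsilon_subset[OF compact_ridge \<open>open O1\<close>] by metis
  \<comment> \<open>A closed collar of the ridge inside \<open>O1\<close>, where \<open>s\<close>
    vanishes only on the ridge. It overlaps \<open>B\<close> in a compact set disjoint from the
    ridge, so \<open>s\<close> is bounded away from \<open>0\<close> there.\<close>
  define A where "A = {z. infdist z ridge \<le> r}"
  define B where "B = {z. r / 2 \<le> infdist z ridge}"
  have AO: "A \<subseteq> O1"
  proof
    fix z assume "z \<in> A"
    moreover obtain x where "x \<in> ridge" "infdist z ridge = dist z x"
      using infdist_attains_inf[OF compact_imp_closed[OF compact_ridge] ne] by blast
    ultimately have "z \<in> cball x r" by (simp add: A_def dist_commute)
    with r(2) \<open>x \<in> ridge\<close> show "z \<in> O1" by blast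
  qed
  have "closed A" "closed B"
    unfolding A_def B_def by (intro closed_Collect_le continuous_intros)+
  have AB: "A \<union> B = UNIV" using r(1) by (auto simp: A_def B_def)
  have ridge_A: "ridge \<subseteq> A" "ridge \<inter> B = {}" using r(1) by (auto simp: A_def B_def)
  have cont_s: "continuous_on A s"
  proof -
    have A\<Omega>: "A \<subseteq> \<Omega>" using AO O1(1) by blast
    have "continuous_on A g" "continuous_on A n"
      using n(1) A\<Omega> holo by (auto intro: continuous_on_subset holomorphic_on_imp_continuous_on)
    then show ?thesis unfolding s_def by (intro continuous_intros)
  qed
  have "bounded A" using AO O1(1) bounded_dom bounded_subset by blast
  then have "compact (A \<inter> B)"
    using \<open>closed A\<close> \<open>closed B\<close> by (metis bounded_Int closed_Int compact_eq_bounded_closed)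
  obtain \<epsilon> where \<epsilon>: "0 < \<epsilon>" "\<And>z. z \<in> A \<inter> B \<Longrightarrow> \<epsilon> \<le> \<bar>s z\<bar>"
  proof (cases "A \<inter> B = {}")
    case True then show ?thesis using that[of 1] by simp
  next
    case False
    have "continuous_on (A \<inter> B) (\<lambda>z. \<bar>s z\<bar>)"
      by (intro continuous_intros continuous_on_subset[OF cont_s]) auto
    then obtain x where x: "x \<in> A \<inter> B" "\<And>z. z \<in> A \<inter> B \<Longrightarrow> \<bar>s x\<bar> \<le> \<bar>s z\<bar>"
      using continuous_attains_inf[OF \<open>compact (A \<inter> B)\<close> False] by blast
    have "x \<in> O1 - ridge" using x(1) AO ridge_A by blast
    then show ?thesis using x O1(2)[of x] by (intro that[of "\<bar>s x\<bar>"]) auto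
  qed
  \<comment> \<open>Truncating at \<epsilon> makes \<open>c\<close> equal to \<open>1\<close> or
    \<open>-1\<close> on the overlap; there \<open>- exp (\<i> * of_real (pi * c z)) = 1\<close>, so
    the two pieces of \<open>Q\<close> fit together.\<close>
  define c where "c z = max (-1) (min 1 (s z / \<epsilon>))" for z
  have c_bounds: "-1 \<le> c z" "c z \<le> 1" for z by (auto simp: c_def)
  have c_AB: "c z = 1 \<or> c z = -1" if "z \<in> A \<inter> B" for z
    using \<epsilon>(2)[OF that] \<epsilon>(1) by (auto simp: c_def field_simps abs_if max_def min_def split: if_splits)
  have c_zero: "c z = 0 \<longleftrightarrow> s z = 0" for z
    using \<epsilon>(1) by (auto simp: c_def max_def min_def divide_simps split: if_splits)
  define Q where "Q z = (if z \<in> B then 1 else - exp (\<i> * of_real (pi * c z)))" for z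
  have Q_A: "Q z = - exp (\<i> * of_real (pi * c z))" if "z \<in> A" for z
    using c_AB[of z] that by (auto simp: Q_def exp_minus)
  have "continuous_on A (\<lambda>z. - exp (\<i> * of_real (pi * c z)))"
    unfolding c_def using \<epsilon>(1) by (intro continuous_intros cont_s) auto
  then have QA: "continuous_on A Q" by (rule continuous_on_eq) (simp add: Q_A)
  have "continuous_on B Q"
    by (rule continuous_on_eq[OF continuous_on_const[of _ 1]]) (simp add: Q_def)
  from continuous_on_closed_Un[OF \<open>closed A\<close> \<open>closed B\<close> QA this]
  have contQ: "continuous_on UNIV Q" unfolding AB .
  have "Q z \<noteq> 0" for z by (simp add: Q_def)
  then obtain h where h: "continuous_on UNIV h" "\<And>z. Q z = exp (h z)"
    using continuous_logarithm_on_contractible[OF contQ contractible_UNIV] by auto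
  \<comment> \<open>As \<open>t\<close> tends to \<open>0\<close> the principal argument tends to
    \<open>- pi\<close> from the right and to \<open>pi\<close> from the left; this is the jump that
    contradicts continuity of \<open>h\<close> at a ridge point.\<close>
  have Ln_pos: "Ln (- exp (\<i> * of_real (pi * t))) = \<i> * of_real (pi * (t - sgn t))" if "t \<noteq> 0" "-1 \<le> t" "t \<le> 1" for t
  proof -
    have "- exp (\<i> * of_real (pi * t)) = exp (\<i> * of_real (pi * (t - sgn t)))"
      using that by (auto simp: sgn_if algebra_simps exp_diff exp_add exp_minus)
    moreover have "- pi < pi * (t - sgn t)" "pi * (t - sgn t) \<le> pi"
      using that mult_strict_left_mono[of "-1" "t - sgn t" pi] by (auto simp: sgn_if)
    ultimately show ?thesis by simp
  qed
  have Q_slit: "Q z \<notin> \<real>\<^sub>\<le>\<^sub>0" if "z \<in> - ridge" for z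
  proof (cases "z \<in> A")
    case True
    then have c0: "c z \<noteq> 0" using O1(2)[of z] AO that c_zero by blast
    define y where "y = pi * (c z - sgn (c z))"
    have eq: "Q z = exp (\<i> * of_real y)"
      using c0 Q_A[OF True] by (auto simp: y_def sgn_if algebra_simps exp_diff exp_add exp_minus)
    have "\<bar>c z - sgn (c z)\<bar> < 1" using c0 c_bounds[of z] by (auto simp: sgn_if)
    then have "\<bar>y\<bar> < pi" by (simp add: y_def abs_mult)
    then have "Im (Ln (Q z)) \<noteq> pi" unfolding eq using Ln_exp[of "\<i> * of_real y"] by simp
    then show ?thesis using \<open>Q z \<noteq> 0\<close> 
      by (metis Im_Ln_eq_pi nonpos_Reals_cases complex_nonpos_Reals_iff order_le_less complex_eq_iff zero_complex.sel)
  next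
    case False
    then show ?thesis using AB by (auto simp: Q_def)
  qed
  define k where "k z = h z - Ln (Q z)" for z
  have "continuous_on (- ridge) k"
    unfolding k_def
    by (intro continuous_intros Q_slit) (auto intro: continuous_on_subset h contQ)
  moreover have "\<exists>e>0. \<forall>y. y \<in> - ridge \<and> k y \<noteq> k x \<longrightarrow> e \<le> norm (k y - k x)" if "x \<in> - ridge" for x
  proof (intro exI[of _ "2 * pi"] conjI allI impI)
    fix y assume y: "y \<in> - ridge \<and> k y \<noteq> k x"
    have "exp (k z) = 1" for z
      using h(2)[of z] \<open>\<And>z. Q z \<noteq> 0\<close>[of z] by (simp add: k_def exp_diff)
    then obtain j :: int where j: "k y = k x + (of_int (2 * j) * pi) * \<i>" using exp_eq by metis
    then have "j \<noteq> 0" using y by auto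
    then have "1 \<le> \<bar>real_of_int j\<bar>" by linarith
    then show "2 * pi \<le> norm (k y - k x)" by (simp add: j norm_mult)
  qed simp
  ultimately have "k constant_on - ridge" by (rule continuous_discrete_range_constant[OF conn])
  then obtain k0 where k0: "\<And>z. z \<in> - ridge \<Longrightarrow> h z = k0 + Ln (Q z)"
    unfolding constant_on_def k_def by (metis diff_add_cancel)
  obtain p where p: "p \<in> ridge" using ne by blast
  obtain \<nu> \<kappa> where \<kappa>: "\<kappa> \<in> {1, -1 :: real}"
    "\<forall>\<^sub>F t in at_right 0. 0 < \<kappa> * s (p + of_real t * \<nu>)"
    "\<forall>\<^sub>F t in at_right 0. \<kappa> * s (p - of_real t * \<nu>) < 0"
    using local[OF p] by blast
  have s_ridge: "s z = 0" if "z \<in> ridge" for z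
    using grad_zero_on_M[of z] that ridge_subset by (auto simp: s_def)
  have "p \<in> interior A"
  proof -
    have "ball p r \<subseteq> A" using infdist_le2[OF p] by (fastforce simp: A_def dist_commute)
    then show ?thesis using r(1) by (meson centre_in_ball interior_maximal open_ball subsetD)
  qed
  have side: "h p = k0 - \<i> * of_real (pi * \<sigma>)"
    if \<sigma>: "\<sigma> \<in> {1, -1}" "\<forall>\<^sub>F t in at_right 0. 0 < \<sigma> * s (p + of_real t * w)" for \<sigma> :: real and w
  proof -
    have lim: "((\<lambda>t. p + of_real t * w) \<longlongrightarrow> p) (at_right 0)"
    proof -
      have "((\<lambda>t. p + of_real t * w) \<longlongrightarrow> p + of_real 0 * w) (at_right 0)" by (intro tendsto_intros)
      then show ?thesis by simp
    qed
    have inA: "\<forall>\<^sub>F t in at_right 0. p + of_real t * w \<in> A"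
      using topological_tendstoD[OF lim open_interior \<open>p \<in> interior A\<close>]
      by eventually_elim (use interior_subset in blast)
    have "isCont h p" using h(1) continuous_on_eq_continuous_at open_UNIV by blast
    then have h_lim: "((\<lambda>t. h (p + of_real t * w)) \<longlongrightarrow> h p) (at_right 0)"
      using lim by (rule isCont_tendsto_compose)
    have "isCont c p"
    proof -
      have "continuous_on A c" unfolding c_def using \<epsilon>(1) by (intro continuous_intros cont_s) auto
      then show ?thesis using \<open>p \<in> interior A\<close> continuous_on_interior by blast
    qed
    then have "((\<lambda>t. c (p + of_real t * w)) \<longlongrightarrow> c p) (at_right 0)"
      using lim by (rule isCont_tendsto_compose)
    moreover have "c p = 0" using s_ridge[OF p] c_zero by simp
    ultimately have "((\<lambda>t. k0 + \<i> * of_real (pi * (c (p + of_real t * w) - \<sigma>))) \<longlongrightarrow> k0 + \<i> * of_real (pi * (0 - \<sigma>))) (at_right 0)"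
      by (intro tendsto_intros) simp
    moreover have "\<forall>\<^sub>F t in at_right 0. k0 + \<i> * of_real (pi * (c (p + of_real t * w) - \<sigma>)) = h (p + of_real t * w)"
      using \<sigma>(2) inA
    proof eventually_elim
      case (elim t)
      let ?z = "p + of_real t * w"
      have "?z \<in> - ridge" using elim(1) s_ridge by force
      moreover have "c ?z \<noteq> 0" using elim(1) c_zero by auto
      moreover have "sgn (c ?z) = \<sigma>"
        using elim(1) \<sigma>(1) \<epsilon>(1) by (auto simp: c_def sgn_if max_def min_def divide_simps split: if_splits)
      ultimately show ?case using k0[of ?z] Q_A[OF elim(2)] Ln_pos[of "c ?z"] c_bounds by simp
    qed
    ultimately have "((\<lambda>t. h (p + of_real t * w)) \<longlongrightarrow> k0 + \<i> * of_real (pi * (0 - \<sigma>))) (at_right 0)"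
      by (rule Lim_transform_eventually)
    from tendsto_unique[OF _ h_lim this] show ?thesis by simp
  qed
  have "h p = k0 - \<i> * of_real (pi * \<kappa>)" using side[OF \<kappa>(1,2)] .
  moreover have "h p = k0 - \<i> * of_real (pi * - \<kappa>)"
    using side[of "- \<kappa>" "- \<nu>"] \<kappa>(1,3) by auto
  ultimately have "complex_of_real (pi * \<kappa>) = of_real (pi * - \<kappa>)" by simp
  then have "pi * \<kappa> = pi * - \<kappa>" by (simp only: of_real_eq_iff)
  then show False using \<kappa>(1) by auto
qed

end


section \<open>Curvature of the ridge and rigidity\<close>

text \<open>The last assumption distinguishes the outer component from the inner one, in a form that
  applies directly to the unbounded component of the complement of the ridge.\<close>

locale ring_torsion = torsion +
  fixes \<Gamma>i \<Gamma>o :: "complex set"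
  assumes frontier_eq: "frontier \<Omega> = \<Gamma>i \<union> \<Gamma>o"
    and connected_inner: "connected \<Gamma>i" and connected_outer: "connected \<Gamma>o"
    and inner_nonempty: "\<Gamma>i \<noteq> {}" and outer_nonempty: "\<Gamma>o \<noteq> {}"
    and outer_encloses: "connected D \<Longrightarrow> \<not> bounded D \<Longrightarrow> D \<inter> \<Gamma>o = {} \<Longrightarrow> D \<inter> \<Omega> = {}"
begin

lemma boundary_off_ridge: "\<Gamma>i \<subseteq> - ridge" "\<Gamma>o \<subseteq> - ridge"
  using frontier_eq ridge_subset(1) open_dom by (auto simp: frontier_def interior_open)

lemma ridge_component:
  assumes D: "D \<in> components (- ridge)" and ne: "ridge \<noteq> {}"
  shows "open D" "closure D \<subseteq> D \<union> ridge" "D \<inter> \<Omega> \<noteq> {}"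
proof -
  have closed: "closed ridge" using compact_ridge compact_imp_closed by blast
  show op: "open D" using open_components[OF _ D] closed by (simp add: open_Compl)
  have fr: "frontier D \<subseteq> ridge" by (rule frontier_of_components_closed_complement[OF closed D])
  then show "closure D \<subseteq> D \<union> ridge" using closure_Un_frontier by blast
  have "D \<noteq> {}" "D \<noteq> UNIV" using D ne in_components_nonempty in_components_subset by blast+
  then obtain x where "x \<in> frontier D" using frontier_not_empty by blast
  then have "x \<in> closure D" "x \<in> \<Omega>" using fr ridge_subset by (auto simp: frontier_def)
  then show "D \<inter> \<Omega> \<noteq> {}" using open_dom by (metis Int_commute open_Int_closure_eq_empty disjoint_iff)
qed

text \<open>If \<open>D\<close> missed the boundary it would lie in the domain with its frontier in
  the ridge; as \<open>u\<close> has no interior minimum, it would be constantly \<open>m\<close> on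
  \<open>D\<close>, which is again impossible. If \<open>D\<close> contained the outer component,
  the unbounded component of the complement would be separated from the domain, although its
  frontier lies on the ridge.\<close>

lemma bounded_ridge_component:
  assumes D: "D \<in> components (- ridge)" "bounded D" and ne: "ridge \<noteq> {}"
  shows "\<Gamma>i \<subseteq> D" "\<Gamma>o \<inter> D = {}"
proof -
  note comp = ridge_component[OF D(1) ne]
  have Dc: "connected D" "D \<noteq> {}" using D(1) in_components_connected in_components_nonempty by blast+
  have "D \<inter> frontier \<Omega> \<noteq> {}"
  proof
    assume "D \<inter> frontier \<Omega> = {}"
    then have D\<Omega>: "D \<subseteq> \<Omega>" using connected_Int_frontier[OF Dc(1) comp(3)] by blast
    have cl: "closure D \<subseteq> \<Omega>" using comp(2) D\<Omega> ridge_subset by blast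
    have "continuous_on (closure D) u"
      by (rule continuous_on_subset[OF cont_u]) (use cl closure_subset in blast)
    moreover have "compact (closure D)" "closure D \<noteq> {}" using D(2) Dc by auto
    ultimately obtain x where x: "x \<in> closure D" "\<And>y. y \<in> closure D \<Longrightarrow> u x \<le> u y"
      using continuous_attains_inf[of "closure D" u] by blast
    have "x \<notin> D" using no_local_min[OF comp(1) _ D\<Omega>] x(2) closure_subset by blast
    then have "u x = m" using x(1) comp(2) ridge_subset by (auto simp: M_def)
    have u_D: "u y = m" if "y \<in> D" for y
    proof (rule antisym)
      show "u y \<le> m" using that D\<Omega> by (intro u_le dom_subset_closure) blast
      show "m \<le> u y" using x(2)[of y] that closure_subset \<open>u x = m\<close> by auto
    qed
    obtain y where "y \<in> D" using Dc(2) by blast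
    then show False using no_local_min[OF comp(1) _ D\<Omega>, of y] u_D by simp
  qed
  then have meet: "D \<inter> \<Gamma>i \<noteq> {} \<or> D \<inter> \<Gamma>o \<noteq> {}" using frontier_eq by blast
  show out: "\<Gamma>o \<inter> D = {}"
  proof (rule ccontr)
    assume "\<Gamma>o \<inter> D \<noteq> {}"
    then have \<Gamma>D: "\<Gamma>o \<subseteq> D"
      using components_maximal[OF D(1) connected_outer boundary_off_ridge(2)] by blast
    obtain D' where D': "D' \<in> components (- ridge)" "\<not> bounded D'"
      using cobounded_unbounded_components[of "- ridge"] compact_ridge compact_imp_bounded by auto
    then have "D' \<inter> D = {}" using components_nonoverlap[OF D'(1) D(1)] D(2) by blast
    then have "D' \<inter> \<Omega> = {}"
      using outer_encloses[of D'] D' \<Gamma>D in_components_connected by blast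
    then show False using ridge_component(3)[OF D'(1) ne] by blast
  qed
  then show "\<Gamma>i \<subseteq> D"
    using meet components_maximal[OF D(1) connected_inner boundary_off_ridge(1)] by blast
qed

text \<open>For \<open>q\<close> on the ridge the condition on \<nu> singles out the two unit
  normals; the normal ray has to avoid \<open>M\<close> because the gradient comparison holds off
  \<open>M\<close>.\<close>

definition two_sided :: "complex set \<Rightarrow> complex set \<Rightarrow> complex \<Rightarrow> bool" where
  "two_sided B E q \<longleftrightarrow> (\<exists>\<nu>. \<nu>\<^sup>2 * deriv g q = -1 \<and>
     (\<forall>\<^sub>F s in at_right 0. q + of_real s * \<nu> \<in> E \<inter> \<Omega> - M) \<and>
     (\<forall>\<^sub>F s in at_right 0. q - of_real s * \<nu> \<in> B \<inter> \<Omega> - M))"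

lemma chart_sides:
  assumes p: "p \<in> ridge" and ch: "chart p V \<zeta>" and q: "q \<in> V \<inter> M"
  obtains \<nu> where "\<nu>\<^sup>2 * deriv g q = -1"
    "\<forall>\<^sub>F s in at_right 0. q + of_real s * \<nu> \<in> V \<and> 0 < Im (\<zeta> (q + of_real s * \<nu>))"
    "\<forall>\<^sub>F s in at_right 0. q - of_real s * \<nu> \<in> V \<and> Im (\<zeta> (q - of_real s * \<nu>)) < 0"
proof -
  have V: "open V" "V \<subseteq> \<Omega>" and hol: "\<zeta> holomorphic_on \<Omega>" and qr: "q \<in> V" "q \<in> ridge"
    and z: "Im (\<zeta> q) = 0" and nz: "deriv \<zeta> q \<noteq> 0"
    using ch q unfolding chart_def by auto
  obtain T where T: "T\<^sup>2 = cnj (deriv g p)" "T * cnj T = 1"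
    using ridge_tangent[OF p] by blast
  obtain \<kappa> :: real where \<kappa>: "\<forall>z\<in>\<Omega>. deriv \<zeta> z = of_real \<kappa> * (cnj T + T * deriv g z)"
    using ch T(1) unfolding chart_def by blast
  show ?thesis
    using chart_transverse[OF V hol qr z nz T(2)] \<kappa> V(2) qr(1) that by blast
qed

text \<open>All bounded components of the complement contain the inner boundary, so there is just
  one bounded component \<open>B\<close>, beside the unbounded one \<open>E\<close>. If no chart had
  \<open>B\<close> and \<open>E\<close> on its two sides, then at every frontier point of
  \<open>B\<close> both halves of the chart would lie in \<open>B\<close>. The closure of
  \<open>B\<close> would then be open, hence the whole plane, although \<open>B\<close> is
  bounded.\<close>

lemma ridge_two_sided:
  assumes inf: "infinite M"
  obtains B E V p where "open B" "open E" "closure B \<subseteq> B \<union> ridge" "closure E \<subseteq> E \<union> ridge"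
    "\<Gamma>i \<subseteq> B" "\<Gamma>o \<subseteq> E" "B \<inter> E = {}"
    "open V" "p \<in> V \<inter> ridge" "V \<inter> M \<subseteq> ridge" "\<And>q. q \<in> V \<inter> M \<Longrightarrow> two_sided B E q"
proof -
  have ne: "ridge \<noteq> {}" using ridge_nonempty[OF inf] .
  have bd: "bounded (- (- ridge))" using compact_ridge compact_imp_bounded by auto
  obtain B where B: "B \<in> components (- ridge)" "bounded B"
    using cobounded_has_bounded_component[OF bd ridge_separates[OF ne]] by auto
  obtain E where E: "E \<in> components (- ridge)" "\<not> bounded E"
    using cobounded_unbounded_components[OF bd] by auto
  note Bc = ridge_component[OF B(1) ne] bounded_ridge_component[OF B ne]
  note Ec = ridge_component[OF E(1) ne]
  have BE: "B \<inter> E = {}" using components_nonoverlap[OF B(1) E(1)] B E by blast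
  have cover: "D = B \<or> D = E" if D: "D \<in> components (- ridge)" for D
  proof (cases "bounded D")
    case True
    from bounded_ridge_component(1)[OF D True ne] Bc(4) inner_nonempty have "D \<inter> B \<noteq> {}" by blast
    then show ?thesis using components_nonoverlap[OF D B(1)] by blast
  next
    case False
    then show ?thesis using cobounded_unique_unbounded_components[OF bd E D] by simp
  qed
  have "\<Gamma>o \<inter> \<Union>(components (- ridge)) \<noteq> {}"
    unfolding Union_components using boundary_off_ridge outer_nonempty by blast
  then have "\<Gamma>o \<inter> E \<noteq> {}" using cover Bc(5) by blast
  then have \<Gamma>E: "\<Gamma>o \<subseteq> E"
    using components_maximal[OF E(1) connected_outer boundary_off_ridge(2)] by blast
  have sides: "S \<subseteq> B \<or> S \<subseteq> E" if S: "connected S" "S \<inter> ridge = {}" for S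
  proof (cases "S = {}")
    case False
    then obtain D where "D \<in> components (- ridge)" "S \<subseteq> D"
      using exists_component_superset[of S "- ridge"] S by blast
    then show ?thesis using cover by blast
  qed simp
  have "\<exists>p V \<zeta>. p \<in> ridge \<and> chart p V \<zeta> \<and>
      ({z \<in> V. Im (\<zeta> z) > 0} \<subseteq> E \<and> {z \<in> V. Im (\<zeta> z) < 0} \<subseteq> B \<or>
       {z \<in> V. Im (\<zeta> z) > 0} \<subseteq> B \<and> {z \<in> V. Im (\<zeta> z) < 0} \<subseteq> E)"
  proof (rule ccontr)
    assume not: "\<not> ?thesis"
    have "frontier B \<subseteq> interior (closure B)"
    proof
      fix p assume pB: "p \<in> frontier B"
      then have p: "p \<in> ridge" using frontier_of_components_closed_complement[of ridge B]
          compact_imp_closed[OF compact_ridge] B(1) by blast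
      obtain V \<zeta> where ch: "chart p V \<zeta>" using ridge_chart[OF p] by blast
      define P N where "P = {z \<in> V. Im (\<zeta> z) > 0}" and "N = {z \<in> V. Im (\<zeta> z) < 0}"
      have V: "open V" "p \<in> V" "connected P" "connected N" "V \<inter> M \<subseteq> ridge"
        and MV: "\<And>z. z \<in> V \<Longrightarrow> z \<in> M \<longleftrightarrow> Im (\<zeta> z) = 0"
        using ch by (auto simp: chart_def P_def N_def)
      have disj: "P \<inter> ridge = {}" "N \<inter> ridge = {}"
        using MV ridge_subset(2) by (auto simp: P_def N_def)
      have split: "V \<subseteq> P \<union> N \<union> M" using MV by (auto simp: P_def N_def)
      have meet: "V \<inter> B \<noteq> {}"
        using pB V(1,2) by (metis Int_commute disjoint_iff frontier_closures IntE open_Int_closure_eq_empty)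
      have "B \<inter> ridge = {}" using in_components_subset[OF B(1)] by blast
      then have "(P \<union> N) \<inter> B \<noteq> {}" using meet split V(5) by blast
      moreover have "P \<subseteq> B \<and> N \<subseteq> B \<or> P \<subseteq> E \<and> N \<subseteq> E"
        using sides[OF V(3) disj(1)] sides[OF V(4) disj(2)] not p ch unfolding P_def N_def by blast
      ultimately have PN: "P \<union> N \<subseteq> B" using BE by blast
      have "V \<subseteq> closure B"
      proof
        fix q assume q: "q \<in> V"
        show "q \<in> closure B"
        proof (cases "q \<in> M")
          case True
          obtain \<nu> where \<nu>: "\<forall>\<^sub>F s in at_right 0. q + of_real s * \<nu> \<in> V \<and> 0 < Im (\<zeta> (q + of_real s * \<nu>))"
            using chart_sides[OF p ch, of q] q True by blast
          have "((\<lambda>s. q + of_real s * \<nu>) \<longlongrightarrow> q + of_real 0 * \<nu>) (at_right 0)" by (intro tendsto_intros)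
          then have lim: "((\<lambda>s. q + of_real s * \<nu>) \<longlongrightarrow> q) (at_right 0)" by simp
          have "\<forall>\<^sub>F s in at_right 0. q + of_real s * \<nu> \<in> closure B"
            using \<nu> by eventually_elim (use PN closure_subset in \<open>auto simp: P_def\<close>)
          then show ?thesis by (rule Lim_in_closed_set[OF closed_closure _ _ lim]) simp
        next
          case False
          then show ?thesis using q split PN closure_subset by blast
        qed
      qed
      then show "p \<in> interior (closure B)" using V(1,2) by (meson interior_maximal subsetD)
    qed
    then have "closure B \<subseteq> interior (closure B)"
      using Bc(1) closure_Un_frontier interior_maximal[OF closure_subset] by (metis Un_least)
    then have "open (closure B)" by (metis interior_subset open_interior subset_antisym)
    then have "closure B = {} \<or> closure B = UNIV" using clopen[of "closure B"] by simp
    moreover have "closure B \<noteq> {}" using in_components_nonempty[OF B(1)] by simp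
    moreover have "closure B \<noteq> UNIV" using bounded_closure[OF B(2)] not_bounded_UNIV[where 'a=complex] by auto
    ultimately show False by blast
  qed
  then obtain p V \<zeta> where p: "p \<in> ridge" and ch: "chart p V \<zeta>" and
      cases: "{z \<in> V. Im (\<zeta> z) > 0} \<subseteq> E \<and> {z \<in> V. Im (\<zeta> z) < 0} \<subseteq> B \<or>
       {z \<in> V. Im (\<zeta> z) > 0} \<subseteq> B \<and> {z \<in> V. Im (\<zeta> z) < 0} \<subseteq> E" by blast
  have V: "open V" "p \<in> V" "V \<inter> M \<subseteq> ridge" "V \<subseteq> \<Omega>" and MV: "\<And>z. z \<in> V \<Longrightarrow> z \<in> M \<longleftrightarrow> Im (\<zeta> z) = 0"
    using ch by (auto simp: chart_def)
  have "two_sided B E q" if q: "q \<in> V \<inter> M" for q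
  proof -
    obtain \<nu> where \<nu>: "\<nu>\<^sup>2 * deriv g q = -1"
      "\<forall>\<^sub>F s in at_right 0. q + of_real s * \<nu> \<in> V \<and> 0 < Im (\<zeta> (q + of_real s * \<nu>))"
      "\<forall>\<^sub>F s in at_right 0. q - of_real s * \<nu> \<in> V \<and> Im (\<zeta> (q - of_real s * \<nu>)) < 0"
      using chart_sides[OF p ch q] by blast
    show ?thesis
    proof (cases "{z \<in> V. Im (\<zeta> z) > 0} \<subseteq> E \<and> {z \<in> V. Im (\<zeta> z) < 0} \<subseteq> B")
      case True
      have "\<forall>\<^sub>F s in at_right 0. q + of_real s * \<nu> \<in> E \<inter> \<Omega> - M"
        using \<nu>(2) by eventually_elim (use True V(4) MV in force)
      moreover have "\<forall>\<^sub>F s in at_right 0. q - of_real s * \<nu> \<in> B \<inter> \<Omega> - M"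
        using \<nu>(3) by eventually_elim (use True V(4) MV in force)
      ultimately show ?thesis using \<nu>(1) unfolding two_sided_def by blast
    next
      case False
      then have sub: "{z \<in> V. Im (\<zeta> z) > 0} \<subseteq> B" "{z \<in> V. Im (\<zeta> z) < 0} \<subseteq> E" using cases by blast+
      have "\<forall>\<^sub>F s in at_right 0. q + of_real s * - \<nu> \<in> E \<inter> \<Omega> - M"
        using \<nu>(3) by eventually_elim (use sub V(4) MV in force)
      moreover have "\<forall>\<^sub>F s in at_right 0. q - of_real s * - \<nu> \<in> B \<inter> \<Omega> - M"
        using \<nu>(2) by eventually_elim (use sub V(4) MV in force)
      moreover have "(- \<nu>)\<^sup>2 * deriv g q = -1" using \<nu>(1) by simp
      ultimately show ?thesis unfolding two_sided_def by blast
    qed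
  qed
  then show ?thesis
    using that[of B E V p] Bc Ec \<Gamma>E BE V p by blast
qed

end

context torsion
begin

text \<open>
  \<open>Re (g'' \<nu>\<^sup>3)\<close> is the third derivative of \<open>u\<close> in the normal direction \<open>\<nu>\<close>; on the ridge it is twice its curvature.
\<close>

lemma normal_third_derivative_bound:
  assumes \<sigma>: "\<sigma> = 1 \<or> \<sigma> = -1" and a: "0 < a" and p: "p \<in> M" and \<nu>: "\<nu>\<^sup>2 * deriv g p = -1" "cmod \<nu> = 1"
    and le: "\<forall>\<^sub>F s in at_right 0. weight \<sigma> a (m - u (p + of_real s * \<nu>)) *
      (cmod (g (p + of_real s * \<nu>) - cnj (p + of_real s * \<nu>)))\<^sup>2 \<le> excess \<sigma> a (m - u (p + of_real s * \<nu>))"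
    and lt: "\<forall>\<^sub>F s in at_right 0. p + of_real s * \<nu> \<in> \<Omega> - M"
  shows "2 * \<sigma> / sqrt a \<le> Re (deriv (deriv g) p * \<nu> ^ 3)"
proof -
  define v where "v s = m - u (p + of_real s * \<nu>)" for s
  define y where "y s = - Re ((g (p + of_real s * \<nu>) - cnj (p + of_real s * \<nu>)) * \<nu>)" for s
  define y' where "y' s = - Re ((deriv g (p + of_real s * \<nu>) * \<nu> - cnj \<nu>) * \<nu>)" for s
  define K where "K = Re (deriv (deriv g) p * \<nu> ^ 3)"
  have p\<Omega>: "p \<in> \<Omega>" using p M_subset by blast
  have lim: "((\<lambda>s. p + of_real s * \<nu>) \<longlongrightarrow> p) (at_right 0)"
  proof -
    have "((\<lambda>s. p + of_real s * \<nu>) \<longlongrightarrow> p + of_real 0 * \<nu>) (at_right 0)" by (intro tendsto_intros)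
    then show ?thesis by simp
  qed
  have in_dom: "\<forall>\<^sub>F s in at_right 0. p + of_real s * \<nu> \<in> \<Omega>"
    using topological_tendstoD[OF lim open_dom p\<Omega>] .
  have p0: "p + of_real 0 * \<nu> \<in> \<Omega>" using p\<Omega> by simp
  have dv: "(v has_real_derivative y s) (at s)" if "p + of_real s * \<nu> \<in> \<Omega>" for s
    unfolding v_def y_def using u_line[OF that] by (auto intro!: derivative_eq_intros)
  have dy: "(y has_real_derivative y' s) (at s)" if "p + of_real s * \<nu> \<in> \<Omega>" for s
    unfolding y_def y'_def by (intro DERIV_minus u'_line that)
  have "(y' has_real_derivative - (Re (deriv (deriv g) p * \<nu>\<^sup>2) * Re \<nu> - Im (deriv (deriv g) p * \<nu>\<^sup>2) * Im \<nu>)) (at 0)"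
    unfolding y'_def times_complex.sel(1)[of _ \<nu>]
    by (rule derivative_eq_intros phi_line(3,4)[OF p0] refl)+ simp
  then have dy': "(y' has_real_derivative - K) (at 0)"
    by (simp add: K_def power2_eq_square power3_eq_cube algebra_simps)
  have \<nu>\<nu>: "\<nu> * cnj \<nu> = 1" using \<nu>(2) by (metis complex_norm_square of_real_1 one_power2)
  have gp: "g p = cnj p" using grad_zero_on_M[OF p] .
  have v0: "v 0 = 0" using p by (simp add: v_def M_def)
  have y0: "y 0 = 0" by (simp add: y_def gp)
  \<comment> \<open>The normal second derivative of \<open>v\<close> is \<open>2\<close>, the
    nonzero eigenvalue of its Hessian.\<close>
  have "(deriv g p * \<nu> - cnj \<nu>) * \<nu> = \<nu>\<^sup>2 * deriv g p - \<nu> * cnj \<nu>"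
    by (simp add: power2_eq_square algebra_simps)
  then have y'0: "y' 0 = 2" by (simp add: y'_def \<nu>(1) \<nu>\<nu> del: times_complex.sel)
  have nz: "\<forall>\<^sub>F s in at_right 0. (0::real) < s" by (rule eventually_at_right_less)
  have "((\<lambda>s. (y' s - y' 0) / (s - 0)) \<longlongrightarrow> - K) (at 0)"
    using dy' by (simp add: has_field_derivative_iff)
  then have "((\<lambda>s. (y' s - 2) / s) \<longlongrightarrow> - K) (at_right 0)"
    using y'0 filterlim_at_split[of "\<lambda>s. (y' s - 2) / s" "nhds (- K)" 0] by simp
  from tendsto_divide[OF this tendsto_const[of 2]]
  have l1: "((\<lambda>s. (y' s - 2) / (2 * s)) \<longlongrightarrow> - K / 2) (at_right 0)" by (simp add: mult.commute)
  have cont: "(v \<longlongrightarrow> 0) (at_right 0)" "(y \<longlongrightarrow> 0) (at_right 0)"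
    using DERIV_isCont[OF dv[OF p0]] DERIV_isCont[OF dy[OF p0]] v0 y0
    by (auto simp: isCont_def filterlim_at_split)
  \<comment> \<open>Two applications of l'Hospital's rule to \<open>v'' = 2 - K s + ...\<close> give
    \<open>v = s\<^sup>2 - K s\<^sup>3 / 6 + ...\<close>, so \<open>normal_expansion_bound\<close>
    is used with \<open>c = - K / 6\<close>.\<close>
  have l2: "((\<lambda>s. (y s - 2 * s) / s\<^sup>2) \<longlongrightarrow> - K / 2) (at_right 0)"
  proof (rule lhopital_right_0[where f' = "\<lambda>s. y' s - 2" and g' = "\<lambda>s. 2 * s"])
    show "((\<lambda>s. y s - 2 * s) \<longlongrightarrow> 0) (at_right 0)"
      using tendsto_diff[OF cont(2) tendsto_mult_right_zero[OF tendsto_ident_at, of 2]] by simp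
    show "((\<lambda>s::real. s\<^sup>2) \<longlongrightarrow> 0) (at_right 0)" by real_asymp
    show "\<forall>\<^sub>F s in at_right 0. ((\<lambda>s. y s - 2 * s) has_real_derivative y' s - 2) (at s)"
      using in_dom by eventually_elim (auto intro!: derivative_eq_intros dy)
    show "\<forall>\<^sub>F s in at_right 0. ((\<lambda>s::real. s\<^sup>2) has_real_derivative 2 * s) (at s)"
      by (auto intro!: always_eventually derivative_eq_intros)
    show "\<forall>\<^sub>F s::real in at_right 0. s\<^sup>2 \<noteq> 0" "\<forall>\<^sub>F s::real in at_right 0. 2 * s \<noteq> 0"
      using nz by (eventually_elim, simp)+
  qed (use l1 in simp)
  then have l2': "((\<lambda>s. (y s - 2 * s) / s\<^sup>2) \<longlongrightarrow> 3 * (- K / 6)) (at_right 0)" by simp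
  from tendsto_divide[OF l2 tendsto_const[of 3]]
  have l3: "((\<lambda>s. (y s - 2 * s) / (3 * s\<^sup>2)) \<longlongrightarrow> - K / 6) (at_right 0)" by (simp add: mult.commute)
  have "((\<lambda>s. (v s - s\<^sup>2) / s ^ 3) \<longlongrightarrow> - K / 6) (at_right 0)"
  proof (rule lhopital_right_0[where f' = "\<lambda>s. y s - 2 * s" and g' = "\<lambda>s. 3 * s\<^sup>2"])
    show "((\<lambda>s. v s - s\<^sup>2) \<longlongrightarrow> 0) (at_right 0)"
      using tendsto_diff[OF cont(1) tendsto_power[OF tendsto_ident_at, where n = 2]] by simp
    show "((\<lambda>s::real. s ^ 3) \<longlongrightarrow> 0) (at_right 0)" by real_asymp
    show "\<forall>\<^sub>F s in at_right 0. ((\<lambda>s. v s - s\<^sup>2) has_real_derivative y s - 2 * s) (at s)"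
      using in_dom by eventually_elim (auto intro!: derivative_eq_intros dv)
    show "\<forall>\<^sub>F s in at_right 0. ((\<lambda>s::real. s ^ 3) has_real_derivative 3 * s\<^sup>2) (at s)"
      by (auto intro!: always_eventually derivative_eq_intros)
    show "\<forall>\<^sub>F s::real in at_right 0. s ^ 3 \<noteq> 0" "\<forall>\<^sub>F s::real in at_right 0. 3 * s\<^sup>2 \<noteq> 0"
      using nz by (eventually_elim, simp)+
  qed (use l3 in simp)
  moreover have "\<forall>\<^sub>F s in at_right 0. weight \<sigma> a (v s) * (y s)\<^sup>2 \<le> excess \<sigma> a (v s)"
    using le lt
  proof eventually_elim
    case (elim s)
    let ?w = "p + of_real s * \<nu>"
    have "u ?w \<noteq> m" "u ?w \<le> m" using elim(2) u_le dom_subset_closure by (auto simp: M_def)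
    then have "0 < v s" by (simp add: v_def)
    then have k: "0 < weight \<sigma> a (v s)" by (rule weight_pos[OF \<sigma> a])
    have "\<bar>y s\<bar> \<le> cmod ((g ?w - cnj ?w) * \<nu>)" unfolding y_def abs_minus_cancel by (rule abs_Re_le_cmod)
    also have "\<dots> = cmod (g ?w - cnj ?w)" using \<nu>(2) by (simp add: norm_mult)
    finally have "(y s)\<^sup>2 \<le> (cmod (g ?w - cnj ?w))\<^sup>2" by (metis abs_ge_zero power2_abs power_mono)
    then have "weight \<sigma> a (v s) * (y s)\<^sup>2 \<le> weight \<sigma> a (v s) * (cmod (g ?w - cnj ?w))\<^sup>2"
      using k by (intro mult_left_mono) auto
    with elim(1) show ?case unfolding v_def by linarith
  qed
  ultimately have "2 * (- K / 6) \<le> - \<sigma> * 2 / (3 * sqrt a)"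
    using l2' by (intro normal_expansion_bound[OF \<sigma> a])
  then have "\<sigma> * 2 / (3 * sqrt a) \<le> K / 3" by simp
  then show ?thesis unfolding K_def[symmetric] by (simp add: field_simps)
qed

text \<open>
  On a ridge of constant curvature \<open>g''\<^sup>2 = - (4 / a) g'\<^sup>3\<close>, hence on all of \<open>\<Omega>\<close>. For such \<open>g\<close> both
  \<open>z + 2 g' / g''\<close> and \<open>g + a g'' / (2 g')\<close> are locally constant.
\<close>

lemma constant_curvature_rigidity:
  assumes a: "0 < a" and V: "open V" "p \<in> V \<inter> ridge" "V \<inter> M \<subseteq> ridge"
    and curv: "\<And>q. q \<in> V \<inter> M \<Longrightarrow> \<exists>\<nu>. \<nu>\<^sup>2 * deriv g q = -1 \<and> Re (deriv (deriv g) q * \<nu> ^ 3) = 2 / sqrt a"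
  obtains z0 where "\<And>z. z \<in> \<Omega> \<Longrightarrow> (g z - cnj z0) * (z - z0) = of_real a"
proof -
  define b where "b = complex_of_real (sqrt a)"
  have b: "b \<noteq> 0" "b\<^sup>2 = of_real a" using a by (auto simp: b_def simp flip: of_real_power)
  have at_ridge: "\<exists>\<nu>. \<nu> * cnj \<nu> = 1 \<and> deriv g q = - (cnj \<nu>)\<^sup>2 \<and> deriv (deriv g) q = 2 / b * (cnj \<nu>) ^ 3"
    if q: "q \<in> V \<inter> M" for q
  proof -
    have qr: "q \<in> ridge" using q V(3) by blast
    obtain \<nu> where \<nu>: "\<nu>\<^sup>2 * deriv g q = -1" "Re (deriv (deriv g) q * \<nu> ^ 3) = 2 / sqrt a"
      using curv[OF q] by blast
    have "cmod (\<nu>\<^sup>2 * deriv g q) = 1" using \<nu>(1) by simp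
    then have "(cmod \<nu>)\<^sup>2 = 1" using ridge_derivatives(1)[OF qr] by (simp add: norm_mult norm_power)
    then have \<nu>\<nu>: "\<nu> * cnj \<nu> = 1" by (metis complex_norm_square of_real_1)
    have "deriv g q = (\<nu>\<^sup>2 * deriv g q) * (cnj \<nu>)\<^sup>2"
    proof -
      have "(\<nu>\<^sup>2 * deriv g q) * (cnj \<nu>)\<^sup>2 = deriv g q * (\<nu> * cnj \<nu>)\<^sup>2"
        by (simp add: power_mult_distrib mult_ac)
      then show ?thesis by (simp add: \<nu>\<nu>)
    qed
    then have g1: "deriv g q = - (cnj \<nu>)\<^sup>2" using \<nu>(1) by simp
    \<comment> \<open>The curvature hypothesis gives only \<open>Re X\<close>. The second relation
      of \<open>ridge_derivatives\<close> makes \<open>X\<close> real, and so determines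
      \<open>g''\<close> at \<open>q\<close>.\<close>
    define X where "X = deriv (deriv g) q * \<nu> ^ 3"
    have g2: "deriv (deriv g) q = X * (cnj \<nu>) ^ 3"
    proof -
      have "X * (cnj \<nu>) ^ 3 = deriv (deriv g) q * (\<nu> * cnj \<nu>) ^ 3"
        by (simp add: X_def power_mult_distrib mult_ac)
      then show ?thesis by (simp add: \<nu>\<nu>)
    qed
    have "cnj X * \<nu> ^ 3 * (cnj \<nu>) ^ 4 - \<nu>\<^sup>2 * (X * (cnj \<nu>) ^ 3) = 0"
      using ridge_derivatives(2)[OF qr] unfolding g1 g2
      by (simp flip: power_mult)
    moreover have "cnj X * \<nu> ^ 3 * (cnj \<nu>) ^ 4 = cnj X * cnj \<nu> * (\<nu> * cnj \<nu>) ^ 3"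
      by (simp add: power_mult_distrib eval_nat_numeral)
    moreover have "\<nu>\<^sup>2 * (X * (cnj \<nu>) ^ 3) = X * cnj \<nu> * (\<nu> * cnj \<nu>)\<^sup>2"
      by (simp add: power_mult_distrib eval_nat_numeral)
    ultimately have "cnj X * cnj \<nu> = X * cnj \<nu>" by (simp add: \<nu>\<nu>)
    then have "cnj X = X" using \<nu>\<nu> by auto
    then have "X = of_real (Re X)" by (simp add: complex_eq_iff)
    then have "X = 2 / b" using \<nu>(2) by (simp add: X_def[symmetric] b_def)
    then show ?thesis using \<nu>\<nu> g1 g2 by auto
  qed
  have gh: "deriv g holomorphic_on \<Omega>" "deriv (deriv g) holomorphic_on \<Omega>"
    by (intro holomorphic_deriv holo open_dom)+
  have p: "p \<in> V \<inter> M" "p \<in> \<Omega>" "p islimpt V \<inter> M"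
  proof -
    show "p \<in> V \<inter> M" "p \<in> \<Omega>" using V ridge_subset by auto
    have "p islimpt M \<inter> V"
      using V(1,2) by (intro islimpt_Int_eventually eventually_at_in_open') (auto simp: ridge_def)
    then show "p islimpt V \<inter> M" by (simp add: Int_commute)
  qed
  have ode: "(deriv (deriv g) z)\<^sup>2 + 4 / of_real a * (deriv g z) ^ 3 = 0" if z: "z \<in> \<Omega>" for z
  proof (rule analytic_continuation[of "\<lambda>z. (deriv (deriv g) z)\<^sup>2 + 4 / of_real a * (deriv g z) ^ 3",
        OF _ open_dom connected_dom _ p(2,3) _ z])
    show "(\<lambda>z. (deriv (deriv g) z)\<^sup>2 + 4 / of_real a * (deriv g z) ^ 3) holomorphic_on \<Omega>"
      by (intro holomorphic_intros gh)
    show "V \<inter> M \<subseteq> \<Omega>" using M_subset by blast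
    show "(deriv (deriv g) q)\<^sup>2 + 4 / of_real a * (deriv g q) ^ 3 = 0" if q: "q \<in> V \<inter> M" for q
    proof -
      obtain \<nu> where \<nu>: "deriv g q = - (cnj \<nu>)\<^sup>2" "deriv (deriv g) q = 2 / b * (cnj \<nu>) ^ 3"
        using at_ridge[OF q] by blast
      show ?thesis unfolding \<nu> b(2)[symmetric]
        by (simp add: power_mult_distrib power_divide flip: power_mult)
    qed
  qed
  obtain \<nu> where \<nu>: "\<nu> * cnj \<nu> = 1" "deriv g p = - (cnj \<nu>)\<^sup>2" "deriv (deriv g) p = 2 / b * (cnj \<nu>) ^ 3"
    using at_ridge[OF p(1)] by blast
  have \<nu>0: "cnj \<nu> \<noteq> 0" using \<nu>(1) by auto
  have nz: "deriv g p \<noteq> 0" "deriv (deriv g) p \<noteq> 0" using \<nu>0 b(1) \<nu>(2,3) by auto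
  have contg: "continuous_on \<Omega> (deriv g)" "continuous_on \<Omega> (deriv (deriv g))"
    using gh by (auto intro: holomorphic_on_imp_continuous_on)
  have "open ((\<Omega> \<inter> deriv g -` (- {0})) \<inter> (\<Omega> \<inter> deriv (deriv g) -` (- {0})))"
    by (intro open_Int continuous_open_preimage contg open_dom) auto
  moreover have "p \<in> (\<Omega> \<inter> deriv g -` (- {0})) \<inter> (\<Omega> \<inter> deriv (deriv g) -` (- {0}))"
    using nz p(2) by simp
  ultimately obtain r where r: "0 < r" "ball p r \<subseteq> (\<Omega> \<inter> deriv g -` (- {0})) \<inter> (\<Omega> \<inter> deriv (deriv g) -` (- {0}))"
    using open_contains_ball by blast
  have nzr: "z \<in> \<Omega>" "deriv g z \<noteq> 0" "deriv (deriv g) z \<noteq> 0" if "z \<in> ball p r" for z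
    using r(2) that by auto
  have third: "deriv (deriv (deriv g)) z = - 6 / of_real a * (deriv g z)\<^sup>2" if z: "z \<in> ball p r" for z
  proof -
    define g1 g2 g3 where "g1 = deriv g z" and "g2 = deriv (deriv g) z" and "g3 = deriv (deriv (deriv g)) z"
    have d: "(deriv g has_field_derivative g2) (at z)" "(deriv (deriv g) has_field_derivative g3) (at z)"
      unfolding g2_def g3_def using nzr(1)[OF z] by (auto intro: holomorphic_derivI[OF _ open_dom] gh)
    have "((\<lambda>z. (deriv (deriv g) z)\<^sup>2 + 4 / of_real a * (deriv g z) ^ 3) has_field_derivative
        2 * g2 * g3 + 4 / of_real a * (3 * g1\<^sup>2 * g2)) (at z)"
      by (rule derivative_eq_intros d refl)+ (simp add: g1_def g2_def)
    moreover have "((\<lambda>z. (deriv (deriv g) z)\<^sup>2 + 4 / of_real a * (deriv g z) ^ 3) has_field_derivative 0) (at z)"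
      by (rule has_field_derivative_transform_within_open[OF DERIV_const[where k = 0] open_dom nzr(1)[OF z]])
         (simp only: ode)
    ultimately have "2 * g2 * g3 + 4 / of_real a * (3 * g1\<^sup>2 * g2) = 0" by (rule DERIV_unique)
    then have "2 * g2 * (g3 + 6 / of_real a * g1\<^sup>2) = 0" by (simp add: algebra_simps)
    then have "g3 + 6 / of_real a * g1\<^sup>2 = 0" using nzr(3)[OF z] by (simp add: g2_def)
    then show ?thesis by (simp add: g1_def g3_def add_eq_0_iff)
  qed
  \<comment> \<open>For the radial solution, \<open>g z = cnj z0 + a / (z - z0)\<close>, these
    expressions equal \<open>z0\<close> and \<open>cnj z0\<close>. Once they are constant,
    multiplying \<open>z - z0\<close> by \<open>g z - cnj z0\<close> gives \<open>a\<close>.\<close>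
  define c where "c z = z + 2 * deriv g z / deriv (deriv g) z" for z
  define e where "e z = g z + of_real a * deriv (deriv g) z / (2 * deriv g z)" for z
  have dc: "(c has_field_derivative 0) (at z within ball p r)" and de: "(e has_field_derivative 0) (at z within ball p r)"
    if z: "z \<in> ball p r" for z
  proof -
    define g1 g2 where "g1 = deriv g z" and "g2 = deriv (deriv g) z"
    have d: "(g has_field_derivative g1) (at z)" "(deriv g has_field_derivative g2) (at z)"
      "(deriv (deriv g) has_field_derivative - 6 / of_real a * g1\<^sup>2) (at z)"
      unfolding g1_def g2_def third[OF z, symmetric] using nzr(1)[OF z]
      by (auto intro: holomorphic_derivI[OF _ open_dom] gh holo)
    have n: "g1 \<noteq> 0" "g2 \<noteq> 0" using nzr(2,3)[OF z] by (auto simp: g1_def g2_def)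
    have a0: "of_real a \<noteq> (0::complex)" using a by simp
    have sq: "g2\<^sup>2 = - 4 / of_real a * g1 ^ 3"
      using ode[OF nzr(1)[OF z]] by (simp add: g1_def g2_def eq_neg_iff_add_eq_0)
    have "(c has_field_derivative 1 + (2 * g2 * g2 - 2 * g1 * (- 6 / of_real a * g1\<^sup>2)) / (g2 * g2)) (at z)"
      unfolding c_def[abs_def] by (rule derivative_eq_intros d refl)+ (use n in \<open>simp_all add: g1_def g2_def\<close>)
    moreover have "2 * g2 * g2 - 2 * g1 * (- 6 / of_real a * g1\<^sup>2) = - (g2 * g2)"
    proof -
      have "2 * g2 * g2 - 2 * g1 * (- 6 / of_real a * g1\<^sup>2) + g2 * g2 = 3 * g2\<^sup>2 + 12 / of_real a * g1 ^ 3"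
        by (simp add: power2_eq_square power3_eq_cube)
      also have "\<dots> = 0" unfolding sq by simp
      finally show ?thesis by (simp only: eq_neg_iff_add_eq_0)
    qed
    ultimately have "(c has_field_derivative 1 + (- (g2 * g2)) / (g2 * g2)) (at z)" by (simp only:)
    then have "(c has_field_derivative 0) (at z)" using n by simp
    then show "(c has_field_derivative 0) (at z within ball p r)" by (rule has_field_derivative_at_within)
    have "(e has_field_derivative g1 + (of_real a * (- 6 / of_real a * g1\<^sup>2) * (2 * g1) - of_real a * g2 * (2 * g2)) / (2 * g1 * (2 * g1))) (at z)"
      unfolding e_def[abs_def] by (rule derivative_eq_intros d refl)+ (use n in \<open>simp_all add: g1_def g2_def\<close>)
    moreover have "of_real a * (- 6 / of_real a * g1\<^sup>2) * (2 * g1) - of_real a * g2 * (2 * g2) = - g1 * (2 * g1 * (2 * g1))"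
    proof -
      have "of_real a * g2 * (2 * g2) = 2 * of_real a * g2\<^sup>2" by (simp add: power2_eq_square)
      then show ?thesis unfolding sq using a0 by (simp add: power2_eq_square power3_eq_cube)
    qed
    ultimately have "(e has_field_derivative g1 + - g1 * (2 * g1 * (2 * g1)) / (2 * g1 * (2 * g1))) (at z)" by (simp only:)
    then have "(e has_field_derivative 0) (at z)" using n by simp
    then show "(e has_field_derivative 0) (at z within ball p r)" by (rule has_field_derivative_at_within)
  qed
  have pr: "p \<in> ball p r" using r(1) by simp
  define z0 where "z0 = c p"
  have c_const: "c z = z0" and e_const: "e z = e p" if z: "z \<in> ball p r" for z
    using has_field_derivative_zero_constant[OF convex_ball dc] has_field_derivative_zero_constant[OF convex_ball de]
      z pr by (auto simp: z0_def)
  \<comment> \<open>The centre is reached from \<open>p\<close> by going \<open>sqrt a\<close>, the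
    radius of curvature, against the normal \<nu>.\<close>
  have z0: "z0 = p - b * \<nu>"
  proof -
    have "2 * deriv g p / deriv (deriv g) p = - b / cnj \<nu>"
      unfolding \<nu>(2,3) using \<nu>0 b(1) by (simp add: power2_eq_square power3_eq_cube)
    also have "\<dots> = - b * \<nu>" using \<nu>(1) \<nu>0 by (simp add: field_simps)
    finally show ?thesis by (simp add: z0_def c_def)
  qed
  have "e p = cnj z0"
  proof -
    have "of_real a * deriv (deriv g) p / (2 * deriv g p) = - b * cnj \<nu>"
      unfolding \<nu>(2,3) b(2)[symmetric] using \<nu>0 b(1) by (simp add: power2_eq_square power3_eq_cube)
    then show ?thesis using grad_zero_on_M[of p] p(1) by (simp add: e_def z0 b_def)
  qed
  have loc: "(g z - cnj z0) * (z - z0) - of_real a = 0" if z: "z \<in> ball p r" for z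
  proof -
    have "z - z0 = - (2 * deriv g z / deriv (deriv g) z)"
      using c_const[OF z] unfolding c_def by (metis add_diff_cancel_left' minus_diff_eq)
    moreover have "g z - cnj z0 = - (of_real a * deriv (deriv g) z / (2 * deriv g z))"
      using e_const[OF z] \<open>e p = cnj z0\<close> unfolding e_def by (metis add_diff_cancel_left' minus_diff_eq)
    ultimately show ?thesis using nzr(2,3)[OF z] by simp
  qed
  have "(g z - cnj z0) * (z - z0) - of_real a = 0" if z: "z \<in> \<Omega>" for z
  proof (rule analytic_continuation[of "\<lambda>z. (g z - cnj z0) * (z - z0) - of_real a",
        OF _ open_dom connected_dom _ p(2) _ loc z])
    show "(\<lambda>z. (g z - cnj z0) * (z - z0) - of_real a) holomorphic_on \<Omega>"
      by (intro holomorphic_intros holo)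
    show "ball p r \<subseteq> \<Omega>" using r(2) by blast
    show "p islimpt ball p r" using pr by (intro interior_limit_point) simp
  qed
  then show ?thesis by (intro that[of z0]) simp
qed

text \<open>The hypothesis on \<open>g\<close> fixes the gradient of \<open>u\<close>, and a maximum
  point fixes the additive constant, so \<open>u\<close> is the radial function \<open>w\<close>.
  Positivity of \<open>u\<close> confines the domain to the annulus between the zero circles of
  \<open>w\<close>. Since \<open>w\<close> has no zero in that annulus, no frontier point of the
  domain lies in it, and by connectedness the two coincide.\<close>

lemma radial_solution:
  assumes a: "0 < a" and gz: "\<And>z. z \<in> \<Omega> \<Longrightarrow> (g z - cnj z0) * (z - z0) = of_real a"
    and x: "0 < xi" "xi < 1" "1 < xo" "eta xi = 2 * m / a" "eta xo = 2 * m / a"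
  shows "\<Omega> = {z. sqrt (a * xi) < cmod (z - z0) \<and> cmod (z - z0) < sqrt (a * xo)}"
    and "\<And>z. z \<in> closure \<Omega> \<Longrightarrow> u z = m - a / 2 * eta ((cmod (z - z0))\<^sup>2 / a)"
proof -
  define w where "w z = m - a / 2 * eta ((cmod (z - z0))\<^sup>2 / a)" for z
  have z0: "z0 \<notin> \<Omega>" using gz[of z0] a by auto
  have dw: "(w has_derivative (\<lambda>h. Re ((g z - cnj z) * h))) (at z)" if z: "z \<in> \<Omega>" for z
  proof -
    define N where "N z = (cmod (z - z0))\<^sup>2 / a" for z
    have ne: "z - z0 \<noteq> 0" using z z0 by auto
    have N: "0 < N z" using ne a by (simp add: N_def)
    have dN: "(N has_derivative (\<lambda>h. 2 / a * Re (cnj (z - z0) * h))) (at z)"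
      unfolding N_def[abs_def] power2_norm_eq_inner
      by (rule derivative_eq_intros refl)+ (use a in \<open>auto simp: fun_eq_iff inner_complex_def field_simps\<close>)
    have "((\<lambda>z. eta (N z)) has_derivative (\<lambda>h. (N z - 1) / N z * (2 / a * Re (cnj (z - z0) * h)))) (at z)"
      using has_derivative_compose[OF dN has_field_derivative_imp_has_derivative[OF eta_deriv[OF N]]] by simp
    then have "(w has_derivative (\<lambda>h. - (a / 2) * ((N z - 1) / N z * (2 / a * Re (cnj (z - z0) * h))))) (at z)"
      unfolding w_def N_def[symmetric] by (auto intro!: derivative_eq_intros)
    moreover have "- (a / 2) * ((N z - 1) / N z * (2 / a * Re (cnj (z - z0) * h))) = Re ((g z - cnj z) * h)" for h
    proof -
      have cc: "(z - z0) * cnj (z - z0) = of_real (a * N z)"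
        using complex_norm_square[of "z - z0"] a by (simp add: N_def del: complex_cnj_diff)
      have "(g z - cnj z0) * (of_real (a * N z)) = of_real a * cnj (z - z0)"
        unfolding cc[symmetric] by (simp only: mult.assoc[symmetric] gz[OF z])
      then have "of_real a * ((g z - cnj z0) * of_real (N z)) = of_real a * cnj (z - z0)"
        by (simp only: of_real_mult mult_ac)
      moreover have "of_real a \<noteq> (0::complex)" "of_real (N z) \<noteq> (0::complex)" using a N by simp_all
      ultimately have "g z - cnj z0 = cnj (z - z0) / of_real (N z)"
        by (simp only: mult_cancel_left nonzero_eq_divide_eq simp_thms)
      then have "g z - cnj z = cnj (z - z0) * of_real (1 / N z - 1)"
        by (simp add: algebra_simps)
      then have "(g z - cnj z) * h = of_real (1 / N z - 1) * (cnj (z - z0) * h)" by (simp only: mult_ac)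
      moreover have "Re (of_real r * w) = r * Re w" for r w by simp
      ultimately have "Re ((g z - cnj z) * h) = (1 / N z - 1) * Re (cnj (z - z0) * h)" by (simp only:)
      moreover have "- (a / 2) * ((N z - 1) / N z * (2 / a * Y)) = (1 / N z - 1) * Y" for Y
        using a N by (simp add: field_simps)
      ultimately show ?thesis by (simp only:)
    qed
    ultimately show ?thesis by simp
  qed
  obtain p where p: "p \<in> \<Omega>" "u p = m" using max_attained by blast
  have "(cmod (p - z0))\<^sup>2 = a"
  proof -
    have "p \<in> M" using p by (simp add: M_def)
    then have "(cnj p - cnj z0) * (p - z0) = of_real a" using gz[OF p(1)] grad_zero_on_M by simp
    then have "complex_of_real ((cmod (p - z0))\<^sup>2) = of_real a" by (simp only: complex_norm_square complex_cnj_diff mult.commute)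
    then show ?thesis by (simp only: of_real_eq_iff)
  qed
  then have wp: "w p = m" using a by (simp add: w_def)
  have uw: "u z = w z" if z: "z \<in> \<Omega>" for z
  proof -
    have "u z - w z = u p - w p"
    proof (rule has_derivative_zero_unique_connected[OF open_dom connected_dom _ z p(1)])
      fix y assume "y \<in> \<Omega>"
      from has_derivative_diff[OF deriv_u[OF this] dw[OF this]]
      show "((\<lambda>y. u y - w y) has_derivative (\<lambda>h. 0)) (at y)" by simp
    qed
    then show ?thesis using p wp by simp
  qed
  have bounds: "a * xi < (cmod (z - z0))\<^sup>2 \<and> (cmod (z - z0))\<^sup>2 < a * xo" if z: "z \<in> \<Omega>" for z
  proof -
    define X where "X = (cmod (z - z0))\<^sup>2 / a"
    have "z - z0 \<noteq> 0" using z z0 by auto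
    then have X: "0 < X" using a by (simp add: X_def)
    have "a / 2 * eta X < m" using u_pos[OF z] uw[OF z] by (simp add: w_def X_def)
    then have lt: "eta X < 2 * m / a" using a by (simp add: field_simps)
    have "xi < X"
    proof (rule ccontr)
      assume "\<not> xi < X"
      then have "eta xi \<le> eta X" using eta_greater[of X xi] X x by (cases "X = xi") auto
      then show False using lt x by simp
    qed
    moreover have "X < xo"
    proof (rule ccontr)
      assume "\<not> X < xo"
      then have "eta xo \<le> eta X" using eta_less[of xo X] x by (cases "X = xo") auto
      then show False using lt x by simp
    qed
    ultimately show ?thesis using a by (simp add: X_def field_simps)
  qed
  define K where "K = {z. a * xi \<le> (cmod (z - z0))\<^sup>2 \<and> (cmod (z - z0))\<^sup>2 \<le> a * xo}"
  have "closed K" unfolding K_def by (intro closed_Collect_conj closed_Collect_le continuous_intros)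
  then have clK: "closure \<Omega> \<subseteq> K" using bounds by (intro closure_minimal) (auto simp: K_def less_imp_le)
  have ap: "0 < a * xi" using a x by simp
  have pos: "0 < (cmod (z - z0))\<^sup>2 / a" if "z \<in> K" for z
    using that ap a by (intro divide_pos_pos) (auto simp: K_def)
  have "continuous_on K w"
    unfolding w_def using a pos
    by (intro continuous_intros continuous_on_compose2[OF eta_cont[of "{0<..}"]]) auto
  then have cw: "continuous_on (closure \<Omega>) w" using clK continuous_on_subset by blast
  have "u z - w z = 0" if z: "z \<in> closure \<Omega>" for z
    using continuous_constant_on_closure[of \<Omega> "\<lambda>z. u z - w z" 0 z] cont_u cw uw z
    by (auto intro: continuous_on_diff)
  then have uwc: "u z = w z" if "z \<in> closure \<Omega>" for z using that by simp
  then show "\<And>z. z \<in> closure \<Omega> \<Longrightarrow> u z = m - a / 2 * eta ((cmod (z - z0))\<^sup>2 / a)" by (simp add: w_def)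
  define A where "A = {z. sqrt (a * xi) < cmod (z - z0) \<and> cmod (z - z0) < sqrt (a * xo)}"
  have A_iff: "z \<in> A \<longleftrightarrow> a * xi < (cmod (z - z0))\<^sup>2 \<and> (cmod (z - z0))\<^sup>2 < a * xo" for z
    unfolding A_def using a x
    by (metis (mono_tags, lifting) mem_Collect_eq norm_ge_zero real_sqrt_abs abs_of_nonneg real_sqrt_less_iff)
  have "connected A" unfolding A_def by (rule connected_annulus) simp
  moreover have sub: "\<Omega> \<subseteq> A" using bounds A_iff by blast
  moreover have "A \<inter> frontier \<Omega> = {}"
  proof (rule ccontr)
    assume "A \<inter> frontier \<Omega> \<noteq> {}"
    then obtain z where z: "z \<in> A" "z \<in> frontier \<Omega>" by blast
    define X where "X = (cmod (z - z0))\<^sup>2 / a"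
    have X: "xi < X" "X < xo" using z(1) A_iff a by (auto simp: X_def field_simps)
    have "w z = 0" using uwc[of z] frontier_zero[OF z(2)] z(2) by (auto simp: frontier_def)
    then have e: "eta X = 2 * m / a" using a by (simp add: w_def X_def field_simps)
    show False
    proof (cases "X \<le> 1")
      case True then show False using eta_greater[of xi X] X x e by simp
    next
      case False then show False using eta_less[of X xo] X x e by simp
    qed
  qed
  ultimately have "\<Omega> = A" using connected_Int_frontier[of A \<Omega>] nonempty_dom by blast
  then show "\<Omega> = {z. sqrt (a * xi) < cmod (z - z0) \<and> cmod (z - z0) < sqrt (a * xo)}"
    by (simp add: A_def)
qed

end

context ring_torsion
begin

text \<open>\<open>outer\<close> and \<open>inner\<close> hold for every \<open>a\<close> whose
  model value of \<open>shear\<close> dominates the squared NWSS. If \<tau>o were at most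
  \<open>1\<close>, every \<open>a\<close> would qualify and small \<open>a\<close> would make the
  curvature unbounded. If \<tau>i were at most \<open>sqrt 2\<close>, large \<open>a\<close> would
  make it nonpositive, against the positive lower bound from \<open>outer\<close>. Otherwise
  \<open>a\<close> is chosen with equality on the respective boundary component.\<close>

theorem core_radius_comparison:
  assumes inf: "infinite M" and \<tau>o: "0 \<le> \<tau>o" "\<tau>o < sqrt 2" and \<tau>i: "0 \<le> \<tau>i"
    and Go: "\<And>z. z \<in> \<Gamma>o \<Longrightarrow> 0 \<le> G z \<and> G z \<le> \<tau>o * sqrt (2 * m)"
    and Gi: "\<And>z. z \<in> \<Gamma>i \<Longrightarrow> 0 \<le> G z \<and> G z \<le> \<tau>i * sqrt (2 * m)"
  shows "1 < \<tau>o" "sqrt 2 < \<tau>i"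
    and "\<And>xo xi. 1 < xo \<Longrightarrow> shear xo = \<tau>o\<^sup>2 \<Longrightarrow> 0 < xi \<Longrightarrow> xi < 1 \<Longrightarrow> shear xi = \<tau>i\<^sup>2 \<Longrightarrow> eta xo \<le> eta xi"
    and "\<And>xo xi. 1 < xo \<Longrightarrow> shear xo = \<tau>o\<^sup>2 \<Longrightarrow> 0 < xi \<Longrightarrow> xi < 1 \<Longrightarrow> shear xi = \<tau>i\<^sup>2 \<Longrightarrow> eta xo = eta xi \<Longrightarrow>
       \<exists>z0 a. 0 < a \<and> eta xo = 2 * m / a \<and>
         \<Omega> = {z. sqrt (a * xi) < cmod (z - z0) \<and> cmod (z - z0) < sqrt (a * xo)} \<and>
         (\<forall>z\<in>closure \<Omega>. u z = m - a / 2 * eta ((cmod (z - z0))\<^sup>2 / a))"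
proof -
  obtain B E V p where BE: "open B" "open E" "closure B \<subseteq> B \<union> ridge" "closure E \<subseteq> E \<union> ridge"
    "\<Gamma>i \<subseteq> B" "\<Gamma>o \<subseteq> E" "B \<inter> E = {}"
    and V: "open V" "p \<in> V \<inter> ridge" "V \<inter> M \<subseteq> ridge"
    and ts: "\<And>q. q \<in> V \<inter> M \<Longrightarrow> two_sided B E q"
    using ridge_two_sided[OF inf] by blast
  \<comment> \<open>Both comparisons are expanded along one and the same normal, so that they bound
    the same number \<open>K q \<nu>\<close> from two sides.\<close>
  define good where "good q \<nu> \<longleftrightarrow> q \<in> V \<inter> M \<and> \<nu>\<^sup>2 * deriv g q = -1 \<and>
     (\<forall>\<^sub>F s in at_right 0. q + of_real s * \<nu> \<in> E \<inter> \<Omega> - M) \<and>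
     (\<forall>\<^sub>F s in at_right 0. q - of_real s * \<nu> \<in> B \<inter> \<Omega> - M)" for q \<nu>
  define K where "K q \<nu> = Re (deriv (deriv g) q * \<nu> ^ 3)" for q \<nu>
  have closed_M: "closed M" using compact_M compact_imp_closed by blast
  have norm\<nu>: "cmod \<nu> = 1" if "good q \<nu>" for q \<nu>
  proof -
    have "cmod (\<nu>\<^sup>2 * deriv g q) = 1" using that by (simp add: good_def)
    moreover have "cmod (deriv g q) = 1" using that V(3) ridge_derivatives(1) by (auto simp: good_def)
    ultimately have "(cmod \<nu>)\<^sup>2 = 1" by (simp add: norm_mult norm_power)
    then show ?thesis by (metis norm_ge_zero one_power2 power2_eq_imp_eq zero_le_one)
  qed
  have bd: "weight \<sigma> a m * (G z)\<^sup>2 \<le> excess \<sigma> a m"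
    if \<sigma>: "\<sigma> = 1 \<or> \<sigma> = -1" and a: "0 < a" and sh: "\<tau>\<^sup>2 \<le> shear (eta_branch \<sigma> (2 * m / a))" and \<tau>: "0 \<le> \<tau>"
      and G: "0 \<le> G z \<and> G z \<le> \<tau> * sqrt (2 * m)" for \<sigma> a \<tau> z
  proof -
    have "(G z)\<^sup>2 \<le> (\<tau> * sqrt (2 * m))\<^sup>2" using G by (intro power_mono) auto
    also have "\<dots> = 2 * m * \<tau>\<^sup>2" using m_pos by (simp add: power_mult_distrib)
    also have "\<dots> \<le> 2 * m * shear (eta_branch \<sigma> (2 * m / a))" using sh m_pos by simp
    also have "\<dots> = excess \<sigma> a m / weight \<sigma> a m" using excess_weight_eq_shear[OF \<sigma> a m_pos] by simp
    finally show ?thesis using weight_pos[OF \<sigma> a m_pos] by (simp add: field_simps)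
  qed
  have outer: "2 / sqrt a \<le> K q \<nu>" if q: "good q \<nu>" and a: "0 < a" and sh: "\<tau>o\<^sup>2 \<le> shear (eta_branch 1 (2 * m / a))" for q \<nu> a
  proof -
    have ev: "\<forall>\<^sub>F s in at_right 0. q + of_real s * \<nu> \<in> E \<inter> \<Omega> - M" using q by (simp add: good_def)
    have comp: "weight 1 a (m - u z) * (cmod (g z - cnj z))\<^sup>2 \<le> excess 1 a (m - u z)" if "z \<in> E \<inter> \<Omega> - M" for z
    proof (rule gradient_comparison[of 1 a "E \<inter> \<Omega> - M" \<Gamma>o])
      show "open (E \<inter> \<Omega> - M)" using BE(2) open_dom closed_M by (intro open_Diff open_Int)
      show "closure (E \<inter> \<Omega> - M) \<subseteq> (E \<inter> \<Omega> - M) \<union> M \<union> \<Gamma>o"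
      proof
        fix z assume "z \<in> closure (E \<inter> \<Omega> - M)"
        then have "z \<in> closure E" "z \<in> closure \<Omega>" by (meson closure_mono Diff_subset Int_lower1 Int_lower2 subsetD order_trans)+
        then show "z \<in> (E \<inter> \<Omega> - M) \<union> M \<union> \<Gamma>o"
          using BE(4,5,7) ridge_subset closure_cases[of z] frontier_eq by blast
      qed
      show "weight 1 a m * (G z)\<^sup>2 \<le> excess 1 a m" if "z \<in> \<Gamma>o" for z
        by (rule bd[OF _ a sh \<tau>o(1) Go[OF that]]) simp
    qed (use a that frontier_eq in auto)
    have "2 * 1 / sqrt a \<le> Re (deriv (deriv g) q * \<nu> ^ 3)"
    proof (rule normal_third_derivative_bound[OF _ a _ _ norm\<nu>[OF q]])
      show "\<forall>\<^sub>F s in at_right 0. weight 1 a (m - u (q + of_real s * \<nu>)) *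
          (cmod (g (q + of_real s * \<nu>) - cnj (q + of_real s * \<nu>)))\<^sup>2 \<le> excess 1 a (m - u (q + of_real s * \<nu>))"
        using ev by eventually_elim (rule comp)
      show "\<forall>\<^sub>F s in at_right 0. q + of_real s * \<nu> \<in> \<Omega> - M" using ev by eventually_elim blast
    qed (use q in \<open>auto simp: good_def\<close>)
    then show ?thesis by (simp add: K_def)
  qed
  have inner: "K q \<nu> \<le> 2 / sqrt a" if q: "good q \<nu>" and a: "0 < a" and sh: "\<tau>i\<^sup>2 \<le> shear (eta_branch (-1) (2 * m / a))" for q \<nu> a
  proof -
    have ev: "\<forall>\<^sub>F s in at_right 0. q + of_real s * - \<nu> \<in> B \<inter> \<Omega> - M" using q by (simp add: good_def)
    have comp: "weight (-1) a (m - u z) * (cmod (g z - cnj z))\<^sup>2 \<le> excess (-1) a (m - u z)" if "z \<in> B \<inter> \<Omega> - M" for z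
    proof (rule gradient_comparison[of "-1" a "B \<inter> \<Omega> - M" \<Gamma>i])
      show "open (B \<inter> \<Omega> - M)" using BE(1) open_dom closed_M by (intro open_Diff open_Int)
      show "closure (B \<inter> \<Omega> - M) \<subseteq> (B \<inter> \<Omega> - M) \<union> M \<union> \<Gamma>i"
      proof
        fix z assume "z \<in> closure (B \<inter> \<Omega> - M)"
        then have "z \<in> closure B" "z \<in> closure \<Omega>" by (meson closure_mono Diff_subset Int_lower1 Int_lower2 subsetD order_trans)+
        then show "z \<in> (B \<inter> \<Omega> - M) \<union> M \<union> \<Gamma>i"
          using BE(3,6,7) ridge_subset closure_cases[of z] frontier_eq by blast
      qed
      show "weight (-1) a m * (G z)\<^sup>2 \<le> excess (-1) a m" if "z \<in> \<Gamma>i" for z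
        by (rule bd[OF _ a sh \<tau>i Gi[OF that]]) simp
    qed (use a that frontier_eq in auto)
    \<comment> \<open>The inner region lies in direction \<open>- \<nu>\<close>; the odd power turns
      this lower bound into an upper bound for \<open>K q \<nu>\<close>.\<close>
    have "2 * - 1 / sqrt a \<le> Re (deriv (deriv g) q * (- \<nu>) ^ 3)"
    proof (rule normal_third_derivative_bound[OF _ a])
      show "\<forall>\<^sub>F s in at_right 0. weight (-1) a (m - u (q + of_real s * - \<nu>)) *
          (cmod (g (q + of_real s * - \<nu>) - cnj (q + of_real s * - \<nu>)))\<^sup>2 \<le> excess (-1) a (m - u (q + of_real s * - \<nu>))"
        using ev by eventually_elim (rule comp)
      show "\<forall>\<^sub>F s in at_right 0. q + of_real s * - \<nu> \<in> \<Omega> - M" using ev by eventually_elim blast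
    qed (use q norm\<nu>[OF q] in \<open>auto simp: good_def\<close>)
    then show ?thesis by (simp add: K_def)
  qed
  have pVM: "p \<in> V \<inter> M" using V(2) ridge_subset by blast
  have good_ex: "\<exists>\<nu>. good q \<nu>" if "q \<in> V \<inter> M" for q
    using ts[OF that] that unfolding good_def two_sided_def by blast
  then obtain \<nu> where p: "good p \<nu>" using pVM by blast
  have xout: "1 < eta_branch 1 (2 * m / a)" if "0 < a" for a
    using eta_branch(2)[of 1 "2 * m / a"] that m_pos by simp
  have xin: "0 < eta_branch (-1) (2 * m / a)" "eta_branch (-1) (2 * m / a) < 1" if "0 < a" for a
    using eta_branch(1,2)[of "-1" "2 * m / a"] that m_pos by auto
  show \<tau>o1: "1 < \<tau>o"
  proof (rule ccontr)
    assume "\<not> 1 < \<tau>o"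
    then have "\<tau>o\<^sup>2 \<le> 1" using \<tau>o(1) by (simp add: power_le_one)
    then have "\<tau>o\<^sup>2 \<le> shear (eta_branch 1 (2 * m / a))" if "0 < a" for a
      using shear_gt_one[OF xout[OF that]] by simp
    then have *: "2 / sqrt a \<le> K p \<nu>" if "0 < a" for a using outer[OF p] that by blast
    \<comment> \<open>With \<open>a = t\<^sup>2\<close> the lower bound becomes
      \<open>2 * (\<bar>K p \<nu>\<bar> + 1)\<close>.\<close>
    define t where "t = 1 / (\<bar>K p \<nu>\<bar> + 1)"
    have "0 < t" by (simp add: t_def add_nonneg_pos)
    then have "2 / t \<le> K p \<nu>" using *[of "t\<^sup>2"] by simp
    then show False by (simp add: t_def)
  qed
  obtain Xo where Xo: "1 < Xo" "shear Xo = \<tau>o\<^sup>2"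
  proof (rule shear_surj_outer[of "\<tau>o\<^sup>2"])
    show "1 < \<tau>o\<^sup>2" using \<tau>o1 by simp
    show "\<tau>o\<^sup>2 < 2" using \<tau>o power_strict_mono[of \<tau>o "sqrt 2" 2] by simp
  qed
  have branch_o: "eta_branch 1 (2 * m / (2 * m / eta x)) = x" if "1 < x" for x
    using eta_branch_unique[of 1 x] that m_pos eta_pos[of x] by simp
  have branch_i: "eta_branch (-1) (2 * m / (2 * m / eta x)) = x" if "0 < x" "x < 1" for x
    using eta_branch_unique[of "-1" x] that m_pos eta_pos[of x] by simp
  have ap: "0 < 2 * m / eta x" if "0 < x" "x \<noteq> 1" for x using that m_pos eta_pos[of x] by simp
  have K_ge: "2 / sqrt (2 * m / eta x) \<le> K q \<nu>" if "1 < x" "shear x = \<tau>o\<^sup>2" "good q \<nu>" for x q \<nu>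
    using outer[OF that(3) ap[of x]] branch_o[of x] that by simp
  have K_le: "K q \<nu> \<le> 2 / sqrt (2 * m / eta x)" if "0 < x" "x < 1" "shear x = \<tau>i\<^sup>2" "good q \<nu>" for x q \<nu>
    using inner[OF that(4) ap[of x]] branch_i[of x] that by simp
  have Kp: "0 < K p \<nu>" using K_ge[OF Xo p] ap[of Xo] Xo(1)
    by (smt (verit) divide_pos_pos real_sqrt_gt_zero)
  show "sqrt 2 < \<tau>i"
  proof (rule ccontr)
    assume "\<not> sqrt 2 < \<tau>i"
    then have "\<tau>i\<^sup>2 \<le> (sqrt 2)\<^sup>2" using \<tau>i by (intro power_mono) auto
    then have "\<tau>i\<^sup>2 \<le> shear (eta_branch (-1) (2 * m / a))" if "0 < a" for a
      using shear_gt_two[OF xin[OF that]] by simp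
    then have "K p \<nu> \<le> 2 / sqrt a" if "0 < a" for a using inner[OF p] that by blast
    \<comment> \<open>For this \<open>a\<close> the upper bound equals
      \<open>K p \<nu> / 2\<close>.\<close>
    from this[of "(4 / K p \<nu>)\<^sup>2"] show False using Kp by simp
  qed
  have sqrt_le: "eta xo \<le> eta xi" if x: "1 < xo" "0 < xi" "xi < 1" "2 / sqrt (2 * m / eta xo) \<le> 2 / sqrt (2 * m / eta xi)" for xo xi
  proof -
    have "sqrt (2 * m / eta xi) \<le> sqrt (2 * m / eta xo)"
      using x ap[of xo] ap[of xi] by (simp add: field_simps)
    then show ?thesis using m_pos eta_pos[of xo] eta_pos[of xi] x by (simp add: field_simps)
  qed
  show "eta xo \<le> eta xi" if x: "1 < xo" "shear xo = \<tau>o\<^sup>2" "0 < xi" "xi < 1" "shear xi = \<tau>i\<^sup>2" for xo xi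
    using sqrt_le[OF x(1,3,4)] K_ge[OF x(1,2) p] K_le[OF x(3-5) p] by linarith
  show "\<exists>z0 a. 0 < a \<and> eta xo = 2 * m / a \<and>
         \<Omega> = {z. sqrt (a * xi) < cmod (z - z0) \<and> cmod (z - z0) < sqrt (a * xo)} \<and>
         (\<forall>z\<in>closure \<Omega>. u z = m - a / 2 * eta ((cmod (z - z0))\<^sup>2 / a))"
    if x: "1 < xo" "shear xo = \<tau>o\<^sup>2" "0 < xi" "xi < 1" "shear xi = \<tau>i\<^sup>2" and eq: "eta xo = eta xi" for xo xi
  proof -
    define a where "a = 2 * m / eta xo"
    have a: "0 < a" using ap[of xo] x by (simp add: a_def)
    have e: "eta xo = 2 * m / a" using a m_pos eta_pos[of xo] x(1) by (simp add: a_def)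
    have "\<exists>\<nu>. \<nu>\<^sup>2 * deriv g q = -1 \<and> Re (deriv (deriv g) q * \<nu> ^ 3) = 2 / sqrt a" if q: "q \<in> V \<inter> M" for q
    proof -
      obtain \<nu> where "good q \<nu>" using good_ex[OF q] by blast
      then have "K q \<nu> = 2 / sqrt a"
        using K_ge[OF x(1,2)] K_le[OF x(3-5)] eq by (intro antisym) (auto simp: a_def)
      then show ?thesis using \<open>good q \<nu>\<close> by (auto simp: K_def good_def)
    qed
    then obtain z0 where z0: "\<And>z. z \<in> \<Omega> \<Longrightarrow> (g z - cnj z0) * (z - z0) = of_real a"
      using constant_curvature_rigidity[OF a V] by blast
    show ?thesis
      using radial_solution[OF a z0 x(3,4,1)] e eq a by (intro exI[of _ z0] exI[of _ a]) auto
  qed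
qed

end


section \<open>Transfer from the real plane\<close>

lemma derivative_along_line:
  fixes f :: "'a::euclidean_space \<Rightarrow> real"
  assumes "f differentiable_on S" "open S" "x + t *\<^sub>R a \<in> S"
  shows "((\<lambda>t. f (x + t *\<^sub>R a)) has_real_derivative frechet_derivative f (at (x + t *\<^sub>R a)) a) (at t)"
proof -
  have "f differentiable (at (x + t *\<^sub>R a))"
    using assms by (simp add: differentiable_on_eq_differentiable_at)
  then have D: "(f has_derivative frechet_derivative f (at (x + t *\<^sub>R a))) (at (x + t *\<^sub>R a))"
    by (simp add: frechet_derivative_works)
  have "((\<lambda>t. x + t *\<^sub>R a) has_derivative (\<lambda>h. h *\<^sub>R a)) (at t)"
    by (auto intro!: derivative_eq_intros)
  from has_derivative_compose[OF this D] show ?thesis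
    using linear_scale[OF has_derivative_linear[OF D]]
    by (simp add: has_field_derivative_def mult_commute_abs)
qed

text \<open>The second difference over a parallelogram is evaluated by two mean value theorems,
  first in direction \<open>a\<close> and then in direction \<open>b\<close>.\<close>

lemma symmetric_second_derivative_aux:
  fixes f :: "'a::euclidean_space \<Rightarrow> real"
  assumes S: "open S" and f: "f differentiable_on S"
    and P: "(\<lambda>y. frechet_derivative f (at y) a) differentiable_on S"
    and h: "0 < h" and sub: "\<And>s t. 0 \<le> s \<Longrightarrow> s \<le> h \<Longrightarrow> 0 \<le> t \<Longrightarrow> t \<le> h \<Longrightarrow> x + s *\<^sub>R a + t *\<^sub>R b \<in> S"
  shows "\<exists>s t. 0 < s \<and> s < h \<and> 0 < t \<and> t < h \<and>
    f (x + h *\<^sub>R a + h *\<^sub>R b) - f (x + h *\<^sub>R a) - f (x + h *\<^sub>R b) + f x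
      = h\<^sup>2 * frechet_derivative (\<lambda>y. frechet_derivative f (at y) a) (at (x + s *\<^sub>R a + t *\<^sub>R b)) b"
proof -
  define P where "P y = frechet_derivative f (at y) a" for y
  define F where "F t = f ((x + h *\<^sub>R b) + t *\<^sub>R a) - f (x + t *\<^sub>R a)" for t
  have dF: "(F has_real_derivative P ((x + h *\<^sub>R b) + t *\<^sub>R a) - P (x + t *\<^sub>R a)) (at t)" if "0 \<le> t" "t \<le> h" for t
    unfolding F_def P_def using sub[of t h] sub[of t 0] that h
    by (intro DERIV_diff derivative_along_line[OF f S]) (simp_all add: algebra_simps)
  obtain s where s: "0 < s" "s < h" "F h - F 0 = (h - 0) * (P ((x + h *\<^sub>R b) + s *\<^sub>R a) - P (x + s *\<^sub>R a))"
    using MVT2[OF h dF] by auto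
  have dP: "((\<lambda>t. P ((x + s *\<^sub>R a) + t *\<^sub>R b)) has_real_derivative frechet_derivative P (at ((x + s *\<^sub>R a) + t *\<^sub>R b)) b) (at t)"
    if "0 \<le> t" "t \<le> h" for t
    using sub[of s t] that s P unfolding P_def[symmetric] by (intro derivative_along_line[OF _ S]) auto
  obtain t where t: "0 < t" "t < h"
    "P ((x + s *\<^sub>R a) + h *\<^sub>R b) - P ((x + s *\<^sub>R a) + 0 *\<^sub>R b) = (h - 0) * frechet_derivative P (at ((x + s *\<^sub>R a) + t *\<^sub>R b)) b"
    using MVT2[OF h dP] by auto
  have "P ((x + h *\<^sub>R b) + s *\<^sub>R a) - P (x + s *\<^sub>R a) = h * frechet_derivative P (at (x + s *\<^sub>R a + t *\<^sub>R b)) b"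
    using t(3) by (simp add: add.assoc add.commute[of "h *\<^sub>R b"])
  then have "F h - F 0 = h\<^sup>2 * frechet_derivative P (at (x + s *\<^sub>R a + t *\<^sub>R b)) b"
    using s(3) by (simp add: power2_eq_square)
  moreover have "F h - F 0 = f (x + h *\<^sub>R a + h *\<^sub>R b) - f (x + h *\<^sub>R a) - f (x + h *\<^sub>R b) + f x"
    by (simp add: F_def algebra_simps)
  ultimately show ?thesis using s t unfolding P_def by metis
qed

text \<open>The second difference does not depend on the order of the two directions. So the two
  mixed derivatives agree at two points of an arbitrarily small parallelogram, hence by continuity
  at \<open>x\<close>. This supplies one of the Cauchy-Riemann equations for
  \<open>analytic_gradient\<close>.\<close>

lemma symmetric_second_derivative:
  fixes f :: "'a::euclidean_space \<Rightarrow> real"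
  assumes S: "open S" "x \<in> S" and f: "f differentiable_on S"
    and P: "(\<lambda>y. frechet_derivative f (at y) a) differentiable_on S"
    and Q: "(\<lambda>y. frechet_derivative f (at y) b) differentiable_on S"
    and cP: "continuous_on S (\<lambda>y. frechet_derivative (\<lambda>y. frechet_derivative f (at y) a) (at y) b)"
    and cQ: "continuous_on S (\<lambda>y. frechet_derivative (\<lambda>y. frechet_derivative f (at y) b) (at y) a)"
  shows "frechet_derivative (\<lambda>y. frechet_derivative f (at y) a) (at x) b
       = frechet_derivative (\<lambda>y. frechet_derivative f (at y) b) (at x) a"
proof (rule ccontr)
  define A where "A y = frechet_derivative (\<lambda>y. frechet_derivative f (at y) a) (at y) b" for y
  define B where "B y = frechet_derivative (\<lambda>y. frechet_derivative f (at y) b) (at y) a" for y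
  assume "\<not> ?thesis"
  then have e: "0 < \<bar>A x - B x\<bar> / 2" (is "0 < ?e") by (simp add: A_def B_def)
  have "isCont A x" "isCont B x"
    using cP cQ S continuous_on_eq_continuous_at unfolding A_def[abs_def] B_def[abs_def] by blast+
  then obtain d1 d2 where d: "0 < d1" "\<And>y. dist y x < d1 \<Longrightarrow> dist (A y) (A x) < ?e"
    "0 < d2" "\<And>y. dist y x < d2 \<Longrightarrow> dist (B y) (B x) < ?e"
    using e unfolding continuous_at_eps_delta by (metis dist_commute)
  obtain d3 where d3: "0 < d3" "ball x d3 \<subseteq> S" using S open_contains_ball by blast
  define d where "d = min (min d1 d2) d3"
  define h where "h = d / (norm a + norm b + 1)"
  have d0: "0 < d" using d d3 by (simp add: d_def)
  have n: "0 < norm a + norm b + 1" by (simp add: add_nonneg_pos)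
  have h: "0 < h" using d0 n by (simp add: h_def)
  have near: "dist (x + s *\<^sub>R a + t *\<^sub>R b) x < d" if "0 \<le> s" "s \<le> h" "0 \<le> t" "t \<le> h" for s t
  proof -
    have "norm (s *\<^sub>R a + t *\<^sub>R b) \<le> h * norm a + h * norm b"
      using that by (intro order_trans[OF norm_triangle_ineq] add_mono) (auto intro: mult_right_mono)
    also have "\<dots> < h * (norm a + norm b + 1)" using h by (simp add: algebra_simps)
    also have "\<dots> = d" using n by (simp add: h_def)
    finally show ?thesis by (simp add: dist_norm add.assoc)
  qed
  have sub: "x + s *\<^sub>R a + t *\<^sub>R b \<in> S" if "0 \<le> s" "s \<le> h" "0 \<le> t" "t \<le> h" for s t
    using near[OF that] d3 by (auto simp: d_def dist_commute)
  have sub': "x + s *\<^sub>R b + t *\<^sub>R a \<in> S" if "0 \<le> s" "s \<le> h" "0 \<le> t" "t \<le> h" for s t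
    using sub[OF that(3,4,1,2)] by (simp add: add.assoc add.commute[of "s *\<^sub>R b"])
  obtain s t where st: "0 < s" "s < h" "0 < t" "t < h"
    "f (x + h *\<^sub>R a + h *\<^sub>R b) - f (x + h *\<^sub>R a) - f (x + h *\<^sub>R b) + f x = h\<^sup>2 * A (x + s *\<^sub>R a + t *\<^sub>R b)"
    using symmetric_second_derivative_aux[OF S(1) f P h sub] unfolding A_def by blast
  obtain s' t' where st': "0 < s'" "s' < h" "0 < t'" "t' < h"
    "f (x + h *\<^sub>R b + h *\<^sub>R a) - f (x + h *\<^sub>R b) - f (x + h *\<^sub>R a) + f x = h\<^sup>2 * B (x + s' *\<^sub>R b + t' *\<^sub>R a)"
    using symmetric_second_derivative_aux[OF S(1) f Q h sub'] unfolding B_def by blast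
  have "f (x + h *\<^sub>R b + h *\<^sub>R a) = f (x + h *\<^sub>R a + h *\<^sub>R b)" by (simp add: algebra_simps)
  then have "h\<^sup>2 * A (x + s *\<^sub>R a + t *\<^sub>R b) = h\<^sup>2 * B (x + s' *\<^sub>R b + t' *\<^sub>R a)" using st(5) st'(5) by linarith
  then have AB: "A (x + s *\<^sub>R a + t *\<^sub>R b) = B (x + s' *\<^sub>R b + t' *\<^sub>R a)" using h by simp
  have "dist (A (x + s *\<^sub>R a + t *\<^sub>R b)) (A x) < ?e"
    using near[of s t] st d(2) by (simp add: d_def)
  moreover have "dist (B (x + s' *\<^sub>R b + t' *\<^sub>R a)) (B x) < ?e"
    using near[of t' s'] st' d(4) by (simp add: d_def add.assoc add.commute[of "s' *\<^sub>R b"])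
  moreover have "\<bar>A x - B x\<bar> \<le> \<bar>y - A x\<bar> + \<bar>y - B x\<bar>" for y by linarith
  ultimately show False unfolding AB dist_real_def by (metis add_strict_mono field_sum_of_halves not_le)
qed

section \<open>Identification of the real plane with the complex plane\<close>

definition to_complex :: "real^2 \<Rightarrow> complex" where "to_complex x = Complex (x $ 1) (x $ 2)"

definition of_complex :: "complex \<Rightarrow> real^2" where
  "of_complex z = Re z *\<^sub>R axis 1 1 + Im z *\<^sub>R axis 2 1"

lemma of_complex_nth [simp]: "of_complex z $ 1 = Re z" "of_complex z $ 2 = Im z"
  by (simp_all add: of_complex_def axis_def)

lemma to_of_complex [simp]: "to_complex (of_complex z) = z" "of_complex (to_complex x) = x"
  by (simp_all add: to_complex_def vec_eq_iff forall_2)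

lemma norm_to_complex [simp]: "cmod (to_complex x) = norm x" "norm (of_complex z) = cmod z"
  by (simp_all add: to_complex_def cmod_def norm_vec_def L2_set_def sum_2)

lemma linear_to_complex: "linear to_complex" "linear of_complex"
  by (auto intro!: linearI simp: to_complex_def of_complex_def complex_eq_iff algebra_simps)

lemma bounded_linear_to_complex: "bounded_linear to_complex" "bounded_linear of_complex"
  using linear_to_complex linear_conv_bounded_linear by blast+

lemma continuous_to_complex: "continuous_on S to_complex" "continuous_on T of_complex"
  using bounded_linear_to_complex linear_continuous_on by blast+

lemma bij_to_complex: "bij to_complex"
  by (rule bij_betw_byWitness[of _ of_complex]) auto

lemma to_complex_image: "to_complex ` S = of_complex -` S"
  by (auto simp: image_iff intro!: bexI[of _ "of_complex _"])

lemma mem_to_complex_image [simp]: "z \<in> to_complex ` S \<longleftrightarrow> of_complex z \<in> S"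
  by (simp add: to_complex_image)

lemma closure_to_complex: "closure (to_complex ` S) = to_complex ` closure S"
  using closure_injective_linear_image[OF linear_to_complex(1) bij_is_inj[OF bij_to_complex]] by simp

lemma frontier_to_complex: "frontier (to_complex ` S) = to_complex ` frontier S"
proof -
  have "- to_complex ` S = to_complex ` (- S)" by (rule bij_image_Compl_eq[OF bij_to_complex, symmetric])
  then show ?thesis
    unfolding frontier_closures closure_to_complex
    using image_Int[OF bij_is_inj[OF bij_to_complex]] by (simp add: closure_to_complex)
qed

lemma Basis_real2: "(Basis :: (real^2) set) = {axis 1 1, axis 2 1}"
  by (auto simp: Basis_vec_def UNIV_2)

lemma sum_Basis_real2: "(\<Sum>b\<in>(Basis :: (real^2) set). f b) = f (axis 1 1) + f (axis 2 1)"
  by (simp add: Basis_real2 axis_eq_axis)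

section \<open>Topology of ring-shaped domains\<close>

lemma ring_boundary:
  assumes "ring_shaped_domain \<Omega> \<Gamma>i \<Gamma>o"
  shows "frontier \<Omega> = \<Gamma>i \<union> \<Gamma>o" "connected \<Gamma>i" "connected \<Gamma>o" "\<Gamma>i \<noteq> {}" "\<Gamma>o \<noteq> {}"
    "compact \<Gamma>i" "compact \<Gamma>o" "\<Gamma>i \<inter> \<Gamma>o = {}"
proof -
  have c: "\<Gamma>i \<in> components (frontier \<Omega>)" "\<Gamma>o \<in> components (frontier \<Omega>)"
    and eq: "components (frontier \<Omega>) = {\<Gamma>i, \<Gamma>o}" and ne: "\<Gamma>i \<noteq> \<Gamma>o" and "bounded \<Omega>"
    using assms by (auto simp: ring_shaped_domain_def)
  show "frontier \<Omega> = \<Gamma>i \<union> \<Gamma>o" using Union_components[of "frontier \<Omega>"] eq by auto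
  show "connected \<Gamma>i" "connected \<Gamma>o" "\<Gamma>i \<noteq> {}" "\<Gamma>o \<noteq> {}"
    using c in_components_connected in_components_nonempty by blast+
  show "\<Gamma>i \<inter> \<Gamma>o = {}" using components_nonoverlap[OF c] ne by simp
  have "compact (frontier \<Omega>)" using \<open>bounded \<Omega>\<close> by (rule compact_frontier_bounded)
  then show "compact \<Gamma>i" "compact \<Gamma>o" using c compact_components by blast+
qed

text \<open>The domain is connected, misses the outer component and comes close to the inner one,
  which lies inside the outer one; so the whole domain lies inside. An unbounded connected set
  avoiding the outer component has no point inside.\<close>

lemma ring_outer_encloses:
  assumes ring: "ring_shaped_domain \<Omega> \<Gamma>i \<Gamma>o" and D: "connected D" "\<not> bounded D" "D \<inter> \<Gamma>o = {}"
  shows "D \<inter> \<Omega> = {}"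
proof -
  note b = ring_boundary[OF ring]
  have r: "open \<Omega>" "connected \<Omega>" "\<Gamma>i \<subseteq> inside \<Gamma>o" using ring by (auto simp: ring_shaped_domain_def)
  have cl: "closed \<Gamma>o" using b(7) by (rule compact_imp_closed)
  obtain q where "q \<in> \<Gamma>i" using b(4) by blast
  then have "q \<in> closure \<Omega>" "q \<in> inside \<Gamma>o" using b(1) r(3) by (auto simp: frontier_def)
  then have meet: "\<Omega> \<inter> inside \<Gamma>o \<noteq> {}"
    using open_inside[OF cl] by (metis Int_commute disjoint_iff open_Int_closure_eq_empty)
  have "\<Omega> \<inter> \<Gamma>o = {}" using b(1) r(1) by (auto simp: frontier_def interior_open)
  then have "\<Omega> \<subseteq> inside \<Gamma>o \<union> outside \<Gamma>o" using inside_Un_outside[of \<Gamma>o] by blast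
  then have "\<Omega> \<inter> outside \<Gamma>o = {}"
    using connectedD[OF r(2) open_inside[OF cl] open_outside[OF cl]] meet inside_Int_outside[of \<Gamma>o] by blast
  then have "\<Omega> \<subseteq> inside \<Gamma>o" using \<open>\<Omega> \<subseteq> inside \<Gamma>o \<union> outside \<Gamma>o\<close> by blast
  moreover have "D \<inter> inside \<Gamma>o = {}"
  proof (rule ccontr)
    assume "D \<inter> inside \<Gamma>o \<noteq> {}"
    then obtain x where x: "x \<in> D" "bounded (connected_component_set (- \<Gamma>o) x)" by (auto simp: inside_def)
    have "D \<subseteq> connected_component_set (- \<Gamma>o) x"
      using x(1) D by (intro connected_component_maximal) auto
    then show False using x(2) D(2) bounded_subset by blast
  qed
  ultimately show ?thesis by blast
qed

definition analytic_gradient :: "(real^2 \<Rightarrow> real) \<Rightarrow> complex \<Rightarrow> complex" where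
  "analytic_gradient u z = Complex (frechet_derivative u (at (of_complex z)) (axis 1 1))
      (- frechet_derivative u (at (of_complex z)) (axis 2 1)) + cnj z"

text \<open>The function \<open>u + |z|\<^sup>2 / 2\<close> is harmonic. Of the Cauchy-Riemann
  equations for its complex gradient, one is the equation for the Laplacian and the other the
  symmetry of the mixed derivatives.\<close>

lemma analytic_gradient_holomorphic:
  assumes "open \<Omega>" and sol: "torsion_solution \<Omega> u"
  shows "analytic_gradient u holomorphic_on to_complex ` \<Omega>"
proof -
  define P where "P x = frechet_derivative u (at x) (axis 1 1)" for x
  define Q where "Q x = frechet_derivative u (at x) (axis 2 1)" for x
  have C2: "Ck_on (Suc (Suc 0)) u \<Omega>" using sol by (simp add: torsion_solution_def numeral_2_eq_2)
  then have f: "u differentiable_on \<Omega>"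
    and d: "\<And>v. (\<lambda>x. frechet_derivative u (at x) v) differentiable_on \<Omega>"
    and c: "\<And>v w. continuous_on \<Omega> (\<lambda>x. frechet_derivative (\<lambda>x. frechet_derivative u (at x) v) (at x) w)"
    by auto
  have open': "open (to_complex ` \<Omega>)"
    unfolding to_complex_image using assms(1) continuous_to_complex(2)[of UNIV] by (auto intro: open_vimage)
  show ?thesis
  proof (rule holomorphic_onI)
    fix z assume "z \<in> to_complex ` \<Omega>"
    then have x: "of_complex z \<in> \<Omega>" by simp
    define A B D where "A = frechet_derivative P (at (of_complex z)) (axis 1 1)"
      and "B = frechet_derivative P (at (of_complex z)) (axis 2 1)"
      and "D = frechet_derivative Q (at (of_complex z)) (axis 2 1)"
    have sym: "frechet_derivative Q (at (of_complex z)) (axis 1 1) = B"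
      unfolding B_def P_def[abs_def] Q_def[abs_def]
      by (rule symmetric_second_derivative[OF assms(1) x f d d c c, symmetric])
    have "laplacian u (of_complex z) = -2" using sol x by (simp add: torsion_solution_def)
    then have lap: "D = -2 - A"
      by (simp add: laplacian_def sum_Basis_real2 A_def D_def P_def[abs_def] Q_def[abs_def])
    have der: "(P has_derivative frechet_derivative P (at (of_complex z))) (at (of_complex z))"
      "(Q has_derivative frechet_derivative Q (at (of_complex z))) (at (of_complex z))"
      using d[of "axis 1 1"] d[of "axis 2 1"] x assms(1) unfolding P_def[abs_def] Q_def[abs_def]
      by (simp_all add: differentiable_on_eq_differentiable_at flip: frechet_derivative_works)
    have lin: "L (of_complex h) = Re h * L (axis 1 1) + Im h * L (axis 2 1)" if "linear L" for L :: "real^2 \<Rightarrow> real" and h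
      using that by (simp add: of_complex_def linear_add linear_scale)
    have "((\<lambda>z. P (of_complex z)) has_derivative (\<lambda>h. Re h * A + Im h * B)) (at z)"
      using has_derivative_compose[OF bounded_linear_imp_has_derivative[OF bounded_linear_to_complex(2)] der(1)]
      by (simp add: lin[OF has_derivative_linear[OF der(1)]] A_def B_def)
    moreover have "((\<lambda>z. Q (of_complex z)) has_derivative (\<lambda>h. Re h * B + Im h * D)) (at z)"
      using has_derivative_compose[OF bounded_linear_imp_has_derivative[OF bounded_linear_to_complex(2)] der(2)]
      by (simp add: lin[OF has_derivative_linear[OF der(2)]] sym D_def)
    ultimately have "((\<lambda>z. of_real (P (of_complex z)) - \<i> * of_real (Q (of_complex z)) + cnj z) has_derivative
        (\<lambda>h. of_real (Re h * A + Im h * B) - \<i> * of_real (Re h * B + Im h * D) + cnj h)) (at z)"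
      by (intro has_derivative_add has_derivative_diff has_derivative_mult_right has_derivative_of_real
          bounded_linear_imp_has_derivative[OF bounded_linear_cnj])
    moreover have "(\<lambda>h. of_real (Re h * A + Im h * B) - \<i> * of_real (Re h * B + Im h * D) + cnj h) = (*) (Complex (A + 1) (- B))"
      by (auto simp: fun_eq_iff complex_eq_iff lap algebra_simps)
    moreover have "(\<lambda>z. of_real (P (of_complex z)) - \<i> * of_real (Q (of_complex z)) + cnj z) = analytic_gradient u"
      by (auto simp: fun_eq_iff complex_eq_iff analytic_gradient_def P_def Q_def)
    ultimately have "(analytic_gradient u has_field_derivative Complex (A + 1) (- B)) (at z)"
      by (simp add: has_field_derivative_def)
    then show "analytic_gradient u field_differentiable at z within to_complex ` \<Omega>"
      using field_differentiable_at_within field_differentiable_def by blast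
  qed
qed

lemma ring_torsion_transfer:
  assumes ring: "ring_shaped_domain \<Omega> \<Gamma>i \<Gamma>o" and sol: "torsion_solution \<Omega> u"
  shows "ring_torsion (to_complex ` \<Omega>) (\<lambda>z. u (of_complex z)) (analytic_gradient u)
    (\<lambda>z. norm (grad_within (closure \<Omega>) u (of_complex z))) (to_complex ` \<Gamma>i) (to_complex ` \<Gamma>o)"
proof
  note b = ring_boundary[OF ring]
  have r: "open \<Omega>" "connected \<Omega>" "\<Omega> \<noteq> {}" "bounded \<Omega>" using ring by (auto simp: ring_shaped_domain_def)
  show "open (to_complex ` \<Omega>)"
    unfolding to_complex_image using r(1) continuous_to_complex(2)[of UNIV] by (auto intro: open_vimage)
  show "connected (to_complex ` \<Omega>)" "connected (to_complex ` \<Gamma>i)" "connected (to_complex ` \<Gamma>o)"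
    using r(2) b(2,3) by (auto intro: connected_continuous_image continuous_to_complex)
  show "bounded (to_complex ` \<Omega>)" using r(4) bounded_linear_to_complex(1) by (rule bounded_linear_image)
  show "to_complex ` \<Omega> \<noteq> {}" "to_complex ` \<Gamma>i \<noteq> {}" "to_complex ` \<Gamma>o \<noteq> {}" using r(3) b(4,5) by auto
  show "analytic_gradient u holomorphic_on to_complex ` \<Omega>" by (rule analytic_gradient_holomorphic[OF r(1) sol])
  have diff: "u differentiable_on \<Omega>" using sol by (simp add: torsion_solution_def numeral_2_eq_2)
  show "((\<lambda>z. u (of_complex z)) has_derivative (\<lambda>h. Re ((analytic_gradient u z - cnj z) * h))) (at z)"
    if "z \<in> to_complex ` \<Omega>" for z
  proof -
    have x: "of_complex z \<in> \<Omega>" using that by simp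
    have der: "(u has_derivative frechet_derivative u (at (of_complex z))) (at (of_complex z))"
      using diff x r(1) by (simp add: differentiable_on_eq_differentiable_at flip: frechet_derivative_works)
    have "frechet_derivative u (at (of_complex z)) (of_complex h) = Re ((analytic_gradient u z - cnj z) * h)" for h
      using has_derivative_linear[OF der]
      by (simp add: of_complex_def[of h] linear_add linear_scale analytic_gradient_def)
    then show ?thesis
      using has_derivative_compose[OF bounded_linear_imp_has_derivative[OF bounded_linear_to_complex(2)] der] by simp
  qed
  have "continuous_on (closure \<Omega>) u"
    using sol by (simp add: torsion_solution_def differentiable_imp_continuous_on)
  then show "continuous_on (closure (to_complex ` \<Omega>)) (\<lambda>z. u (of_complex z))"
    unfolding closure_to_complex by (rule continuous_on_compose2[OF _ continuous_to_complex(2)]) auto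
  have "continuous_on (closure \<Omega>) (grad_within (closure \<Omega>) u)" using sol by (simp add: torsion_solution_def)
  then show "continuous_on (closure (to_complex ` \<Omega>)) (\<lambda>z. norm (grad_within (closure \<Omega>) u (of_complex z)))"
    unfolding closure_to_complex
    by (intro continuous_on_norm continuous_on_compose2[OF _ continuous_to_complex(2)]) auto
  show "u (of_complex z) = 0" if "z \<in> frontier (to_complex ` \<Omega>)" for z
    using that sol by (simp add: frontier_to_complex torsion_solution_def)
  show "norm (grad_within (closure \<Omega>) u (of_complex z)) = cmod (analytic_gradient u z - cnj z)"
    if "z \<in> to_complex ` \<Omega>" for z
  proof -
    have "of_complex z \<in> interior (closure \<Omega>)"
      using that r(1) closure_subset by (metis interior_maximal mem_to_complex_image subsetD)
    then have "at (of_complex z) within closure \<Omega> = at (of_complex z)" by (rule at_within_interior)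
    then have "grad_within (closure \<Omega>) u (of_complex z) = of_complex (cnj (analytic_gradient u z - cnj z))"
      by (simp add: grad_within_def sum_Basis_real2 of_complex_def analytic_gradient_def)
    then show ?thesis by (simp only: norm_to_complex complex_mod_cnj)
  qed
  show "frontier (to_complex ` \<Omega>) = to_complex ` \<Gamma>i \<union> to_complex ` \<Gamma>o"
    by (simp add: frontier_to_complex b(1) image_Un)
  show "D \<inter> to_complex ` \<Omega> = {}" if D: "connected D" "\<not> bounded D" "D \<inter> to_complex ` \<Gamma>o = {}" for D
  proof -
    have "connected (of_complex ` D)" using D(1) by (intro connected_continuous_image continuous_to_complex)
    moreover have "\<not> bounded (of_complex ` D)"
    proof
      assume "bounded (of_complex ` D)"
      then have "bounded (to_complex ` of_complex ` D)" using bounded_linear_to_complex(1) by (rule bounded_linear_image)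
      then show False using D(2) by (simp add: image_image)
    qed
    moreover have "of_complex ` D \<inter> \<Gamma>o = {}" using D(3) by fastforce
    ultimately have "of_complex ` D \<inter> \<Omega> = {}" by (rule ring_outer_encloses[OF ring])
    then show ?thesis by fastforce
  qed
qed


section \<open>NWSS of the model solutions\<close>

lemma r_inner_bounds:
  assumes "0 < R" "R < 1" shows "0 < r_inner R" "r_inner R < R"
    "eta ((r_inner R)\<^sup>2 / R\<^sup>2) = eta (1 / R\<^sup>2)"
proof -
  obtain y where y: "0 < y" "y < 1" "eta y = eta (1 / R\<^sup>2)"
    using eta_surj_inner[OF eta_pos[of "1 / R\<^sup>2"]] assms inv_square_gt_one[OF assms] by auto
  have r: "r_inner R = R * sqrt y" by (rule r_inner_eq[OF assms y])
  then show "0 < r_inner R" "r_inner R < R" using assms y by auto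
  show "eta ((r_inner R)\<^sup>2 / R\<^sup>2) = eta (1 / R\<^sup>2)"
    using assms y by (simp add: r power_mult_distrib)
qed

lemma model_solution_eq_eta:
  assumes "0 < R" "x \<noteq> 0"
  shows "model_solution R x = R\<^sup>2 / 2 * (eta (1 / R\<^sup>2) - eta ((norm x)\<^sup>2 / R\<^sup>2))"
  using assms by (simp add: model_solution_def eta_def ln_div ln_realpow field_simps)

text \<open>The boundary components are given only as the components of the frontier. They have to
  be identified with the two spheres by connectedness, and put in the right order by the condition
  that the inner one lies inside the outer one.\<close>

lemma model_NWSS:
  fixes \<Omega> \<Gamma>i \<Gamma>o :: "(real^2) set"
  assumes ring: "ring_shaped_domain \<Omega> \<Gamma>i \<Gamma>o" and sol: "torsion_solution \<Omega> u"
    and R: "0 < R" "R < 1" and eqv: "equivalent_pairs \<Omega> u (model_domain R) (model_solution R)"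
  shows "NWSS \<Omega> u \<Gamma>o = tau_outer R" "NWSS \<Omega> u \<Gamma>i = tau_inner R"
proof -
  obtain c s where s: "0 < s" and \<Omega>: "\<Omega> = (\<lambda>x. c + s *\<^sub>R x) ` model_domain R"
    and u: "\<And>x. x \<in> closure \<Omega> \<Longrightarrow> u x = s\<^sup>2 * model_solution R ((x - c) /\<^sub>R s)"
    using eqv unfolding equivalent_pairs_def by blast
  define r where "r = r_inner R"
  have r: "0 < r" "r < R" using r_inner_bounds[OF R] by (auto simp: r_def)
  have \<Omega>_iff: "y \<in> \<Omega> \<longleftrightarrow> s * r < norm (y - c) \<and> norm (y - c) < s" for y
  proof -
    have "y \<in> \<Omega> \<longleftrightarrow> (y - c) /\<^sub>R s \<in> model_domain R"
      unfolding \<Omega> using s by (auto intro!: image_eqI[of _ _ "(y - c) /\<^sub>R s"])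
    also have "\<dots> \<longleftrightarrow> s * r < norm (y - c) \<and> norm (y - c) < s"
    proof -
      have "norm ((y - c) /\<^sub>R s) = norm (y - c) / s" using s by (simp add: divide_inverse mult.commute)
      then show ?thesis
        unfolding model_domain_def mem_Collect_eq r_def
        using s by (simp add: pos_less_divide_eq pos_divide_less_eq mult.commute)
    qed
    finally show ?thesis .
  qed
  note b = ring_boundary[OF ring]
  have op: "open \<Omega>" and inside: "\<Gamma>i \<subseteq> inside \<Gamma>o" using ring by (auto simp: ring_shaped_domain_def)
  have sr: "0 < s * r" "s * r < s" using s r R by (auto simp: mult_less_cancel_left1)
  have fr_sub: "frontier \<Omega> \<subseteq> sphere c (s * r) \<union> sphere c s"
  proof
    fix y assume "y \<in> frontier \<Omega>"
    then have y: "y \<in> closure \<Omega>" "y \<notin> \<Omega>" using op by (auto simp: frontier_def interior_open)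
    have "closure \<Omega> \<subseteq> {y. s * r \<le> norm (y - c) \<and> norm (y - c) \<le> s}"
      by (intro closure_minimal closed_Collect_conj closed_Collect_le continuous_intros) (auto simp: \<Omega>_iff)
    then show "y \<in> sphere c (s * r) \<union> sphere c s" using y \<Omega>_iff[of y] by (auto simp: dist_norm norm_minus_commute)
  qed
  \<comment> \<open>A point of a sphere is approached along its own ray from the centre, with factor
    \<open>t\<close> tending to \<open>1\<close>. The set \<open>T\<close> keeps \<open>t\<close> on
    the side leading into the annulus: below \<open>1\<close> for the outer sphere, above
    \<open>1\<close> for the inner one.\<close>
  have radial: "y \<in> closure \<Omega>" if y: "norm (y - c) = \<rho>" "0 < \<rho>" and ev: "\<forall>\<^sub>F t in at 1 within T. s * r < t * \<rho> \<and> t * \<rho> < s"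
    and T: "at 1 within T \<noteq> bot" "T \<subseteq> {0..}" for y \<rho> T
  proof -
    have "((\<lambda>t. c + t *\<^sub>R (y - c)) \<longlongrightarrow> c + 1 *\<^sub>R (y - c)) (at 1 within T)" by (intro tendsto_intros)
    then have lim: "((\<lambda>t. c + t *\<^sub>R (y - c)) \<longlongrightarrow> y) (at 1 within T)" by simp
    have "\<forall>\<^sub>F t in at 1 within T. t \<in> T" by (simp add: eventually_at_topological) blast
    then have "\<forall>\<^sub>F t in at 1 within T. c + t *\<^sub>R (y - c) \<in> closure \<Omega>"
      using ev
    proof eventually_elim
      case (elim t)
      then have "0 \<le> t" using T(2) by auto
      then have "norm (c + t *\<^sub>R (y - c) - c) = t * \<rho>" using y(1) by simp
      then have "c + t *\<^sub>R (y - c) \<in> \<Omega>" unfolding \<Omega>_iff using elim by simp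
      then show ?case using closure_subset by blast
    qed
    then show ?thesis by (rule Lim_in_closed_set[OF closed_closure _ T(1) lim])
  qed
  have sph_o: "sphere c s \<subseteq> frontier \<Omega>"
  proof
    fix y assume y: "y \<in> sphere c s"
    have "\<forall>\<^sub>F t in at 1 within {r..1}. s * r < t * s \<and> t * s < s"
    proof -
      have "\<forall>\<^sub>F t in at 1 within {r..1}. r < t"
        using order_tendstoD(1)[OF tendsto_ident_at, of r 1 "{r..1}"] r R by simp
      moreover have "\<forall>\<^sub>F t in at 1 within {r..1}. t \<in> {r..1} \<and> t \<noteq> 1"
        by (simp add: eventually_at_filter)
      ultimately show ?thesis by eventually_elim (use s in \<open>auto simp: mult.commute\<close>)
    qed
    moreover have "at 1 within {r..1} \<noteq> bot"
      using r R by (simp add: trivial_limit_within islimpt_Icc)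
    ultimately have "y \<in> closure \<Omega>"
      using y s r by (intro radial[of y s "{r..1}"]) (auto simp: dist_norm norm_minus_commute)
    moreover have "y \<notin> \<Omega>" using y by (simp add: \<Omega>_iff dist_norm norm_minus_commute)
    ultimately show "y \<in> frontier \<Omega>" using op by (simp add: frontier_def interior_open)
  qed
  have sph_i: "sphere c (s * r) \<subseteq> frontier \<Omega>"
  proof
    fix y assume y: "y \<in> sphere c (s * r)"
    have r1: "1 < 1 / r" using r R by simp
    have "\<forall>\<^sub>F t in at 1 within {1..1 / r}. s * r < t * (s * r) \<and> t * (s * r) < s"
    proof -
      have "\<forall>\<^sub>F t in at 1 within {1..1 / r}. t < 1 / r"
        using order_tendstoD(2)[OF tendsto_ident_at, of 1 "1 / r" "{1..1 / r}"] r1 by simp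
      moreover have "\<forall>\<^sub>F t in at 1 within {1..1 / r}. t \<in> {1..1 / r} \<and> t \<noteq> 1"
        by (simp add: eventually_at_filter)
      ultimately show ?thesis
      proof eventually_elim
        case (elim t)
        have "t * r < 1" using elim(1) r by (simp add: field_simps)
        then have "s * (t * r) < s * 1" using s by (intro mult_strict_left_mono)
        moreover have "1 * (s * r) < t * (s * r)" using elim(2) sr by (intro mult_strict_right_mono) auto
        ultimately show ?case by (simp add: mult_ac)
      qed
    qed
    moreover have "at 1 within {1..1 / r} \<noteq> bot"
      using r1 by (simp add: trivial_limit_within islimpt_Icc)
    ultimately have "y \<in> closure \<Omega>"
      using y sr by (intro radial[of y "s * r" "{1..1 / r}"]) (auto simp: dist_norm norm_minus_commute)
    moreover have "y \<notin> \<Omega>" using y by (simp add: \<Omega>_iff dist_norm norm_minus_commute)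
    ultimately show "y \<in> frontier \<Omega>" using op by (simp add: frontier_def interior_open)
  qed
  have disj: "sphere c (s * r) \<inter> sphere c s = {}" using sr by auto
  have one: "\<Gamma> \<subseteq> sphere c (s * r) \<or> \<Gamma> \<subseteq> sphere c s" if "connected \<Gamma>" "\<Gamma> \<subseteq> frontier \<Omega>" for \<Gamma>
  proof -
    have "sphere c (s * r) \<inter> \<Gamma> = {} \<or> sphere c s \<inter> \<Gamma> = {}"
      using connected_closedD[OF that(1), of "sphere c (s * r)" "sphere c s"] disj that(2) fr_sub by auto
    then show ?thesis using that(2) fr_sub by blast
  qed
  have ne: "sphere c (s * r) \<noteq> {}" "sphere c s \<noteq> {}" using sr s by (auto simp: sphere_eq_empty)
  have not_swapped: "\<not> (\<Gamma>o \<subseteq> sphere c (s * r) \<and> \<Gamma>i \<subseteq> sphere c s)"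
  proof
    assume h: "\<Gamma>o \<subseteq> sphere c (s * r) \<and> \<Gamma>i \<subseteq> sphere c s"
    then have "\<Gamma>o \<subseteq> cball c (s * r)" by auto
    then have "- cball c (s * r) \<subseteq> outside \<Gamma>o" by (rule outside_subset_convex[OF convex_cball])
    then have "inside \<Gamma>o \<subseteq> cball c (s * r)" using inside_Int_outside[of \<Gamma>o] by blast
    moreover obtain y where "y \<in> \<Gamma>i" using b(4) by blast
    ultimately show False using inside h sr by force
  qed
  have io: "\<Gamma>i = sphere c (s * r) \<and> \<Gamma>o = sphere c s"
  proof -
    have cover: "sphere c (s * r) \<union> sphere c s = \<Gamma>i \<union> \<Gamma>o" using b(1) fr_sub sph_i sph_o by blast
    have i: "\<Gamma>i \<subseteq> sphere c (s * r) \<or> \<Gamma>i \<subseteq> sphere c s" using one[OF b(2)] b(1) by simp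
    have o: "\<Gamma>o \<subseteq> sphere c (s * r) \<or> \<Gamma>o \<subseteq> sphere c s" using one[OF b(3)] b(1) by simp
    define A B where "A = sphere c (s * r)" and "B = sphere c s"
    show ?thesis
      using cover i o not_swapped ne disj unfolding A_def[symmetric] B_def[symmetric] by blast
  qed
  define k where "k y = s\<^sup>2 * R\<^sup>2 / (norm (y - c))\<^sup>2 - 1" for y
  have grad: "norm (grad_within (closure \<Omega>) u y) = \<bar>k y\<bar> * norm (y - c)" if y: "y \<in> \<Omega>" for y
  proof -
    have n0: "0 < norm (y - c)" using y \<Omega>_iff sr by (meson less_trans)
    define w where "w y = s\<^sup>2 / 2 - ((y - c) \<bullet> (y - c)) / 2 + s\<^sup>2 * R\<^sup>2 / 2 * (ln ((y - c) \<bullet> (y - c)) - ln (s\<^sup>2))" for y :: "real^2"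
    have uw: "u y = w y" if "y \<in> \<Omega>" for y
    proof -
      have n: "0 < norm (y - c)" using that \<Omega>_iff sr by (meson less_trans)
      define d where "d = norm (y - c)"
      have d: "0 < d" "(y - c) \<bullet> (y - c) = d\<^sup>2" using n by (simp_all add: d_def power2_norm_eq_inner)
      have nrm: "norm ((y - c) /\<^sub>R s) = d / s" using s by (simp add: d_def divide_inverse mult.commute)
      have "u y = s\<^sup>2 * model_solution R ((y - c) /\<^sub>R s)" using that closure_subset by (intro u) blast
      also have "\<dots> = s\<^sup>2 * ((1 - (d / s)\<^sup>2) / 2 + R\<^sup>2 * ln (d / s))"
        unfolding model_solution_def nrm ..
      also have "\<dots> = s\<^sup>2 / 2 - d\<^sup>2 / 2 + s\<^sup>2 * R\<^sup>2 / 2 * (ln (d\<^sup>2) - ln (s\<^sup>2))"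
        using s d(1) by (simp add: ln_div ln_realpow field_simps)
      finally show ?thesis unfolding w_def d(2) .
    qed
    have "((\<lambda>y. (y - c) \<bullet> (y - c)) has_derivative (\<lambda>h. 2 * ((y - c) \<bullet> h))) (at y)"
      by (auto intro!: derivative_eq_intros simp: inner_commute)
    moreover have "((\<lambda>t. s\<^sup>2 / 2 - t / 2 + s\<^sup>2 * R\<^sup>2 / 2 * (ln t - ln (s\<^sup>2))) has_real_derivative k y / 2) (at ((y - c) \<bullet> (y - c)))"
      using n0 by (auto intro!: derivative_eq_intros simp: k_def power2_norm_eq_inner field_simps)
    ultimately have dw: "(w has_derivative (\<lambda>h. k y * ((y - c) \<bullet> h))) (at y)"
      unfolding w_def using has_derivative_compose[OF _ has_field_derivative_imp_has_derivative] by fastforce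
    have "(u has_derivative (\<lambda>h. k y * ((y - c) \<bullet> h))) (at y)"
      by (rule has_derivative_transform_within_open[OF dw op y]) (simp add: uw)
    moreover have "at y within closure \<Omega> = at y"
      using interior_maximal[OF closure_subset op] y by (intro at_within_interior) blast
    ultimately have "frechet_derivative u (at y within closure \<Omega>) = (\<lambda>h. k y * ((y - c) \<bullet> h))"
      using frechet_derivative_at by metis
    then have "grad_within (closure \<Omega>) u y = k y *\<^sub>R (\<Sum>b\<in>Basis. ((y - c) \<bullet> b) *\<^sub>R b)"
      by (simp add: grad_within_def scaleR_sum_right)
    then show ?thesis by (simp only: euclidean_representation norm_scaleR)
  qed
  have pos: "0 < norm (y - c)" if "y \<in> closure \<Omega>" for y
  proof -
    have "closure \<Omega> \<subseteq> {y. s * r \<le> norm (y - c)}"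
      by (intro closure_minimal closed_Collect_le continuous_intros) (auto simp: \<Omega>_iff)
    then show ?thesis using that sr by force
  qed
  \<comment> \<open>The gradient on the boundary is obtained as the limit of the interior gradient,
    by the continuity up to the boundary contained in \<open>torsion_solution\<close>.\<close>
  have diff: "continuous_on (closure \<Omega>) (\<lambda>y. norm (grad_within (closure \<Omega>) u y) - \<bar>k y\<bar> * norm (y - c))"
  proof -
    have "continuous_on (closure \<Omega>) (grad_within (closure \<Omega>) u)" using sol by (simp add: torsion_solution_def)
    then show ?thesis unfolding k_def using pos by (intro continuous_intros) fastforce+
  qed
  have "norm (grad_within (closure \<Omega>) u y) - \<bar>k y\<bar> * norm (y - c) = 0" if "y \<in> closure \<Omega>" for y
    by (rule continuous_constant_on_closure[OF diff _ that]) (simp add: grad)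
  then have gradc: "norm (grad_within (closure \<Omega>) u y) = \<bar>k y\<bar> * norm (y - c)" if "y \<in> frontier \<Omega>" for y
    using that by (simp add: frontier_def)
  have go: "norm (grad_within (closure \<Omega>) u y) = s * (1 - R\<^sup>2)" if "y \<in> \<Gamma>o" for y
  proof -
    have n: "norm (y - c) = s" using that by (simp add: io dist_norm norm_minus_commute)
    have "k y = R\<^sup>2 - 1" using s by (simp add: k_def n)
    moreover have "R\<^sup>2 < 1" using R by (simp add: power_less_one_iff)
    ultimately show ?thesis using gradc[of y] that b(1) n by simp
  qed
  have gi: "norm (grad_within (closure \<Omega>) u y) = s * ((R\<^sup>2 - r\<^sup>2) / r)" if "y \<in> \<Gamma>i" for y
  proof -
    have n: "norm (y - c) = s * r" using that by (simp add: io dist_norm norm_minus_commute)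
    have "k y = (R\<^sup>2 - r\<^sup>2) / r\<^sup>2" using s r by (simp add: k_def n power_mult_distrib diff_divide_distrib)
    moreover have "r\<^sup>2 < R\<^sup>2" using r by (intro power_strict_mono) auto
    ultimately show ?thesis using gradc[of y] that b(1) n r s by (simp add: power2_eq_square)
  qed
  define e where "e = R\<^sup>2 * eta (1 / R\<^sup>2)"
  have e0: "0 < e" using R inv_square_gt_one[OF R] by (simp add: e_def eta_pos)
  have umax: "u_max \<Omega> u = s\<^sup>2 * (e / 2)"
  proof -
    have val: "u y = s\<^sup>2 * (e / 2 - R\<^sup>2 / 2 * eta ((norm (y - c) / s)\<^sup>2 / R\<^sup>2))" if "y \<in> \<Omega>" for y
    proof -
      have "0 < norm (y - c)" using that \<Omega>_iff sr by (meson less_trans)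
      then have "(y - c) /\<^sub>R s \<noteq> 0" using s by auto
      moreover have "norm ((y - c) /\<^sub>R s) = norm (y - c) / s" using s by (simp add: divide_inverse mult.commute)
      moreover have "u y = s\<^sup>2 * model_solution R ((y - c) /\<^sub>R s)" using that closure_subset by (intro u) blast
      ultimately show ?thesis using model_solution_eq_eta[OF R(1), of "(y - c) /\<^sub>R s"]
        by (simp add: e_def right_diff_distrib)
    qed
    have eta_nonneg: "0 \<le> eta x" if "0 < x" for x
      using eta_pos[OF that] by (cases "x = 1") auto
    have le: "u y \<le> s\<^sup>2 * (e / 2)" if "y \<in> \<Omega>" for y
    proof -
      have "0 < norm (y - c)" using that \<Omega>_iff sr by (meson less_trans)
      then have "0 < (norm (y - c) / s)\<^sup>2 / R\<^sup>2" using s R by simp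
      then have "0 \<le> R\<^sup>2 / 2 * eta ((norm (y - c) / s)\<^sup>2 / R\<^sup>2)" by (intro mult_nonneg_nonneg eta_nonneg) auto
      then show ?thesis unfolding val[OF that] by (intro mult_left_mono) auto
    qed
    \<comment> \<open>A point of the core circle, where the squared radius ratio is \<open>1\<close>
      and the subtracted \<open>eta\<close> term vanishes.\<close>
    define y where "y = c + (s * R) *\<^sub>R axis 1 1"
    have ny: "norm (y - c) = s * R" using s R by (simp add: y_def)
    have y: "y \<in> \<Omega>" using s r R by (simp add: \<Omega>_iff ny)
    have "u y = s\<^sup>2 * (e / 2)" using val[OF y] s R by (simp add: ny)
    moreover have "bdd_above (u ` \<Omega>)" using le by (rule bdd_aboveI2)
    ultimately show ?thesis
      unfolding u_max_def using y le by (intro antisym cSUP_upper2[of _ _ y] cSUP_least) auto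
  qed
  have root: "sqrt (2 * u_max \<Omega> u) = s * sqrt e"
    using s by (simp add: umax real_sqrt_mult)
  have e_eq: "1 - R\<^sup>2 + 2 * R\<^sup>2 * ln R = e" using model_max_eq_eta[OF R(1)] by (simp add: e_def)
  have "(SUP x\<in>\<Gamma>o. norm (grad_within (closure \<Omega>) u x)) = s * (1 - R\<^sup>2)"
    using go b(5) by simp
  then show "NWSS \<Omega> u \<Gamma>o = tau_outer R"
    using s R by (simp add: NWSS_def root tau_outer_def e_eq)
  have "(SUP x\<in>\<Gamma>i. norm (grad_within (closure \<Omega>) u x)) = s * ((R\<^sup>2 - r\<^sup>2) / r)"
    using gi b(4) by simp
  then show "NWSS \<Omega> u \<Gamma>i = tau_inner R"
    using s R by (simp add: NWSS_def root tau_inner_def e_eq r_def)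
qed

text \<open>The scale is the outer radius \<open>sqrt (a * xo)\<close>. The maxima lie at radius
  \<open>sqrt a\<close>, so the core radius after rescaling is \<open>1 / sqrt xo\<close>.\<close>

lemma equivalent_model_intro:
  assumes a: "0 < a" and x: "0 < xi" "xi < 1" "1 < xo" "eta xi = eta xo" "eta xo = 2 * m / a"
    and \<Omega>: "to_complex ` \<Omega> = {z. sqrt (a * xi) < cmod (z - z0) \<and> cmod (z - z0) < sqrt (a * xo)}"
    and u: "\<And>z. z \<in> closure (to_complex ` \<Omega>) \<Longrightarrow> u (of_complex z) = m - a / 2 * eta ((cmod (z - z0))\<^sup>2 / a)"
  shows "equivalent_pairs \<Omega> u (model_domain (1 / sqrt xo)) (model_solution (1 / sqrt xo))"
proof -
  define s where "s = sqrt (a * xo)"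
  define R where "R = 1 / sqrt xo"
  have s: "0 < s" "s\<^sup>2 = a * xo" using a x by (auto simp: s_def)
  have R: "0 < R" "R < 1" "R\<^sup>2 = 1 / xo" using x by (auto simp: R_def power_divide)
  have r: "r_inner R = R * sqrt xi" by (rule r_inner_eq[OF R(1,2) x(1,2)]) (simp add: R(3) x)
  have dist: "cmod (to_complex y - z0) = norm (y - of_complex z0)" for y
    by (metis linear_diff linear_to_complex(1) norm_to_complex(1) to_of_complex(1))
  have \<Omega>_iff: "y \<in> \<Omega> \<longleftrightarrow> sqrt (a * xi) < norm (y - of_complex z0) \<and> norm (y - of_complex z0) < s" for y
  proof -
    have "y \<in> \<Omega> \<longleftrightarrow> to_complex y \<in> to_complex ` \<Omega>" by simp
    then show ?thesis unfolding \<Omega> by (simp add: dist s_def)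
  qed
  have sr: "s * r_inner R = sqrt (a * xi)"
    unfolding r unfolding s_def R_def using x by (simp add: real_sqrt_mult)
  have "\<Omega> = (\<lambda>x. of_complex z0 + s *\<^sub>R x) ` model_domain R"
  proof (intro set_eqI)
    fix y
    have "y \<in> (\<lambda>x. of_complex z0 + s *\<^sub>R x) ` model_domain R \<longleftrightarrow> (y - of_complex z0) /\<^sub>R s \<in> model_domain R"
      using s(1) by (auto intro!: image_eqI[of _ _ "(y - of_complex z0) /\<^sub>R s"])
    also have "\<dots> \<longleftrightarrow> s * r_inner R < norm (y - of_complex z0) \<and> norm (y - of_complex z0) < s"
    proof -
      have "norm ((y - of_complex z0) /\<^sub>R s) = norm (y - of_complex z0) / s"
        using s(1) by (simp add: divide_inverse mult.commute)
      then show ?thesis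
        unfolding model_domain_def mem_Collect_eq
        using s(1) by (simp add: pos_less_divide_eq pos_divide_less_eq mult.commute)
    qed
    finally show "y \<in> \<Omega> \<longleftrightarrow> y \<in> (\<lambda>x. of_complex z0 + s *\<^sub>R x) ` model_domain R"
      using \<Omega>_iff[of y] sr by simp
  qed
  moreover have "u y = s\<^sup>2 * model_solution R ((y - of_complex z0) /\<^sub>R s)" if y: "y \<in> closure \<Omega>" for y
  proof -
    have "closure \<Omega> \<subseteq> {y. sqrt (a * xi) \<le> norm (y - of_complex z0)}"
      by (intro closure_minimal closed_Collect_le continuous_intros) (auto simp: \<Omega>_iff)
    moreover have "0 < sqrt (a * xi)" using a x by simp
    ultimately have n: "0 < norm (y - of_complex z0)" using y by force
    have "(norm ((y - of_complex z0) /\<^sub>R s))\<^sup>2 / R\<^sup>2 = (norm (y - of_complex z0))\<^sup>2 / a"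
    proof -
      have "norm ((y - of_complex z0) /\<^sub>R s) = norm (y - of_complex z0) / s"
        using s(1) by (simp add: divide_inverse mult.commute)
      then show ?thesis using s(2) R(3) x a by (simp add: power_divide)
    qed
    then have "s\<^sup>2 * model_solution R ((y - of_complex z0) /\<^sub>R s)
        = s\<^sup>2 * (R\<^sup>2 / 2 * (eta (1 / R\<^sup>2) - eta ((norm (y - of_complex z0))\<^sup>2 / a)))"
      using model_solution_eq_eta[OF R(1), of "(y - of_complex z0) /\<^sub>R s"] n s by simp
    also have "\<dots> = a / 2 * (2 * m / a - eta ((norm (y - of_complex z0))\<^sup>2 / a))"
      using s(2) R(3) x by simp
    also have "\<dots> = m - a / 2 * eta ((norm (y - of_complex z0))\<^sup>2 / a)"
      using a by (simp add: field_simps)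
    also have "\<dots> = u y"
      using u[of "to_complex y"] y by (simp add: closure_to_complex dist)
    finally show ?thesis by simp
  qed
  ultimately show ?thesis
    unfolding equivalent_pairs_def R_def[symmetric] using s(1) by blast
qed

theorem theorem4:
  fixes \<Omega> \<Gamma>\<^sub>i \<Gamma>\<^sub>o :: "(real^2) set" and u :: "real^2 \<Rightarrow> real"
  assumes "ring_shaped_domain \<Omega> \<Gamma>\<^sub>i \<Gamma>\<^sub>o"
    and "torsion_solution \<Omega> u"
    and "infinite (max_points \<Omega> u)"
    and "NWSS \<Omega> u \<Gamma>\<^sub>o < sqrt 2"
  shows "\<exists>R\<^sub>o R\<^sub>i. expected_core_radius \<Omega> u \<Gamma>\<^sub>o = Some R\<^sub>o \<and>
           expected_core_radius \<Omega> u \<Gamma>\<^sub>i = Some R\<^sub>i \<and>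
           R\<^sub>o \<ge> R\<^sub>i \<and> R\<^sub>i > 0 \<and>
           (R\<^sub>o = R\<^sub>i \<longleftrightarrow>
              (\<exists>R\<in>{0<..<1}. equivalent_pairs \<Omega> u (model_domain R) (model_solution R))) \<and>
           (\<forall>R\<in>{0<..<1}. equivalent_pairs \<Omega> u (model_domain R) (model_solution R) \<longrightarrow>
              R\<^sub>o = R \<and> R\<^sub>i = R)"
proof -
  define N where "N x = norm (grad_within (closure \<Omega>) u x)" for x
  define \<tau>o \<tau>i where "\<tau>o = NWSS \<Omega> u \<Gamma>\<^sub>o" and "\<tau>i = NWSS \<Omega> u \<Gamma>\<^sub>i"
  interpret T: ring_torsion "to_complex ` \<Omega>" "\<lambda>z. u (of_complex z)" "analytic_gradient u"
    "\<lambda>z. N (of_complex z)" "to_complex ` \<Gamma>\<^sub>i" "to_complex ` \<Gamma>\<^sub>o"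
    unfolding N_def by (rule ring_torsion_transfer[OF assms(1,2)])
  note b = ring_boundary[OF assms(1)]
  have m: "T.m = u_max \<Omega> u" by (simp add: T.m_def u_max_def image_image)
  have "T.M = to_complex ` max_points \<Omega> u" by (auto simp: T.M_def max_points_def m)
  then have inf: "infinite T.M"
    using assms(3) finite_image_iff[OF inj_on_subset[OF bij_is_inj[OF bij_to_complex] subset_UNIV]] by simp
  have contN: "continuous_on (closure \<Omega>) N"
    unfolding N_def using assms(2) by (intro continuous_on_norm) (simp add: torsion_solution_def)
  have bounds: "0 \<le> NWSS \<Omega> u \<Gamma> \<and> (\<forall>x\<in>\<Gamma>. N x \<le> NWSS \<Omega> u \<Gamma> * sqrt (2 * T.m))"
    if \<Gamma>: "compact \<Gamma>" "\<Gamma> \<noteq> {}" "\<Gamma> \<subseteq> frontier \<Omega>" for \<Gamma>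
  proof -
    have "continuous_on \<Gamma> N" by (rule continuous_on_subset[OF contN]) (use \<Gamma>(3) in \<open>auto simp: frontier_def\<close>)
    then have bdd: "bdd_above (N ` \<Gamma>)"
      using \<Gamma>(1) by (intro bounded_imp_bdd_above compact_imp_bounded compact_continuous_image)
    have up: "N x \<le> (SUP x\<in>\<Gamma>. N x)" if "x \<in> \<Gamma>" for x using bdd that by (rule cSUP_upper[rotated])
    have eq: "(SUP x\<in>\<Gamma>. N x) = NWSS \<Omega> u \<Gamma> * sqrt (2 * T.m)"
      using T.m_pos by (simp add: NWSS_def N_def m)
    obtain x where "x \<in> \<Gamma>" using \<Gamma>(2) by blast
    then have "0 \<le> (SUP x\<in>\<Gamma>. N x)" using up[of x] by (metis N_def norm_ge_zero order_trans)
    then have "0 \<le> NWSS \<Omega> u \<Gamma>" using T.m_pos unfolding eq by (simp add: zero_le_mult_iff)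
    with up eq show ?thesis by simp
  qed
  have bo: "0 \<le> \<tau>o" "\<And>z. z \<in> to_complex ` \<Gamma>\<^sub>o \<Longrightarrow> 0 \<le> N (of_complex z) \<and> N (of_complex z) \<le> \<tau>o * sqrt (2 * T.m)"
    using bounds[OF b(7,5)] b(1) by (auto simp: \<tau>o_def N_def)
  have bi: "0 \<le> \<tau>i" "\<And>z. z \<in> to_complex ` \<Gamma>\<^sub>i \<Longrightarrow> 0 \<le> N (of_complex z) \<and> N (of_complex z) \<le> \<tau>i * sqrt (2 * T.m)"
    using bounds[OF b(6,4)] b(1) by (auto simp: \<tau>i_def N_def)
  have \<tau>o2: "\<tau>o < sqrt 2" using assms(4) by (simp add: \<tau>o_def)
  note main = T.core_radius_comparison[OF inf bo(1) \<tau>o2 bi(1) bo(2) bi(2)]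
  obtain xo where xo: "1 < xo" "shear xo = \<tau>o\<^sup>2"
  proof (rule shear_surj_outer[of "\<tau>o\<^sup>2"])
    show "1 < \<tau>o\<^sup>2" using main(1) by simp
    show "\<tau>o\<^sup>2 < 2" using bo(1) \<tau>o2 power_strict_mono[of \<tau>o "sqrt 2" 2] by simp
  qed
  obtain xi where xi: "0 < xi" "xi < 1" "shear xi = \<tau>i\<^sup>2"
  proof (rule shear_surj_inner[of "\<tau>i\<^sup>2"])
    show "2 < \<tau>i\<^sup>2" using main(2) power_strict_mono[of "sqrt 2" \<tau>i 2] by simp
  qed
  \<comment> \<open>A core radius is measured relative to the outer circle, so the inner root
    \<open>xi\<close> is replaced by the root above \<open>1\<close> at the same level of
    \<open>eta\<close>.\<close>
  obtain x' where x': "1 < x'" "eta x' = eta xi"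
    using eta_surj_outer[OF eta_pos[of xi]] xi by auto
  define Ro Ri where "Ro = 1 / sqrt xo" and "Ri = 1 / sqrt x'"
  have Ro: "0 < Ro" "Ro < 1" "1 / Ro\<^sup>2 = xo" using xo by (auto simp: Ro_def power_divide)
  have Ri: "0 < Ri" "Ri < 1" "1 / Ri\<^sup>2 = x'" using x' by (auto simp: Ri_def power_divide)
  have "tau_outer Ro = \<tau>o" using tau_outer_eq[OF Ro(1,2)] bo(1) by (simp add: Ro(3) xo(2))
  then have inv_o: "the_inv_into {0..<1} tau_outer \<tau>o = Ro"
    using the_inv_into_f_f[OF tau_outer_inj, of Ro] Ro by simp
  have "tau_inner Ri = \<tau>i" using tau_inner_eq[OF Ri(1,2) xi(1,2)] bi(1) x'(2) by (simp add: Ri(3) xi(3))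
  then have inv_i: "the_inv_into {0<..1} tau_inner \<tau>i = Ri"
    using the_inv_into_f_f[OF tau_inner_inj, of Ri] Ri by simp
  have R_eqs: "expected_core_radius \<Omega> u \<Gamma>\<^sub>o = Some Ro" "expected_core_radius \<Omega> u \<Gamma>\<^sub>i = Some Ri"
    using main(1,2) \<tau>o2 inv_o inv_i sqrt2_less_2 real_sqrt_ge_one[of 2]
    by (auto simp: expected_core_radius_def \<tau>o_def[symmetric] \<tau>i_def[symmetric])
  have le: "eta xo \<le> eta x'" using main(3)[OF _ _ xo xi] x'(2) by simp
  then have "xo \<le> x'" using eta_less[of x' xo] x'(1) by (meson less_imp_le not_le)
  then have RiRo: "Ri \<le> Ro" using xo(1) by (simp add: Ri_def Ro_def frac_le)
  have model: "Ro = R \<and> Ri = R"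
    if R: "R \<in> {0<..<1}" and eqv: "equivalent_pairs \<Omega> u (model_domain R) (model_solution R)" for R
  proof -
    have R': "0 < R" "R < 1" using R by auto
    have "\<tau>o = tau_outer R" "\<tau>i = tau_inner R"
      unfolding \<tau>o_def \<tau>i_def by (rule model_NWSS[OF assms(1,2) R' eqv])+
    then show ?thesis
      using inv_o inv_i the_inv_into_f_f[OF tau_outer_inj, of R] the_inv_into_f_f[OF tau_inner_inj, of R] R' by simp
  qed
  have rigid: "\<exists>R\<in>{0<..<1}. equivalent_pairs \<Omega> u (model_domain R) (model_solution R)" if eq: "Ro = Ri"
  proof -
    have "xo = x'" using eq Ro(3) Ri(3) by simp
    then have e: "eta xo = eta xi" using x'(2) by simp
    obtain z0 a where a: "0 < a" "eta xo = 2 * T.m / a"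
      "to_complex ` \<Omega> = {z. sqrt (a * xi) < cmod (z - z0) \<and> cmod (z - z0) < sqrt (a * xo)}"
      "\<forall>z\<in>closure (to_complex ` \<Omega>). u (of_complex z) = T.m - a / 2 * eta ((cmod (z - z0))\<^sup>2 / a)"
      using main(4)[OF _ _ xo xi e] by blast
    have "equivalent_pairs \<Omega> u (model_domain Ro) (model_solution Ro)"
      unfolding Ro_def
      using equivalent_model_intro[OF a(1) xi(1,2) xo(1) e[symmetric] a(2,3), of u] a(4) by blast
    then show ?thesis using Ro by auto
  qed
  show ?thesis
    using R_eqs RiRo Ri(1) model rigid by (intro exI[of _ Ro] exI[of _ Ri]) auto
qed

end
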